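(* For every $N\in\mathbb C$ and $\hbar\ne0$, $$\tau_N(\mathbf t,\hbar)=e^{\hbar\widehat W_N}\cdot1=\sum_{k\ge0}\frac{\hbar^k}{k!}\widehat W_N^{\,k}\cdot 1,$$ where $$\widehat W_N=\frac12\sum_{k,m\ge0}(2k+1)(2m+1)t_{2k+1}t_{2m+1}\frac{\partial}{\partial t_{2k+2m+1}}+\frac14\sum_{k,m\ge0}(2k+2m+3)t_{2k+2m+3}\frac{\partial^2}{\partial t_{2k+1}\partial t_{2m+1}}+\Big(\frac1{16}-\frac{N^2}{4}\Big)t_1 .$$ Equivalently, writing $\tau_N=1+\sum_{k\ge1}\hbar^k\tau_N^{(k)}$ with $\tau^{(k)}_N$ independent of $\hbar$, one has $\tau_N^{(k+1)}=\frac1{k+1}\widehat W_N\tau_N^{(k)}$. Moreover, every formal power series in the odd times solving the Virasoro constraints $\hbar\widehat{\mathcal L}^{(N)}_mZ=\partial Z/\partial t_{2m+1}$ ($m\ge0$) equals $C\,e^{\hbar\widehat W_N}\cdot1$ for a constant $C$. In particular (case $N=0$) $\tau_{BGW}=e^{\hbar\widehat W_{0}}\cdot 1$.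
   Context: For $k\ge1$ and $j\in\mathbb C$ put $a_k(j)=\prod_{i=1}^k\big(4(j-1)^2-(2i-1)^2\big)$, and for $j\in\mathbb Z$ let $\Phi^{(N)}_j(\lambda)=\lambda^{j-1}\big(1+\sum_{k\ge1}\frac{(-\hbar)^k a_k(j-N)}{16^k k!}\lambda^{-k}\big)$. The generalized BGW tau-function $\tau_N(\mathbf t,\hbar)$ is the formal power series in $\mathbf t=(t_1,t_2,\dots)$ such that for every $M\ge1$, under $t_k=\frac1k\sum_{i=1}^M\lambda_i^{-k}$, $\tau_N=\det_{i,j=1}^M\big(\Phi^{(N)}_j(\lambda_i)\big)/\prod_{i<j}(\lambda_j-\lambda_i)$; $\tau_{BGW}=\tau_0$. The Virasoro operators are $\widehat{\mathcal L}^{(N)}_m=\frac12\sum_{k\ge0}(2k+1)t_{2k+1}\frac{\partial}{\partial t_{2k+2m+1}}+\frac14\sum_{a+b=m-1,\ a,b\ge0}\frac{\partial^2}{\partial t_{2a+1}\partial t_{2b+1}}+\big(\frac1{16}-\frac{N^2}{4}\big)\delta_{m,0}$. *)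

theory Defs
  imports "HOL-Analysis.Analysis" "HOL-Library.Multiset" "HOL-Combinatorics.Permutations"
begin

text \<open>Formal power series in countably many variables (indexed by nat) with complex
coefficients: a monomial is a finite multiset of variable indices, a series is its
coefficient function.  For the times t_1, t_2, ... the index k stands for t_k; for the
Miwa variables x_0, ..., x_(M-1) the index i stands for x_i.\<close>

type_synonym mser = "nat multiset \<Rightarrow> complex"

definition fone :: mser where
  "fone C = (if C = {#} then 1 else 0)"

definition fmul :: "mser \<Rightarrow> mser \<Rightarrow> mser" where
  "fmul f g C = (\<Sum>A\<in>{A. A \<subseteq># C}. f A * g (C - A))"

definition fprod_list :: "mser list \<Rightarrow> mser" where
  "fprod_list fs = foldr fmul fs fone"

definition fdet :: "nat \<Rightarrow> (nat \<Rightarrow> nat \<Rightarrow> mser) \<Rightarrow> mser" where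
  "fdet M A C = (\<Sum>\<sigma>\<in>{\<sigma>. \<sigma> permutes {..<M}}.
      of_int (sign \<sigma>) * fprod_list (map (\<lambda>i. A i (\<sigma> i)) [0..<M]) C)"

text \<open>Power sum p_k = sum_(i<M) x_i^k in the Miwa variables x_i = lambda_i^(-1).\<close>
definition psum :: "nat \<Rightarrow> nat \<Rightarrow> mser" where
  "psum M k C = (if \<exists>i<M. C = replicate_mset k i then 1 else 0)"

text \<open>Miwa substitution t_k = (1/k) p_k(x) into a series in the times (indices \<ge> 1).
Only t-monomials of weight equal to the x-degree contribute, so the sum is finite.\<close>
definition miwa :: "nat \<Rightarrow> mser \<Rightarrow> mser" where
  "miwa M \<tau> C = (\<Sum>T\<in>{T. 0 \<notin># T \<and> sum_mset T = size C}.
      \<tau> T * fprod_list (map (\<lambda>k. (\<lambda>D. psum M k D / of_nat k)) (sorted_list_of_multiset T)) C)"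

definition a_coef :: "nat \<Rightarrow> complex \<Rightarrow> complex" where
  "a_coef k j = (\<Prod>i=1..k. 4 * (j - 1)^2 - (2 * of_nat i - 1)^2)"

text \<open>Coefficient of lambda^(j-1-k) in Phi^(N)_j(lambda).\<close>
definition phi_coef :: "complex \<Rightarrow> complex \<Rightarrow> int \<Rightarrow> nat \<Rightarrow> complex" where
  "phi_coef N hb j k = (- hb)^k * a_coef k (of_int j - N) / (16^k * fact k)"

text \<open>After multiplying row i by lambda_i^(-(M-1)) = x_i^(M-1), the (i,j) entry
(0-indexed, j' = j+1 in the paper) becomes x_i^(M-1-j) * (1 + sum_k c_k x_i^k).\<close>
definition phi_entry :: "complex \<Rightarrow> complex \<Rightarrow> nat \<Rightarrow> nat \<Rightarrow> nat \<Rightarrow> mser" where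
  "phi_entry N hb M i j C =
     (if set_mset C \<subseteq> {i} \<and> M - 1 - j \<le> size C
      then phi_coef N hb (int j + 1) (size C - (M - 1 - j)) else 0)"

text \<open>Vandermonde entries, treated the same way: x_i^(M-1-j).\<close>
definition vand_entry :: "nat \<Rightarrow> nat \<Rightarrow> nat \<Rightarrow> mser" where
  "vand_entry M i j C = (if C = replicate_mset (M - 1 - j) i then 1 else 0)"

definition is_tau :: "complex \<Rightarrow> complex \<Rightarrow> mser \<Rightarrow> bool" where
  "is_tau N hb \<tau> \<longleftrightarrow> (\<forall>T. 0 \<in># T \<longrightarrow> \<tau> T = 0) \<and>
     (\<forall>M\<ge>1. fmul (miwa M \<tau>) (fdet M (vand_entry M)) = fdet M (phi_entry N hb M))"

definition tauN :: "complex \<Rightarrow> complex \<Rightarrow> mser" where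
  "tauN N hb = (THE \<tau>. is_tau N hb \<tau>)"

definition tmul :: "nat \<Rightarrow> mser \<Rightarrow> mser" where
  "tmul k F T = (if k \<in># T then F (T - {#k#}) else 0)"

definition dt :: "nat \<Rightarrow> mser \<Rightarrow> mser" where
  "dt k F T = of_nat (count T k + 1) * F (T + {#k#})"

definition Wop :: "complex \<Rightarrow> mser \<Rightarrow> mser" where
  "Wop N F T =
     1/2 * (\<Sum>\<^sub>\<infinity>(k,m)\<in>UNIV. of_nat ((2*k+1)*(2*m+1)) *
              tmul (2*k+1) (tmul (2*m+1) (dt (2*k+2*m+1) F)) T)
   + 1/4 * (\<Sum>\<^sub>\<infinity>(k,m)\<in>UNIV. of_nat (2*k+2*m+3) *
              tmul (2*k+2*m+3) (dt (2*k+1) (dt (2*m+1) F)) T)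
   + (1/16 - N^2/4) * tmul 1 F T"

definition expW :: "complex \<Rightarrow> complex \<Rightarrow> mser" where
  "expW N hb T = (\<Sum>k. hb^k / fact k * ((Wop N ^^ k) fone) T)"

definition Lvir :: "complex \<Rightarrow> nat \<Rightarrow> mser \<Rightarrow> mser" where
  "Lvir N m F T =
     1/2 * (\<Sum>\<^sub>\<infinity>k\<in>UNIV. of_nat (2*k+1) * tmul (2*k+1) (dt (2*k+2*m+1) F) T)
   + 1/4 * (\<Sum>a<m. dt (2*a+1) (dt (2*(m-1-a)+1) F) T)
   + (if m = 0 then 1/16 - N^2/4 else 0) * F T"

end

theory Submission
  imports Defs "HOL-Computational_Algebra.Formal_Power_Series" "Jordan_Normal_Form.Determinant"
begin

text \<open>Grade by the degree in the Miwa variables \<open>x\<^sub>i = 1 / \<lambda>\<^sub>i\<close>. For an even number of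
variables the relation \<open>\<lambda>\<^sup>2 \<Phi>\<^sub>j = \<Phi>\<^sub>j\<^sub>+\<^sub>2 + (j - N) \<hbar> \<Phi>\<^sub>j\<^sub>+\<^sub>1\<close> reduces the determinant of the
\<open>\<Phi>\<^sub>j(\<lambda>\<^sub>i)\<close> to that of \<open>f, g, \<lambda>\<^sup>2 f, \<lambda>\<^sup>2 g, \<dots>\<close> with \<open>f = \<Phi>\<^sub>1\<close>, \<open>g = \<Phi>\<^sub>2\<close>, and this is the
product of all \<open>\<lambda>\<^sub>i + \<lambda>\<^sub>j\<close> times the Pfaffian of the kernel \<open>(f\<^sub>i g\<^sub>j - g\<^sub>i f\<^sub>j) / (\<lambda>\<^sub>i + \<lambda>\<^sub>j)\<close>. By Bessel's
equation the kernel, hence the Pfaffian, satisfies an evolution equation in which the variables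
do not interact. Dividing by the product of the \<open>(\<lambda>\<^sub>j - \<lambda>\<^sub>i) / (\<lambda>\<^sub>i + \<lambda>\<^sub>j)\<close> conjugates this equation into
the Miwa form of \<open>E \<tau> = \<hbar> W \<tau>\<close>, where \<open>E\<close> is the Euler operator and \<open>W\<close> the cut-and-join operator; as \<open>W\<close>
raises the weight by one, the solution with constant term 1 is \<open>e\<^sup>\<hbar>\<^sup>W 1\<close>. The identity
\<open>W = \<Sum>\<^sub>m (2m+1) t\<^sub>2\<^sub>m\<^sub>+\<^sub>1 L\<^sub>m\<close> turns the Virasoro constraints into the same equation.\<close>

hide_const (open) Determinants.det
no_notation vec_index (infixl "$" 100)
unbundle no vec_syntax
unbundle fps_syntax

section \<open>Evaluation of series in the Miwa variables\<close>

text \<open>The \<open>\<Phi>_j\<close> are in general divergent expansions, so there is no function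
  of \<open>\<lambda>\<close> to differentiate. Everything is therefore evaluated at numerical
  points, with a formal variable \<open>X\<close> recording the degree: each coefficient of a power
  of \<open>X\<close> is a rational function of the points, can be differentiated in the ordinary
  sense, and is determined by its values at generic points. Up to leading powers, \<open>hb\<close>
  occurs only as \<open>hb / \<lambda>\<close>; hence the Euler operator is \<open>X d/dX\<close>
  and the evolution equation is a recursion on the order in \<open>X\<close>. Conjugation by the
  Vandermonde ratio \<open>V\<close> would leave a potential, the sum of the
  \<open>\<lambda>_i d_i^2 V\<close> divided by \<open>V\<close>. It vanishes because
  \<open>V\<close> is itself a Pfaffian of the family, for a value of \<open>N\<close> at which the
  flow stands still. Pfaffians force an even number of variables, whereas the tau-function is
  specified for every \<open>M\<close>; an odd \<open>M\<close> is reached from \<open>M + 1\<close>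
  by letting one \<open>x_i\<close> vanish. Since \<open>tauN\<close> is a definite description, the
  Miwa substitutions for all \<open>M\<close> together must also be shown to be injective.\<close>

definition monval :: "(nat \<Rightarrow> complex) \<Rightarrow> nat multiset \<Rightarrow> complex" where
  "monval xi C = (\<Prod>i\<in>#C. xi i)"

lemma monval_simps [simp]: "monval xi {#} = 1" "monval xi (add_mset a C) = xi a * monval xi C"
  "monval xi (A + B) = monval xi A * monval xi B" "monval xi (replicate_mset k i) = xi i ^ k"
  by (simp_all add: monval_def)

definition msets :: "nat \<Rightarrow> nat \<Rightarrow> nat multiset set" where
  "msets M d = {C. set_mset C \<subseteq> {..<M} \<and> size C = d}"

lemma finite_msets_size: "finite A \<Longrightarrow> finite {C. set_mset C \<subseteq> A \<and> size C = (d::nat)}"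
proof (induction d)
  case (Suc d)
  have "{C. set_mset C \<subseteq> A \<and> size C = Suc d} \<subseteq>
     (\<lambda>(a, C). add_mset a C) ` (A \<times> {C. set_mset C \<subseteq> A \<and> size C = d})"
  proof
    fix C assume C: "C \<in> {C. set_mset C \<subseteq> A \<and> size C = Suc d}"
    then obtain a D where "C = add_mset a D" by (auto simp: size_eq_Suc_imp_eq_union dest: size_eq_Suc_imp_eq_union)
    thus "C \<in> (\<lambda>(a, C). add_mset a C) ` (A \<times> {C. set_mset C \<subseteq> A \<and> size C = d})" using C by auto
  qed
  thus ?case using Suc by (auto intro: finite_subset)
qed (auto intro: finite_subset[of _ "{{#}}"])

lemma finite_msets [simp]: "finite (msets M d)"
  unfolding msets_def by (rule finite_msets_size) simp

lemma finite_submsets [simp]: "finite {A. A \<subseteq># (C :: nat multiset)}"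
proof (rule finite_subset)
  show "{A. A \<subseteq># C} \<subseteq> (\<Union>d\<le>size C. {A. set_mset A \<subseteq> set_mset C \<and> size A = d})"
    by (auto simp: size_mset_mono dest: mset_subset_eqD)
  show "finite (\<Union>d\<le>size C. {A. set_mset A \<subseteq> set_mset C \<and> size A = d})"
    using finite_msets_size by auto
qed

text \<open>Substitutes \<open>xi i * X\<close> for \<open>x_i\<close> when \<open>i < M\<close> and
  0 for the other variables. Every coefficient is a finite sum, so no convergence is
  involved.\<close>

definition ev :: "nat \<Rightarrow> (nat \<Rightarrow> complex) \<Rightarrow> mser \<Rightarrow> complex fps" where
  "ev M xi f = Abs_fps (\<lambda>d. \<Sum>C\<in>msets M d. f C * monval xi C)"

lemma ev_nth: "ev M xi f $ d = (\<Sum>C\<in>msets M d. f C * monval xi C)"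
  by (simp add: ev_def)

lemma ev_fmul: "ev M xi (fmul f g) = ev M xi f * ev M xi g"
proof (rule fps_ext)
  fix d
  have "ev M xi (fmul f g) $ d = (\<Sum>C\<in>msets M d. \<Sum>A\<in>{A. A \<subseteq># C}. f A * g (C - A) * monval xi C)"
    by (simp add: ev_nth fmul_def sum_distrib_right)
  also have "\<dots> = (\<Sum>(C,A)\<in>Sigma (msets M d) (\<lambda>C. {A. A \<subseteq># C}). f A * g (C - A) * monval xi C)"
    by (rule sum.Sigma) auto
  \<comment> \<open>A monomial with a chosen divisor is an ordered factorisation, here sorted by the
    degree of its first factor.\<close>
  also have "\<dots> = (\<Sum>(i,A,B)\<in>(SIGMA i:{0..d}. msets M i \<times> msets M (d-i)). f A * monval xi A * (g B * monval xi B))"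
    by (rule sum.reindex_bij_witness[where i="\<lambda>(i,A,B). (A+B,A)" and j="\<lambda>(C,A). (size A, A, C - A)"])
       (auto simp: msets_def size_mset_mono size_Diff_submset subset_mset.le_iff_add)
  also have "\<dots> = (\<Sum>i=0..d. \<Sum>(A,B)\<in>msets M i \<times> msets M (d-i). f A * monval xi A * (g B * monval xi B))"
    by (subst sum.Sigma) (auto simp: case_prod_unfold)
  also have "\<dots> = (ev M xi f * ev M xi g) $ d"
    by (simp add: fps_mult_nth ev_nth sum_product sum.cartesian_product)
  finally show "ev M xi (fmul f g) $ d = (ev M xi f * ev M xi g) $ d" .
qed

lemma ev_fone: "ev M xi fone = 1"
proof (rule fps_ext)
  fix d
  show "ev M xi fone $ d = 1 $ d"
  proof (cases "d = 0")
    case True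
    have "msets M 0 = {{#}}" by (auto simp: msets_def)
    thus ?thesis using True by (simp add: ev_nth fone_def)
  next
    case False
    thus ?thesis by (auto simp: ev_nth fone_def msets_def intro!: sum.neutral)
  qed
qed

lemma ev_fprod_list: "ev M xi (fprod_list fs) = (\<Prod>f\<leftarrow>fs. ev M xi f)"
  by (induction fs) (simp_all add: fprod_list_def ev_fone ev_fmul)

lemma ev_sum: "ev M xi (\<lambda>C. \<Sum>i\<in>I. of_int (a i) * h i C) = (\<Sum>i\<in>I. of_int (a i) * ev M xi (h i))"
proof (rule fps_ext)
  fix d
  have nth_of_int: "(of_int z * F) $ d = of_int z * F $ d" for z and F :: "complex fps"
    by (metis fps_const_mult_left fps_nth_Abs_fps fps_of_int)
  show "ev M xi (\<lambda>C. \<Sum>i\<in>I. of_int (a i) * h i C) $ d = (\<Sum>i\<in>I. of_int (a i) * ev M xi (h i)) $ d"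
    unfolding ev_nth fps_sum_nth nth_of_int
    by (simp add: sum_distrib_right sum_distrib_left mult.assoc) (rule sum.swap)
qed

lemma ev_fdet: "ev M xi (fdet M A) =
   (\<Sum>\<sigma>\<in>{\<sigma>. \<sigma> permutes {..<M}}. of_int (sign \<sigma>) * (\<Prod>i<M. ev M xi (A i (\<sigma> i))))"
proof -
  have eq: "fdet M A = (\<lambda>C. \<Sum>\<sigma>\<in>{\<sigma>. \<sigma> permutes {..<M}}.
      of_int (sign \<sigma>) * fprod_list (map (\<lambda>i. A i (\<sigma> i)) [0..<M]) C)"
    by (auto simp: fdet_def)
  have pl: "(\<Prod>i\<leftarrow>[0..<M]. h i) = (\<Prod>i<M. h i)" for h :: "nat \<Rightarrow> complex fps"
    by (induction M) (simp_all add: lessThan_Suc mult.commute)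
  show ?thesis
    unfolding eq ev_sum ev_fprod_list by (simp add: o_def pl)
qed

lemma ev_psum:
  assumes "k > 0"
  shows "ev M xi (\<lambda>D. psum M k D / of_nat k) = fps_const ((\<Sum>i<M. xi i ^ k) / of_nat k) * fps_X ^ k"
proof (rule fps_ext)
  fix d
  let ?h = "\<lambda>C. psum M k C / of_nat k * monval xi C"
  have sub: "replicate_mset k ` {..<M} \<subseteq> msets M k"
    using assms by (auto simp: msets_def)
  have zero: "?h C = 0" if "C \<notin> replicate_mset k ` {..<M}" for C
    using that by (auto simp: psum_def)
  have inj: "inj_on (replicate_mset k) {..<M}"
    using assms by (intro inj_onI) (metis count_replicate_mset less_numeral_extra(3))
  have "sum ?h (msets M d) = (if d = k then (\<Sum>i<M. xi i ^ k) / of_nat k else 0)"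
  proof (cases "d = k")
    case True
    have "sum ?h (msets M k) = sum ?h (replicate_mset k ` {..<M})"
      using sub zero by (intro sum.mono_neutral_right) auto
    also have "\<dots> = (\<Sum>i<M. ?h (replicate_mset k i))"
      using inj by (simp add: sum.reindex)
    also have "\<dots> = (\<Sum>i<M. xi i ^ k / of_nat k)"
      by (intro sum.cong) (auto simp: psum_def)
    finally show ?thesis using True by (simp add: sum_divide_distrib)
  next
    case False
    have "?h C = 0" if "C \<in> msets M d" for C
      using that False by (intro zero) (auto simp: msets_def)
    thus ?thesis using False by (simp add: sum.neutral)
  qed
  thus "ev M xi (\<lambda>D. psum M k D / of_nat k) $ d =
     (fps_const ((\<Sum>i<M. xi i ^ k) / of_nat k) * fps_X ^ k) $ d"
    by (simp add: ev_nth fps_X_power_mult_right_nth)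
qed

text \<open>Excluding the index 0, which has weight 0, leaves only finitely many monomials of each
  weight.\<close>

definition Wt :: "nat \<Rightarrow> nat multiset set" where
  "Wt d = {T. 0 \<notin># T \<and> sum_mset T = d}"

lemma size_le_sum_mset: "0 \<notin># T \<Longrightarrow> size T \<le> sum_mset (T :: nat multiset)"
  by (induction T) auto

lemma mem_le_sum_mset: "(i :: nat) \<in># T \<Longrightarrow> i \<le> sum_mset T"
  by (metis insert_DiffM le_add1 sum_mset.add_mset)

lemma finite_Wt [simp]: "finite (Wt d)"
proof (rule finite_subset)
  show "Wt d \<subseteq> (\<Union>n\<le>d. {C. set_mset C \<subseteq> {..d} \<and> size C = n})"
    using size_le_sum_mset mem_le_sum_mset by (auto simp: Wt_def)
  show "finite (\<Union>n\<le>d. {C. set_mset C \<subseteq> {..d} \<and> size C = n})"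
    using finite_msets_size[of "{..d}"] by auto
qed

definition miwa_time :: "nat \<Rightarrow> (nat \<Rightarrow> complex) \<Rightarrow> nat \<Rightarrow> complex" where
  "miwa_time M xi k = (\<Sum>i<M. xi i ^ k) / of_nat k"

lemma ev_fprod_psum:
  assumes "0 \<notin># T"
  shows "ev M xi (fprod_list (map (\<lambda>k. (\<lambda>D. psum M k D / of_nat k)) (sorted_list_of_multiset T))) =
     fps_const (monval (miwa_time M xi) T) * fps_X ^ sum_mset T"
proof -
  have *: "(\<Prod>k\<leftarrow>ks. ev M xi (\<lambda>D. psum M k D / of_nat k)) =
      fps_const (monval (miwa_time M xi) (mset ks)) * fps_X ^ sum_mset (mset ks)"
    if "0 \<notin> set ks" for ks
    using that
    by (induction ks) (simp_all add: ev_psum power_add miwa_time_def flip: fps_const_mult)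
  show ?thesis
    using *[of "sorted_list_of_multiset T"] assms by (simp add: ev_fprod_list o_def)
qed

lemma ev_miwa: "ev M xi (miwa M \<tau>) $ d = (\<Sum>T\<in>Wt d. \<tau> T * monval (miwa_time M xi) T)"
proof -
  let ?f = "\<lambda>T. fprod_list (map (\<lambda>k. (\<lambda>D. psum M k D / of_nat k)) (sorted_list_of_multiset T))"
  have "ev M xi (miwa M \<tau>) $ d = (\<Sum>C\<in>msets M d. \<Sum>T\<in>Wt d. \<tau> T * (?f T C * monval xi C))"
    by (auto simp: ev_nth miwa_def sum_distrib_right Wt_def msets_def mult.assoc intro!: sum.cong)
  also have "\<dots> = (\<Sum>T\<in>Wt d. \<Sum>C\<in>msets M d. \<tau> T * (?f T C * monval xi C))"
    by (rule sum.swap)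
  also have "\<dots> = (\<Sum>T\<in>Wt d. \<tau> T * ev M xi (?f T) $ d)"
    by (simp add: ev_nth sum_distrib_left)
  also have "\<dots> = (\<Sum>T\<in>Wt d. \<tau> T * monval (miwa_time M xi) T)"
    by (rule sum.cong) (auto simp: ev_fprod_psum Wt_def fps_X_power_mult_right_nth)
  finally show ?thesis .
qed

section \<open>Recovering a series from its values at generic points\<close>

definition in_vars :: "nat \<Rightarrow> mser \<Rightarrow> bool" where
  "in_vars M f \<longleftrightarrow> (\<forall>C. f C \<noteq> 0 \<longrightarrow> set_mset C \<subseteq> {..<M})"

lemma in_vars_fmul: "in_vars M f \<Longrightarrow> in_vars M g \<Longrightarrow> in_vars M (fmul f g)"
  unfolding in_vars_def
proof (intro allI impI)
  fix C assume f: "\<forall>C. f C \<noteq> 0 \<longrightarrow> set_mset C \<subseteq> {..<M}" and g: "\<forall>C. g C \<noteq> 0 \<longrightarrow> set_mset C \<subseteq> {..<M}"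
    and C: "fmul f g C \<noteq> 0"
  obtain A where A: "A \<subseteq># C" "f A * g (C - A) \<noteq> 0"
    using sum.not_neutral_contains_not_neutral[OF C[unfolded fmul_def]] by auto
  have "set_mset C \<subseteq> set_mset A \<union> set_mset (C - A)"
    using A(1) by (metis set_mset_union subset_mset.add_diff_inverse subset_refl)
  thus "set_mset C \<subseteq> {..<M}" using A f g by fastforce
qed

lemma in_vars_fprod_list: "(\<And>f. f \<in> set fs \<Longrightarrow> in_vars M f) \<Longrightarrow> in_vars M (fprod_list fs)"
  by (induction fs) (auto simp: fprod_list_def intro!: in_vars_fmul, auto simp: in_vars_def fone_def)

lemma in_vars_sum: "(\<And>i. i \<in> I \<Longrightarrow> in_vars M (h i)) \<Longrightarrow> in_vars M (\<lambda>C. \<Sum>i\<in>I. a i * h i C)"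
  unfolding in_vars_def
  by (metis (no_types, lifting) mult_zero_right sum.neutral)

lemma in_vars_fdet:
  assumes "\<And>i j. i < M \<Longrightarrow> j < M \<Longrightarrow> in_vars M (A i j)"
  shows "in_vars M (fdet M A)"
  unfolding fdet_def[abs_def]
  by (rule in_vars_sum, rule in_vars_fprod_list)
     (use assms permutes_in_image in fastforce)

lemma in_vars_miwa: "in_vars M (miwa M \<tau>)"
proof -
  have "in_vars M (fprod_list (map (\<lambda>k. (\<lambda>D. psum M k D / of_nat k)) (sorted_list_of_multiset T)))" for T
    by (rule in_vars_fprod_list) (auto simp: in_vars_def psum_def split: if_splits)
  thus ?thesis unfolding in_vars_def miwa_def
    by (metis (no_types, lifting) mult_zero_right sum.neutral)
qed

text \<open>These are the points where the quantities \<open>x_i\<close>, \<open>x_i - x_j\<close>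
  and \<open>x_i + x_j\<close> met in the Vandermonde and Pfaffian computations are nonzero; the
  condition is invariant under inverting all coordinates.\<close>

definition generic :: "nat \<Rightarrow> (nat \<Rightarrow> complex) \<Rightarrow> bool" where
  "generic M xi \<longleftrightarrow> (\<forall>i<M. xi i \<noteq> 0) \<and> (\<forall>i<M. \<forall>j<M. i \<noteq> j \<longrightarrow> xi i \<noteq> xi j \<and> xi i + xi j \<noteq> 0)"

text \<open>Kronecker substitution: at \<open>xi\<^sub>i = z ^ B ^ i\<close> distinct monomials with exponents below \<open>B\<close> become
distinct powers of \<open>z\<close>, and the point is generic as soon as \<open>|z| > 1\<close>.\<close>
lemma kronecker_inj:
  assumes "(\<Sum>i<M. a i * B ^ i) = (\<Sum>i<M. b i * B ^ i)" "\<And>i. i < M \<Longrightarrow> a i < B" "\<And>i. i < M \<Longrightarrow> b i < B"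
    "i < M"
  shows "a i = (b i :: nat)"
  using assms
proof (induction M arbitrary: a b i)
  case (Suc M)
  have split: "(\<Sum>i<Suc M. c i * B ^ i) = c 0 + B * (\<Sum>i<M. c (Suc i) * B ^ i)" for c
    by (subst sum.lessThan_Suc_shift) (simp add: sum_distrib_left mult_ac)
  have eq: "a 0 + B * (\<Sum>i<M. a (Suc i) * B ^ i) = b 0 + B * (\<Sum>i<M. b (Suc i) * B ^ i)"
    using Suc.prems(1) unfolding split .
  have lt: "a 0 < B" "b 0 < B" using Suc.prems(2,3) by auto
  have "a 0 = b 0" using arg_cong[OF eq, of "\<lambda>x. x mod B"] lt by simp
  moreover have "(\<Sum>i<M. a (Suc i) * B ^ i) = (\<Sum>i<M. b (Suc i) * B ^ i)"
    using arg_cong[OF eq, of "\<lambda>x. x div B"] lt by simp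
  hence "a (Suc i) = b (Suc i)" if "i < M" for i
    using Suc.IH[where a="\<lambda>i. a (Suc i)" and b="\<lambda>i. b (Suc i)" and i=i] Suc.prems(2,3) that by auto
  ultimately show ?case using Suc.prems(4) by (cases i) auto
qed simp

lemma monval_kronecker:
  assumes "set_mset C \<subseteq> {..<M}"
  shows "monval (\<lambda>i. z ^ (B ^ i)) C = z ^ (\<Sum>i<M. count C i * B ^ i)"
  using assms
proof (induction C)
  case (add x C)
  have "(\<Sum>i<M. count (add_mset x C) i * B ^ i) = (\<Sum>i<M. (if i = x then B ^ i else 0) + count C i * B ^ i)"
    by (rule sum.cong) auto
  also have "\<dots> = B ^ x + (\<Sum>i<M. count C i * B ^ i)"
    using add.prems by (simp add: sum.distrib)
  finally show ?case using add by (simp add: power_add)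
qed simp

lemma generic_kronecker:
  assumes "B > 1" "z = of_real r" "r > 1"
  shows "generic M (\<lambda>i. z ^ (B ^ i))"
proof -
  have z: "z ^ n = of_real (r ^ n)" for n using assms(2) by simp
  have ne: "r ^ B ^ i \<noteq> r ^ B ^ j" if "i \<noteq> j" for i j
    using assms(1,3) that by (simp add: power_inject_exp)
  have pos: "r ^ B ^ i + r ^ B ^ j \<noteq> 0" for i j
    using assms(3) by (smt (verit) zero_less_power)
  have "z ^ B ^ i \<noteq> z ^ B ^ j \<and> z ^ B ^ i + z ^ B ^ j \<noteq> 0" if "i \<noteq> j" for i j
    using ne[OF that] pos[of i j] unfolding z of_real_eq_iff of_real_add[symmetric] of_real_eq_0_iff by simp
  thus ?thesis using assms by (auto simp: generic_def)
qed

text \<open>Along the Kronecker points the sum becomes a polynomial in one variable whose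
  coefficients are the \<open>f C\<close>, since the base \<open>B\<close> digits of an exponent
  recover the monomial. It has infinitely many roots.\<close>

lemma generic_monomials_independent:
  assumes fin: "finite S" and S: "\<And>C. C \<in> S \<Longrightarrow> set_mset C \<subseteq> {..<M}"
    and zero: "\<And>xi. generic M xi \<Longrightarrow> (\<Sum>C\<in>S. f C * monval xi C) = 0"
    and C: "C \<in> S"
  shows "f C = 0"
proof -
  \<comment> \<open>Larger than every exponent that occurs; adding 2 rather than 1 makes
    \<open>B > 1\<close> also when all monomials are constant, as genericity of the points
    requires.\<close>
  define B where "B = Max (size ` S) + 2"
  have cnt: "count C i < B" if "C \<in> S" for C i
  proof -
    have "count C i \<le> size C" by (metis count_le_replicate_mset_subset_eq size_mset_mono size_replicate_mset order_refl)
    also have "size C \<le> Max (size ` S)" using fin that by auto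
    finally show ?thesis by (simp add: B_def)
  qed
  define e where "e C = (\<Sum>i<M. count C i * B ^ i)" for C
  have inj: "inj_on e S"
  proof (rule inj_onI)
    fix C D assume CD: "C \<in> S" "D \<in> S" "e C = e D"
    have "count C i = count D i" for i
    proof (cases "i < M")
      case True
      thus ?thesis using kronecker_inj[where a="count C" and b="count D" and B=B and M=M and i=i] CD cnt by (auto simp: e_def)
    next
      case False
      thus ?thesis using S[of C] S[of D] CD by (metis count_inI lessThan_iff subsetD)
    qed
    thus "C = D" by (rule multiset_eqI)
  qed
  define p where "p = (\<Sum>C\<in>S. Polynomial.monom (f C) (e C))"
  have "poly p z = (\<Sum>C\<in>S. f C * monval (\<lambda>i. z ^ (B ^ i)) C)" for z
    unfolding p_def poly_sum poly_monom
    by (rule sum.cong) (auto simp: monval_kronecker[OF S] e_def)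
  hence "poly p (of_real r) = 0" if "r > 1" for r
    using zero[OF generic_kronecker[of B "of_real r" r M]] that by (simp add: B_def)
  hence "complex_of_real ` {1<..} \<subseteq> {z. poly p z = 0}" by auto
  moreover have "infinite (complex_of_real ` {1<..})"
    by (subst finite_image_iff) (auto simp: inj_on_def infinite_Ioi)
  ultimately have "p = 0" using poly_roots_finite finite_subset by blast
  hence "0 = Polynomial.coeff p (e C)" by simp
  also have "\<dots> = (\<Sum>D\<in>S. if D = C then f C else 0)"
    unfolding p_def coeff_sum using inj C by (intro sum.cong) (auto simp: inj_on_def)
  also have "\<dots> = f C" using fin C by simp
  finally show ?thesis by simp
qed

text \<open>Each homogeneous component involves finitely many monomials, to which their independence
  on generic points applies. The support hypotheses settle the remaining monomials, which
  \<open>ev\<close> cannot see.\<close>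

lemma ev_eqI:
  assumes "in_vars M f" "in_vars M g" "\<And>xi. generic M xi \<Longrightarrow> ev M xi f = ev M xi g"
  shows "f = g"
proof
  fix C
  show "f C = g C"
  proof (cases "set_mset C \<subseteq> {..<M}")
    case True
    have "f C - g C = 0"
    proof (rule generic_monomials_independent[where S="msets M (size C)" and M=M and f="\<lambda>C. f C - g C"])
      fix xi assume "generic M xi"
      thus "(\<Sum>C\<in>msets M (size C). (f C - g C) * monval xi C) = 0"
        using assms(3)[of xi] by (simp add: left_diff_distrib sum_subtractf flip: ev_nth)
    qed (use True in \<open>simp_all\<close>, simp_all add: msets_def)
    thus ?thesis by simp
  next
    case False
    thus ?thesis using assms(1,2) unfolding in_vars_def by metis
  qed
qed

section \<open>Determinants with paired columns as Pfaffians\<close>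

definition del_nth :: "nat \<Rightarrow> 'a list \<Rightarrow> 'a list" where
  "del_nth l xs = take l xs @ drop (Suc l) xs"

lemma length_del [simp]: "l < length xs \<Longrightarrow> length (del_nth l xs) = length xs - 1"
  by (simp add: del_nth_def)

lemma nth_del: "l < length xs \<Longrightarrow> i < length xs - 1 \<Longrightarrow> del_nth l xs ! i = xs ! (if i < l then i else Suc i)"
  by (auto simp: del_nth_def nth_append)

lemma map_del: "map f (del_nth l xs) = del_nth l (map f xs)"
  by (simp add: del_nth_def take_map drop_map)

lemma mset_del: "l < length xs \<Longrightarrow> mset xs = add_mset (xs ! l) (mset (del_nth l xs))"
  by (subst id_take_nth_drop[of l xs], assumption) (simp add: del_nth_def)

lemma distinct_del: "distinct xs \<Longrightarrow> l < length xs \<Longrightarrow> distinct (del_nth l xs)"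
  by (simp add: del_nth_def set_take_disj_set_drop_if_distinct)

lemma set_del: "distinct xs \<Longrightarrow> l < length xs \<Longrightarrow> set (del_nth l xs) = set xs - {xs ! l}"
proof -
  assume d: "distinct xs" and l: "l < length xs"
  have "mset_set (set xs) = add_mset (xs ! l) (mset_set (set (del_nth l xs)))"
    using mset_del[OF l] by (simp add: mset_set_set d distinct_del l)
  hence "mset_set (set (del_nth l xs)) = mset_set (set xs) - {#xs ! l#}" by simp
  also have "\<dots> = mset_set (set xs - {xs ! l})" using l by (subst mset_set_Diff) auto
  finally show ?thesis by simp
qed

text \<open>Expansion of the Pfaffian along its first row. Only entries whose first argument comes
  earlier in the list are read; lists of odd length give 0.\<close>

function pf :: "('b \<Rightarrow> 'b \<Rightarrow> 'a::comm_ring_1) \<Rightarrow> 'b list \<Rightarrow> 'a" where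
  "pf A [] = 1"
| "pf A (x # xs) = (\<Sum>l<length xs. (-1) ^ l * A x (xs ! l) * pf A (del_nth l xs))"
  by pat_completeness auto
termination by (relation "Wellfounded.measure (\<lambda>(A, xs). length xs)") auto

text \<open>A row \<open>(a, b, x)\<close> stands for \<open>(a, b, x\<^sup>2 a, x\<^sup>2 b, x\<^sup>4 a, \<dots>)\<close>; it depends on \<open>x\<close> only up to sign.\<close>
type_synonym row = "complex fps \<times> complex fps \<times> complex"

fun row_entry :: "row \<Rightarrow> nat \<Rightarrow> complex fps" where
  "row_entry (a, b, x) j = (if even j then a else b) * fps_const ((x\<^sup>2) ^ (j div 2))"

definition rowmat :: "row list \<Rightarrow> complex fps mat" where
  "rowmat rs = mat (length rs) (length rs) (\<lambda>(i, j). row_entry (rs ! i) j)"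

lemma rowmat_carrier [simp]: "rowmat rs \<in> carrier_mat (length rs) (length rs)"
  by (simp add: rowmat_def)

lemma det_first_row_linear:
  assumes "\<And>j. j < Suc (length rs) \<Longrightarrow> row_entry r j = (\<Sum>l\<in>S. c l * row_entry (q l) j)"
  shows "det (rowmat (r # rs)) = (\<Sum>l\<in>S. c l * det (rowmat (q l # rs)))"
proof -
  have cof: "cofactor (rowmat (q' # rs)) 0 j = cofactor (rowmat (r # rs)) 0 j" for j q'
    unfolding cofactor_def
    by (intro arg_cong2[of _ _ _ _ "(*)"] arg_cong[of _ _ det] refl eq_matI)
       (auto simp: rowmat_def mat_delete_def)
  have ex: "det (rowmat (q' # rs)) = (\<Sum>j<Suc (length rs). row_entry q' j * cofactor (rowmat (r # rs)) 0 j)" for q'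
  proof -
    have "rowmat (q' # rs) $$ (0, j) = row_entry q' j" if "j < Suc (length rs)" for j
      using that by (simp add: rowmat_def)
    thus ?thesis
      by (subst laplace_expansion_row[OF rowmat_carrier, of 0])
         (auto simp: cof[of q'] simp del: row_entry.simps sum.lessThan_Suc intro!: sum.cong)
  qed
  have "det (rowmat (r # rs)) =
      (\<Sum>j<Suc (length rs). (\<Sum>l\<in>S. c l * row_entry (q l) j) * cofactor (rowmat (r # rs)) 0 j)"
    unfolding ex[of r] by (rule sum.cong) (use assms in auto)
  also have "\<dots> = (\<Sum>l\<in>S. c l * det (rowmat (q l # rs)))"
    unfolding ex[of "q _"] sum_distrib_right sum_distrib_left
    by (subst sum.swap) (simp add: mult.assoc)
  finally show ?thesis .
qed

lemma det_move_row:
  assumes "l < length rs"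
  shows "det (rowmat (r # rs)) = (-1) ^ Suc l * det (rowmat (rs ! l # r # del_nth l rs))"
proof -
  have "swap_row_to_front (rowmat (r # rs)) (Suc l) = rowmat (rs ! l # r # del_nth l rs)"
    by (subst swap_row_to_front_result[OF rowmat_carrier])
       (use assms in \<open>auto simp: rowmat_def nth_Cons nth_del split: nat.splits intro!: eq_matI\<close>)
  hence "det (rowmat (rs ! l # r # del_nth l rs)) = (-1) ^ Suc l * det (rowmat (r # rs))"
    using swap_row_to_front_det[OF rowmat_carrier, of "Suc l" "r # rs"] assms by simp
  thus ?thesis by (simp add: minus_one_power_iff)
qed

text \<open>Right multiplication by the unitriangular matrix with \<open>- c\<close> on its
  \<open>k\<close>-th superdiagonal changes all columns at once, each by an original column. The
  value \<open>k = 2\<close> suits paired columns, \<open>k = 1\<close> the Vandermonde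
  matrix.\<close>

lemma sub_column_det:
  fixes A :: "'a::idom mat"
  assumes A: "A \<in> carrier_mat n n" and "k > 0"
  shows "det A = det (mat n n (\<lambda>(i, j). A $$ (i, j) - (if j < k then 0 else c * A $$ (i, j - k))))"
proof -
  define U where "U = mat n n (\<lambda>(i, j). if i = j then 1 else if j = i + k then - c else 0 :: 'a)"
  have U: "U \<in> carrier_mat n n" by (simp add: U_def)
  have "upper_triangular U" unfolding upper_triangular_def by (auto simp: U_def)
  hence "det U = prod_list (diag_mat U)" using U by (rule det_upper_triangular)
  also have "diag_mat U = map (\<lambda>i. 1) [0..<n]" by (auto simp: diag_mat_def U_def)
  finally have detU: "det U = 1" by (simp add: map_replicate_const)
  have "A * U = mat n n (\<lambda>(i, j). A $$ (i, j) - (if j < k then 0 else c * A $$ (i, j - k)))"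
  proof (rule eq_matI)
    fix i j assume "i < dim_row (mat n n (\<lambda>(i, j). A $$ (i, j) - (if j < k then 0 else c * A $$ (i, j - k))))"
      and "j < dim_col (mat n n (\<lambda>(i, j). A $$ (i, j) - (if j < k then 0 else c * A $$ (i, j - k))))"
    hence ij: "i < n" "j < n" by auto
    have "(A * U) $$ (i, j) = (\<Sum>h\<in>{0..<n}. A $$ (i, h) * (if h = j then 1 else if j = h + k then - c else 0))"
      using ij A U by (simp add: scalar_prod_def U_def)
    also have "\<dots> = (\<Sum>h\<in>{0..<n}. (if h = j then A $$ (i, j) else 0) +
         (if h = j - k then (if j < k then 0 else - c * A $$ (i, j - k)) else 0))"
      using \<open>k > 0\<close> by (intro sum.cong) auto
    also have "\<dots> = A $$ (i, j) - (if j < k then 0 else c * A $$ (i, j - k))"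
      using ij by (simp add: sum.distrib less_imp_diff_less)
    finally show "(A * U) $$ (i, j) =
        mat n n (\<lambda>(i, j). A $$ (i, j) - (if j < k then 0 else c * A $$ (i, j - k))) $$ (i, j)"
      using ij by simp
  qed (use A U in auto)
  thus ?thesis using det_mult[OF A U] detU by simp
qed

lemma det_scale_rows:
  assumes "B \<in> carrier_mat n n"
  shows "det (mat n n (\<lambda>(i, j). c i * B $$ (i, j))) = (\<Prod>i<n. c i) * det (B :: 'a::comm_ring_1 mat)"
proof -
  have "det (mat n n (\<lambda>(i, j). c i * B $$ (i, j))) =
     (\<Sum>p | p permutes {0..<n}. signof p * (\<Prod>i = 0..<n. c i * B $$ (i, p i)))"
    by (subst det_def'[of _ n]) (auto intro!: sum.cong prod.cong)
  also have "\<dots> = (\<Prod>i<n. c i) * det B"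
    by (subst det_def'[OF assms]) (simp add: prod.distrib sum_distrib_left mult_ac lessThan_atLeast0)
  finally show ?thesis .
qed

lemma det_two_by_two:
  assumes A: "A \<in> carrier_mat 2 2"
  shows "det A = A $$ (0, 0) * A $$ (1, 1) - A $$ (0, 1) * A $$ (1, 0)"
proof -
  have c: "mat_delete A 0 j \<in> carrier_mat 1 1" for j
    using mat_delete_carrier[OF A, of 0 j] by simp
  have "det A = (\<Sum>j<2. A $$ (0, j) * cofactor A 0 j)"
    by (rule laplace_expansion_row[OF A]) simp
  also have "\<dots> = A $$ (0, 0) * cofactor A 0 0 + A $$ (0, 1) * cofactor A 0 1"
    by (simp add: numeral_2_eq_2)
  also have "cofactor A 0 0 = A $$ (1, 1)"
    unfolding cofactor_def det_single[OF c] using A by (simp add: mat_delete_def)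
  also have "cofactor A 0 1 = - A $$ (1, 0)"
    unfolding cofactor_def det_single[OF c] using A by (simp add: mat_delete_def)
  finally show ?thesis by simp
qed

text \<open>Subtracting \<open>x\<^sup>2\<close> times column \<open>j - 2\<close> from column
  \<open>j\<close> clears the two rows with node \<open>x\<close> beyond their first two entries and
  turns any other row, from there on, into a shifted copy of itself times a difference of squared
  nodes. The result is block triangular.\<close>

lemma det_equal_node_rows:
  "det (rowmat ((a, b, x) # (c, d, x) # rs)) =
     (a * d - b * c) * (\<Prod>r\<leftarrow>rs. fps_const ((snd (snd r))\<^sup>2 - x\<^sup>2)) * det (rowmat rs)"
proof -
  let ?n = "length rs"
  let ?rs = "(a, b, x) # (c, d, x) # rs"
  define B where "B = mat (2 + ?n) (2 + ?n) (\<lambda>(i, j). rowmat ?rs $$ (i, j) -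
      (if j < 2 then 0 else fps_const (x\<^sup>2) * rowmat ?rs $$ (i, j - 2)))"
  define A1 where "A1 = mat 2 2 (\<lambda>(i, j). row_entry (?rs ! i) j)"
  define A3 where "A3 = mat ?n 2 (\<lambda>(i, j). row_entry (rs ! i) j)"
  define A4 where "A4 = mat ?n ?n (\<lambda>(i, j). fps_const ((snd (snd (rs ! i)))\<^sup>2 - x\<^sup>2) * rowmat rs $$ (i, j))"
  have step: "row_entry r j - fps_const (x\<^sup>2) * row_entry r (j - 2) = fps_const ((snd (snd r))\<^sup>2 - x\<^sup>2) * row_entry r (j - 2)"
    if "\<not> j < 2" for r j
  proof -
    obtain p q z where r: "r = (p, q, z)" by (cases r)
    define i where "i = j - 2"
    have j: "j = i + 2" using that by (simp add: i_def)
    show ?thesis unfolding j r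
      by (simp add: algebra_simps flip: fps_const_sub fps_const_mult)
  qed
  have "det (rowmat ?rs) = det B"
    unfolding B_def by (rule sub_column_det) (simp_all add: rowmat_def)
  also have "B = four_block_mat A1 (0\<^sub>m 2 ?n) A3 A4"
  proof (rule eq_matI)
    fix i j assume "i < dim_row (four_block_mat A1 (0\<^sub>m 2 ?n) A3 A4)" "j < dim_col (four_block_mat A1 (0\<^sub>m 2 ?n) A3 A4)"
    hence ij: "i < 2 + ?n" "j < 2 + ?n" by (auto simp: A1_def A4_def)
    have e: "B $$ (i, j) = (if j < 2 then row_entry (?rs ! i) j else fps_const ((snd (snd (?rs ! i)))\<^sup>2 - x\<^sup>2) * row_entry (?rs ! i) (j - 2))"
    proof (cases "j < 2")
      case True
      thus ?thesis using ij by (simp add: B_def rowmat_def)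
    next
      case False
      have "B $$ (i, j) = row_entry (?rs ! i) j - fps_const (x\<^sup>2) * row_entry (?rs ! i) (j - 2)"
        using False ij by (simp add: B_def rowmat_def del: row_entry.simps)
      thus ?thesis using step[OF False] False by simp
    qed
    have "i = 0 \<or> i = 1 \<or> (\<exists>k. i = k + 2)" by presburger
    then consider "i = 0" | "i = 1" | k where "i = k + 2" "k < ?n"
      using ij by auto
    thus "B $$ (i, j) = four_block_mat A1 (0\<^sub>m 2 ?n) A3 A4 $$ (i, j)"
      unfolding e using ij
      by cases (simp_all add: A1_def A3_def A4_def rowmat_def del: row_entry.simps)
  qed (auto simp: B_def A1_def A4_def)
  also have "det \<dots> = det A1 * det A4"
    by (rule det_four_block_mat_upper_right_zero) (auto simp: A1_def A3_def A4_def)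
  also have "det A1 = a * d - b * c"
  proof -
    have "det A1 = A1 $$ (0, 0) * A1 $$ (1, 1) - A1 $$ (0, 1) * A1 $$ (1, 0)"
      by (rule det_two_by_two) (simp add: A1_def)
    thus ?thesis by (simp add: A1_def)
  qed
  also have "det A4 = (\<Prod>i<?n. fps_const ((snd (snd (rs ! i)))\<^sup>2 - x\<^sup>2)) * det (rowmat rs)"
    unfolding A4_def by (rule det_scale_rows) simp
  also have "(\<Prod>i<?n. fps_const ((snd (snd (rs ! i)))\<^sup>2 - x\<^sup>2)) = (\<Prod>r\<leftarrow>rs. fps_const ((snd (snd r))\<^sup>2 - x\<^sup>2))"
    by (simp add: prod.list_conv_set_nth lessThan_atLeast0)
  finally show ?thesis by (simp add: mult.assoc)
qed

text \<open>Lagrange interpolation at the nodes \<open>- (ys ! l)\<close>. The minus signs are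
  invisible for even \<open>m\<close> but turn the numerators into the factors \<open>x + z\<close>
  from which \<open>pair_sums\<close> is built.\<close>

lemma lagrange_power:
  fixes ys :: "complex list"
  assumes "distinct ys" "m < length ys"
  shows "x ^ m = (\<Sum>l<length ys. (\<Prod>z\<leftarrow>del_nth l ys. (x + z) / (z - ys ! l)) * (- (ys ! l)) ^ m)"
proof -
  define c where "c l = (\<Prod>z\<leftarrow>del_nth l ys. z - ys ! l)" for l
  define q where "q = (\<Sum>l<length ys. Polynomial.smult ((- (ys ! l)) ^ m / c l) (\<Prod>z\<leftarrow>del_nth l ys. [:z, 1:]))"
  have c: "c l \<noteq> 0" if "l < length ys" for l
  proof -
    have "0 \<notin> set (map (\<lambda>z. z - ys ! l) (del_nth l ys))"
      unfolding set_map set_del[OF assms(1) that] by auto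
    thus ?thesis unfolding c_def prod_list_zero_iff .
  qed
  have poly_pl: "poly (\<Prod>z\<leftarrow>zs. [:z, 1:]) x = (\<Prod>z\<leftarrow>zs. x + z)" for zs :: "complex list" and x
    by (induction zs) (auto simp: algebra_simps)
  have deg_pl: "degree (\<Prod>z\<leftarrow>zs. [:z, 1:]) \<le> length zs" for zs :: "complex list"
  proof (induction zs)
    case (Cons z zs)
    thus ?case using degree_mult_le[of "[:z, 1:]" "\<Prod>z\<leftarrow>zs. [:z, 1:]"] by simp
  qed simp
  have "q = Polynomial.monom 1 m"
  proof (rule poly_eqI_degree[where A="uminus ` set ys"])
    have card: "card (uminus ` set ys) = length ys"
      using assms(1) by (simp add: card_image distinct_card)
    show "card (uminus ` set ys) > degree (Polynomial.monom (1::complex) m)"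
      using assms(2) by (simp add: card degree_monom_eq)
    have "degree q \<le> length ys - 1"
      unfolding q_def
    proof (rule degree_sum_le)
      fix l assume "l \<in> {..<length ys}"
      hence "degree (\<Prod>z\<leftarrow>del_nth l ys. [:z, 1:]) \<le> length ys - 1"
        using deg_pl[of "del_nth l ys"] by simp
      thus "degree (Polynomial.smult ((- (ys ! l)) ^ m / c l) (\<Prod>z\<leftarrow>del_nth l ys. [:z, 1:])) \<le> length ys - 1"
        by (rule order_trans[OF degree_smult_le])
    qed simp
    thus "card (uminus ` set ys) > degree q" using assms(2) by (simp add: card)
    fix y assume "y \<in> uminus ` set ys"
    then obtain k where k: "k < length ys" "y = - (ys ! k)" by (auto simp: in_set_conv_nth)
    have "poly q y = (\<Sum>l<length ys. if l = k then (- (ys ! k)) ^ m else 0)"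
      unfolding q_def poly_sum poly_smult poly_pl
    proof (rule sum.cong)
      fix l assume l: "l \<in> {..<length ys}"
      show "(- (ys ! l)) ^ m / c l * (\<Prod>z\<leftarrow>del_nth l ys. y + z) = (if l = k then (- (ys ! k)) ^ m else 0)"
      proof (cases "l = k")
        case True
        have "(\<Prod>z\<leftarrow>del_nth l ys. y + z) = c l" by (simp add: c_def k True)
        thus ?thesis using True c l by simp
      next
        case False
        have "ys ! k \<in> set (del_nth l ys)" using set_del[OF assms(1)] l k False assms(1) by (auto simp: nth_eq_iff_index_eq)
        hence "0 \<in> set (map (\<lambda>z. y + z) (del_nth l ys))" by (force simp: k(2))
        hence "(\<Prod>z\<leftarrow>del_nth l ys. y + z) = 0" by (simp only: prod_list_zero_iff)
        thus ?thesis using False by simp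
      qed
    qed simp
    thus "poly q y = poly (Polynomial.monom 1 m) y" using k by (simp add: poly_monom)
  qed
  hence "x ^ m = poly q x" by (simp add: poly_monom)
  also have "\<dots> = (\<Sum>l<length ys. (\<Prod>z\<leftarrow>del_nth l ys. (x + z) / (z - ys ! l)) * (- (ys ! l)) ^ m)"
  proof -
    have "(\<Prod>z\<leftarrow>zs. (x + z) / (z - y)) = (\<Prod>z\<leftarrow>zs. x + z) / (\<Prod>z\<leftarrow>zs. z - y)" for zs y
      by (induction zs) simp_all
    thus ?thesis unfolding q_def poly_sum poly_smult poly_pl c_def by (simp add: mult.commute)
  qed
  finally show ?thesis .
qed

context
  fixes f g :: "complex \<Rightarrow> complex fps"
begin

definition row_det :: "complex list \<Rightarrow> complex fps" where
  "row_det xs = det (rowmat (map (\<lambda>x. (f x, g x, x)) xs))"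

definition pair_kernel :: "complex \<Rightarrow> complex \<Rightarrow> complex fps" where
  "pair_kernel x y = fps_const (1 / (x + y)) * (f x * g y - g x * f y)"

lemma fps_const_prod_list: "(\<Prod>z\<leftarrow>zs. fps_const (h z)) = fps_const (\<Prod>z\<leftarrow>zs. h z :: complex)"
  by (induction zs) (simp_all flip: fps_const_mult)

text \<open>The entries of a row are even polynomials in its node, so Lagrange interpolation at the
nodes \<open>- y\<^sub>l\<close> replaces the node of the first row by the node \<open>y\<^sub>l\<close> of another row.\<close>
lemma row_det_rec:
  assumes "distinct ys" "odd (length ys)"
  shows "row_det (x # ys) = (\<Sum>l<length ys. (-1) ^ l * (f x * g (ys ! l) - g x * f (ys ! l)) *
     fps_const (\<Prod>z\<leftarrow>del_nth l ys. (x + z) * (ys ! l + z)) * row_det (del_nth l ys))"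
proof -
  let ?r = "\<lambda>x. (f x, g x, x)"
  define L where "L l = (\<Prod>z\<leftarrow>del_nth l ys. (x + z) / (z - ys ! l))" for l
  have "row_det (x # ys) = (\<Sum>l<length ys. fps_const (L l) * det (rowmat ((f x, g x, ys ! l) # map ?r ys)))"
    unfolding row_det_def list.map
  proof (rule det_first_row_linear)
    fix j assume j: "j < Suc (length (map ?r ys))"
    \<comment> \<open>With \<open>length ys = 2 * b + 1\<close> the entries have degree at most
      \<open>2 * b\<close> in the node, just below the number of interpolation points. Here the even
      total number of rows is used.\<close>
    have "2 * (j div 2) < length ys"
    proof -
      obtain b where "length ys = 2 * b + 1" using assms(2) by (auto elim: oddE)
      moreover have "j div 2 < Suc b" using j calculation by simp
      ultimately show ?thesis by simp
    qed
    from lagrange_power[OF assms(1) this, of x]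
    have "(x\<^sup>2) ^ (j div 2) = (\<Sum>l<length ys. L l * ((ys ! l)\<^sup>2) ^ (j div 2))"
      by (simp add: L_def power_mult)
    hence "fps_const ((x\<^sup>2) ^ (j div 2)) =
        (\<Sum>l<length ys. fps_const (L l) * fps_const (((ys ! l)\<^sup>2) ^ (j div 2)))"
      by (simp add: fps_eq_iff fps_sum_nth)
    thus "row_entry (?r x) j = (\<Sum>l<length ys. fps_const (L l) * row_entry (f x, g x, ys ! l) j)"
      unfolding row_entry.simps by (simp only: sum_distrib_left mult.left_commute)
  qed
  also have "\<dots> = (\<Sum>l<length ys. (-1) ^ l * (f x * g (ys ! l) - g x * f (ys ! l)) *
     fps_const (\<Prod>z\<leftarrow>del_nth l ys. (x + z) * (ys ! l + z)) * row_det (del_nth l ys))"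
  proof (rule sum.cong)
    fix l assume "l \<in> {..<length ys}"
    hence l: "l < length ys" by simp
    \<comment> \<open>The first row now shares its node with row \<open>l\<close> of the rest; once
      that row is moved to the front, \<open>det_equal_node_rows\<close> applies.\<close>
    have "det (rowmat ((f x, g x, ys ! l) # map ?r ys)) =
       (-1) ^ Suc l * det (rowmat (?r (ys ! l) # (f x, g x, ys ! l) # map ?r (del_nth l ys)))"
      by (subst det_move_row[of l]) (use l in \<open>simp_all add: map_del\<close>)
    also have "\<dots> = (-1) ^ l * (f x * g (ys ! l) - g x * f (ys ! l)) *
        fps_const (\<Prod>z\<leftarrow>del_nth l ys. z\<^sup>2 - (ys ! l)\<^sup>2) * row_det (del_nth l ys)"
    proof -
      have swap: "f (ys ! l) * g x - g (ys ! l) * f x = - (f x * g (ys ! l) - g x * f (ys ! l))"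
        by (simp add: mult.commute)
      have const: "(\<Prod>r\<leftarrow>map ?r (del_nth l ys). fps_const ((snd (snd r))\<^sup>2 - (ys ! l)\<^sup>2)) =
          fps_const (\<Prod>z\<leftarrow>del_nth l ys. z\<^sup>2 - (ys ! l)\<^sup>2)"
        by (simp add: o_def fps_const_prod_list)
      have "(-1) ^ Suc l * (- X * P * D) = (-1) ^ l * X * P * D" for X P D :: "complex fps"
        by (simp add: mult.assoc)
      thus ?thesis unfolding det_equal_node_rows swap const row_det_def .
    qed
    finally have d: "det (rowmat ((f x, g x, ys ! l) # map ?r ys)) = \<dots>" .
    \<comment> \<open>The denominators \<open>z - ys ! l\<close> of the interpolation cancel against
      \<open>z\<^sup>2 - (ys ! l)\<^sup>2\<close>.\<close>
    have "L l * (\<Prod>z\<leftarrow>del_nth l ys. z\<^sup>2 - (ys ! l)\<^sup>2) = (\<Prod>z\<leftarrow>del_nth l ys. (x + z) * (ys ! l + z))"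
    proof -
      have "(\<Prod>z\<leftarrow>zs. (x + z) / (z - y)) * (\<Prod>z\<leftarrow>zs. z\<^sup>2 - y\<^sup>2) = (\<Prod>z\<leftarrow>zs. (x + z) * (y + z))"
        if "y \<notin> set zs" for zs y
        using that
      proof (induction zs)
        case (Cons z zs)
        have "(x + z) / (z - y) * (z\<^sup>2 - y\<^sup>2) = (x + z) * (y + z)"
        proof -
          have "z\<^sup>2 - y\<^sup>2 = (z - y) * (z + y)" by (simp add: power2_eq_square algebra_simps)
          moreover have "z - y \<noteq> 0" using Cons.prems by auto
          ultimately show ?thesis by (simp add: add.commute)
        qed
        hence step: "(x + z) / (z - y) * P * ((z\<^sup>2 - y\<^sup>2) * Q) = (x + z) * (y + z) * (P * Q)" for P Q
        proof -
          assume K: "(x + z) / (z - y) * (z\<^sup>2 - y\<^sup>2) = (x + z) * (y + z)"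
          have "(x + z) / (z - y) * P * ((z\<^sup>2 - y\<^sup>2) * Q) = ((x + z) / (z - y) * (z\<^sup>2 - y\<^sup>2)) * (P * Q)"
            by (simp only: mult_ac)
          thus ?thesis unfolding K .
        qed
        show ?case using Cons unfolding list.map prod_list.Cons step by simp
      qed simp
      thus ?thesis using set_del[OF assms(1) l] by (simp add: L_def)
    qed
    hence "fps_const (\<Prod>z\<leftarrow>del_nth l ys. (x + z) * (ys ! l + z)) =
       fps_const (L l) * fps_const (\<Prod>z\<leftarrow>del_nth l ys. z\<^sup>2 - (ys ! l)\<^sup>2)" by simp
    thus "fps_const (L l) * det (rowmat ((f x, g x, ys ! l) # map ?r ys)) =
      (-1) ^ l * (f x * g (ys ! l) - g x * f (ys ! l)) *
      fps_const (\<Prod>z\<leftarrow>del_nth l ys. (x + z) * (ys ! l + z)) * row_det (del_nth l ys)"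
      unfolding d by (simp only: mult_ac)
  qed simp
  finally show ?thesis .
qed

fun pair_sums :: "complex list \<Rightarrow> complex" where
  "pair_sums [] = 1"
| "pair_sums (x # xs) = (\<Prod>z\<leftarrow>xs. x + z) * pair_sums xs"

lemma pair_sums_del: "l < length xs \<Longrightarrow> pair_sums xs = (\<Prod>z\<leftarrow>del_nth l xs. xs ! l + z) * pair_sums (del_nth l xs)"
proof (induction xs arbitrary: l)
  case (Cons x xs)
  show ?case
  proof (cases l)
    case 0
    thus ?thesis by (simp add: del_nth_def)
  next
    case (Suc k)
    hence k: "k < length xs" using Cons.prems by simp
    have "(\<Prod>z\<leftarrow>xs. x + z) = (x + xs ! k) * (\<Prod>z\<leftarrow>del_nth k xs. x + z)"
      using arg_cong[OF mset_del[OF k], of "\<lambda>M. \<Prod>z\<in>#M. x + z"] by (simp add: prod_mset_prod_list flip: mset_map)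
    moreover have "del_nth (Suc k) (x # xs) = x # del_nth k xs" by (simp add: del_nth_def)
    ultimately show ?thesis
      unfolding Suc using Cons.IH[OF k] by (simp add: mult_ac add.commute[of x "xs ! k"])
  qed
qed simp

text \<open>\<open>row_det_rec\<close> is the row expansion of a Pfaffian in disguise: the factors
  \<open>(x + z) * (ys ! l + z)\<close> together with those of the shorter list make up all of
  \<open>pair_sums xs\<close> except \<open>x + ys ! l\<close>, which becomes the denominator of the
  kernel.\<close>

lemma row_det_eq_pf:
  assumes "distinct xs" "even (length xs)" "\<And>x y. x \<in> set xs \<Longrightarrow> y \<in> set xs \<Longrightarrow> x \<noteq> y \<Longrightarrow> x + y \<noteq> 0"
  shows "row_det xs = fps_const (pair_sums xs) * pf pair_kernel xs"
  using assms
proof (induction xs rule: length_induct)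
  case (1 xs)
  show ?case
  proof (cases xs)
    case Nil
    thus ?thesis by (simp add: row_det_def rowmat_def)
  next
    case (Cons x ys)
    have dist: "distinct ys" and odd: "odd (length ys)" using 1 Cons by auto
    have "row_det xs = (\<Sum>l<length ys. (-1) ^ l * (f x * g (ys ! l) - g x * f (ys ! l)) *
     fps_const (\<Prod>z\<leftarrow>del_nth l ys. (x + z) * (ys ! l + z)) * row_det (del_nth l ys))"
      unfolding Cons by (rule row_det_rec[OF dist odd])
    also have "\<dots> = (\<Sum>l<length ys. fps_const (pair_sums xs) * ((-1) ^ l * pair_kernel x (ys ! l) * pf pair_kernel (del_nth l ys)))"
    proof (rule sum.cong)
      fix l assume "l \<in> {..<length ys}"
      hence l: "l < length ys" by simp
      have sub: "set (del_nth l ys) = set ys - {ys ! l}" by (rule set_del[OF dist l])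
      have "even (length (del_nth l ys))" using l odd by simp
      hence IH: "row_det (del_nth l ys) = fps_const (pair_sums (del_nth l ys)) * pf pair_kernel (del_nth l ys)"
        using 1 l Cons sub distinct_del[OF dist l] by (intro "1.IH"[rule_format]) auto
      have "ys ! l \<in> set ys" using l by simp
      hence "x + ys ! l \<noteq> 0" using 1(2,4) Cons by (metis distinct.simps(2) list.set_intros)
      moreover have "(\<Prod>z\<leftarrow>ys. x + z) = (x + ys ! l) * (\<Prod>z\<leftarrow>del_nth l ys. x + z)"
        using arg_cong[OF mset_del[OF l], of "\<lambda>M. \<Prod>z\<in>#M. x + z"] by (simp add: prod_mset_prod_list flip: mset_map)
      moreover have "(\<Prod>z\<leftarrow>zs. (x + z) * (y + z)) = (\<Prod>z\<leftarrow>zs. x + z) * (\<Prod>z\<leftarrow>zs. y + z)" for zs y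
        by (induction zs) (auto simp: mult_ac)
      ultimately have "(\<Prod>z\<leftarrow>del_nth l ys. (x + z) * (ys ! l + z)) * pair_sums (del_nth l ys) = pair_sums xs * (1 / (x + ys ! l))"
        unfolding Cons by (simp add: pair_sums_del[OF l])
      hence "fps_const (\<Prod>z\<leftarrow>del_nth l ys. (x + z) * (ys ! l + z)) * fps_const (pair_sums (del_nth l ys)) =
         fps_const (pair_sums xs) * fps_const (1 / (x + ys ! l))"
        by (simp only: fps_const_mult)
      moreover have "s * B * P * (r * X) = R * (s * (Q * B) * X)" if "P * r = R * Q" for s B P r X R Q :: "complex fps"
      proof -
        have "s * B * P * (r * X) = (P * r) * (s * B * X)" by (simp only: mult_ac)
        thus ?thesis unfolding that by (simp only: mult_ac)
      qed
      ultimately show "(-1) ^ l * (f x * g (ys ! l) - g x * f (ys ! l)) *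
          fps_const (\<Prod>z\<leftarrow>del_nth l ys. (x + z) * (ys ! l + z)) * row_det (del_nth l ys) =
          fps_const (pair_sums xs) * ((-1) ^ l * pair_kernel x (ys ! l) * pf pair_kernel (del_nth l ys))"
        unfolding IH pair_kernel_def by blast
    qed simp
    also have "\<dots> = fps_const (pair_sums xs) * pf pair_kernel xs"
      by (simp add: Cons sum_distrib_left del: pair_sums.simps)
    finally show ?thesis .
  qed
qed

end

section \<open>The determinant of the Bessel-type series\<close>

lemma a_coef_0 [simp]: "a_coef 0 z = 1" by (simp add: a_coef_def)

lemma a_coef_Suc: "a_coef (Suc k) z = a_coef k z * ((2 * (z - 1) - 2 * of_nat k - 1) * (2 * (z - 1) + 2 * of_nat k + 1))"
  by (simp add: a_coef_def power2_eq_square algebra_simps)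

text \<open>\<open>a_coef k z\<close> is the product of \<open>2 * (z - 1) + r\<close> over the odd
  \<open>r\<close> with \<open>|r| < 2 * k\<close>. Raising \<open>z\<close> by one shifts this
  window by 2, so \<open>a_coef (Suc k) (z + 1)\<close> has two more factors at the upper end;
  lowering \<open>z\<close> puts them at the lower end.\<close>

lemma a_coef_Suc_up: "a_coef (Suc k) (z + 1) = a_coef k z * ((2 * (z - 1) + 2 * of_nat k + 1) * (2 * (z - 1) + 2 * of_nat k + 3))"
proof (induction k)
  case 0
  show ?case by (simp add: a_coef_Suc algebra_simps)
next
  case (Suc k)
  show ?case unfolding a_coef_Suc[of "Suc k" "z + 1"] Suc.IH unfolding a_coef_Suc[of k z]
    by (simp add: algebra_simps)
qed

lemma a_coef_Suc_down: "a_coef (Suc k) (z - 1) = a_coef k z * ((2 * (z - 1) - 2 * of_nat k - 1) * (2 * (z - 1) - 2 * of_nat k - 3))"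
proof (induction k)
  case 0
  show ?case by (simp add: a_coef_Suc algebra_simps)
next
  case (Suc k)
  show ?case unfolding a_coef_Suc[of "Suc k" "z - 1"] Suc.IH unfolding a_coef_Suc[of k z]
    by (simp add: algebra_simps)
qed

lemma phi_coef_0 [simp]: "phi_coef N hb j 0 = 1" by (simp add: phi_coef_def)

lemma phi_coef_Suc:
  "phi_coef N hb j (Suc k) =
     - hb * a_coef (Suc k) (of_int j - N) * ((- hb) ^ k / (16 ^ k * fact k)) / (16 * (of_nat k + 1))"
  by (simp add: phi_coef_def algebra_simps)

text \<open>By the two shift rules all three coefficients are multiples of \<open>a_coef k\<close>
  at the middle argument \<open>z\<close>. The two quadratic factors differ, up to sign, by
  \<open>16 * (z - 1) * (k + 1)\<close>, which cancels the denominator.\<close>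

lemma phi_coef_three_term:
  "phi_coef N hb j (Suc k) =
     phi_coef N hb (j + 2) (Suc k) + (of_int j - N) * hb * phi_coef N hb (j + 1) k"
proof -
  define z where "z = of_int (j + 1) - N"
  define q where "q = a_coef k z * ((- hb) ^ k / (16 ^ k * fact k))"
  define K :: complex where "K = of_nat k + 1"
  have K: "K \<noteq> 0" unfolding K_def by (metis of_nat_Suc of_nat_eq_0_iff add.commute nat.distinct(1))
  have z1: "of_int j - N = z - 1" "of_int (j + 2) - N = z + 1" by (simp_all add: z_def)
  have p: "phi_coef N hb (j + 1) k = q" by (simp add: phi_coef_def q_def z_def)
  have k: "of_nat k = K - 1" by (simp add: K_def)
  have a: "phi_coef N hb j (Suc k) = - hb * q * ((2 * (z - 1) - 2 * of_nat k - 1) * (2 * (z - 1) - 2 * of_nat k - 3)) / (16 * K)"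
    unfolding phi_coef_Suc z1 a_coef_Suc_down by (simp add: q_def K_def)
  have b: "phi_coef N hb (j + 2) (Suc k) = - hb * q * ((2 * (z - 1) + 2 * of_nat k + 1) * (2 * (z - 1) + 2 * of_nat k + 3)) / (16 * K)"
    unfolding phi_coef_Suc z1 a_coef_Suc_up by (simp add: q_def K_def)
  show ?thesis unfolding a b p z1 k using K by (simp add: field_simps)
qed

text \<open>Column \<open>j\<close>, counted from 0, is \<open>\<Phi>_(j+1)\<close>. The leading
  power \<open>x ^ j\<close> sits in degree 0 of \<open>X\<close>, so that order zero of the
  determinant is the Vandermonde determinant.\<close>

definition phiS :: "complex \<Rightarrow> complex \<Rightarrow> nat \<Rightarrow> complex \<Rightarrow> complex fps" where
  "phiS N hb j x = Abs_fps (\<lambda>k. phi_coef N hb (int j + 1) k * x ^ j / x ^ k)"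

lemma phiS_three_term:
  assumes "x \<noteq> 0"
  shows "phiS N hb (Suc (Suc j)) x = fps_const (x\<^sup>2) * phiS N hb j x
     - fps_const ((of_nat (Suc j) - N) * hb) * fps_X * phiS N hb (Suc j) x"
proof (rule fps_ext)
  fix k
  have j: "int (Suc (Suc j)) + 1 = (int j + 1) + 2" "int (Suc j) + 1 = (int j + 1) + 1" by simp_all
  show "phiS N hb (Suc (Suc j)) x $ k = (fps_const (x\<^sup>2) * phiS N hb j x
     - fps_const ((of_nat (Suc j) - N) * hb) * fps_X * phiS N hb (Suc j) x) $ k"
  proof (cases k)
    case 0
    thus ?thesis by (simp add: phiS_def power2_eq_square mult.assoc)
  next
    case (Suc l)
    have X: "(fps_const c * fps_X * F) $ Suc l = c * F $ l" for c and F :: "complex fps"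
      by (simp add: mult.assoc)
    have "phi_coef N hb (int j + 1 + 2) (Suc l) * x ^ Suc (Suc j) / x ^ Suc l =
       (x\<^sup>2 * (phi_coef N hb (int j + 1) (Suc l) * x ^ j / x ^ Suc l)) -
       ((of_nat (Suc j) - N) * hb * (phi_coef N hb (int j + 1 + 1) l * x ^ Suc j / x ^ l))"
      unfolding phi_coef_three_term[of N hb "int j + 1" l]
      using assms by (simp add: field_simps power2_eq_square)
    thus ?thesis unfolding Suc fps_sub_nth X unfolding phiS_def j by simp
  qed
qed

text \<open>Column \<open>j\<close> of the unitriangular change of basis from \<open>f, g, \<lambda>\<^sup>2 f, \<lambda>\<^sup>2 g, \<dots>\<close> to the \<open>\<Phi>\<^sub>j\<close>.\<close>
fun phi_row :: "complex \<Rightarrow> complex \<Rightarrow> nat \<Rightarrow> nat \<Rightarrow> complex fps" where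
  "phi_row N hb 0 i = (if i = 0 then 1 else 0)"
| "phi_row N hb (Suc 0) i = (if i = 1 then 1 else 0)"
| "phi_row N hb (Suc (Suc j)) i = (if i < 2 then 0 else phi_row N hb j (i - 2))
     - fps_const ((of_nat (Suc j) - N) * hb) * fps_X * phi_row N hb (Suc j) i"

lemma phi_row_triangular: "phi_row N hb j j = 1" "j < i \<Longrightarrow> phi_row N hb j i = 0"
proof -
  have "j \<le> i \<Longrightarrow> phi_row N hb j i = (if i = j then 1 else 0)" for i
    by (induction N hb j i rule: phi_row.induct) auto
  thus "phi_row N hb j j = 1" "j < i \<Longrightarrow> phi_row N hb j i = 0" by auto
qed

lemma phiS_eq_ent_combination:
  assumes "x \<noteq> 0" "j < n"
  shows "phiS N hb j x = (\<Sum>i<n. phi_row N hb j i * row_entry (phiS N hb 0 x, phiS N hb 1 x, x) i)"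
  using assms(2)
proof (induction j arbitrary: n rule: less_induct)
  case (less j)
  let ?e = "row_entry (phiS N hb 0 x, phiS N hb 1 x, x)"
  have delta: "(\<Sum>i<n. (if i = m then 1 else 0) * ?e i) = ?e m" if "m < n" for m n
  proof -
    have "(\<Sum>i<n. (if i = m then 1 else 0) * ?e i) = (\<Sum>i<n. if i = m then ?e m else 0)"
      by (rule sum.cong) auto
    thus ?thesis using that by simp
  qed
  consider "j = 0" | "j = Suc 0" | i where "j = Suc (Suc i)" by (metis not0_implies_Suc)
  thus ?case
  proof cases
    case 1
    thus ?thesis using delta[of 0 n] less.prems by simp
  next
    case 2
    thus ?thesis using delta[of 1 n] less.prems by simp
  next
    case (3 i)
    obtain m where n: "n = Suc (Suc m)" "i < m"
      using less.prems 3 by (metis Suc_less_SucD Suc_lessE)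
    have e: "?e (Suc (Suc l)) = fps_const (x\<^sup>2) * ?e l" for l
      by (simp add: mult_ac flip: fps_const_mult)
    have "(\<Sum>l<n. phi_row N hb j l * ?e l) =
       (\<Sum>l<n. (if l < 2 then 0 else phi_row N hb i (l - 2)) * ?e l)
       - fps_const ((of_nat (Suc i) - N) * hb) * fps_X * (\<Sum>l<n. phi_row N hb (Suc i) l * ?e l)"
      unfolding 3 phi_row.simps
      by (simp only: left_diff_distrib sum_subtractf sum_distrib_left mult.assoc)
    also have "(\<Sum>l<n. phi_row N hb (Suc i) l * ?e l) = phiS N hb (Suc i) x"
      using less.IH[of "Suc i" n] less.prems 3 by simp
    also have "(\<Sum>l<n. (if l < 2 then 0 else phi_row N hb i (l - 2)) * ?e l) =
        (\<Sum>l<m. phi_row N hb i l * ?e (Suc (Suc l)))"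
      unfolding n(1) sum.lessThan_Suc_shift by simp
    also have "\<dots> = fps_const (x\<^sup>2) * (\<Sum>l<m. phi_row N hb i l * ?e l)"
      unfolding e sum_distrib_left by (simp only: mult.left_commute)
    also have "(\<Sum>l<m. phi_row N hb i l * ?e l) = phiS N hb i x"
      using less.IH[of i m] n(2) 3 by simp
    finally show ?thesis unfolding 3 phiS_three_term[OF assms(1)] by simp
  qed
qed

definition phi_det :: "complex \<Rightarrow> complex \<Rightarrow> complex list \<Rightarrow> complex fps" where
  "phi_det N hb xs = det (mat (length xs) (length xs) (\<lambda>(i, j). phiS N hb j (xs ! i)))"

lemma phi_det_eq_row_det:
  assumes "\<And>x. x \<in> set xs \<Longrightarrow> x \<noteq> 0"
  shows "phi_det N hb xs = row_det (phiS N hb 0) (phiS N hb 1) xs"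
proof -
  let ?n = "length xs"
  define R where "R = rowmat (map (\<lambda>x. (phiS N hb 0 x, phiS N hb 1 x, x)) xs)"
  define U where "U = mat ?n ?n (\<lambda>(i, j). phi_row N hb j i)"
  have U: "U \<in> carrier_mat ?n ?n" by (simp add: U_def)
  have R: "R \<in> carrier_mat ?n ?n" by (simp add: R_def rowmat_def)
  have "upper_triangular U"
    unfolding upper_triangular_def by (auto simp: U_def phi_row_triangular)
  hence "det U = prod_list (diag_mat U)" using U by (rule det_upper_triangular)
  also have "diag_mat U = map (\<lambda>i. 1) [0..<?n]" by (auto simp: diag_mat_def U_def phi_row_triangular)
  finally have detU: "det U = 1" by (simp add: map_replicate_const)
  have "mat ?n ?n (\<lambda>(i, j). phiS N hb j (xs ! i)) = R * U"
  proof (rule eq_matI)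
    fix i j assume "i < dim_row (R * U)" "j < dim_col (R * U)"
    hence ij: "i < ?n" "j < ?n" using R U by auto
    have "(R * U) $$ (i, j) = (\<Sum>h<?n. R $$ (i, h) * U $$ (h, j))"
      using ij R U by (simp add: scalar_prod_def lessThan_atLeast0)
    also have "\<dots> = (\<Sum>h<?n. phi_row N hb j h * row_entry (phiS N hb 0 (xs ! i), phiS N hb 1 (xs ! i), xs ! i) h)"
      using ij by (intro sum.cong) (auto simp: R_def U_def rowmat_def mult.commute simp del: row_entry.simps)
    also have "\<dots> = phiS N hb j (xs ! i)"
      using phiS_eq_ent_combination[of "xs ! i" j ?n N hb] assms ij by simp
    finally show "mat ?n ?n (\<lambda>(i, j). phiS N hb j (xs ! i)) $$ (i, j) = (R * U) $$ (i, j)"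
      using ij by simp
  qed (use R U in auto)
  thus ?thesis using det_mult[OF R U] detU by (simp add: phi_det_def row_det_def R_def)
qed

section \<open>The Vandermonde determinant as the order-zero term\<close>

fun vander :: "complex list \<Rightarrow> complex" where
  "vander [] = 1"
| "vander (x # xs) = (\<Prod>z\<leftarrow>xs. z - x) * vander xs"

lemma det_vandermonde:
  "det (mat (length xs) (length xs) (\<lambda>(i, j). (xs ! i) ^ j)) = vander xs"
proof (induction xs)
  case (Cons x xs)
  let ?n = "length xs"
  let ?V = "mat (1 + ?n) (1 + ?n) (\<lambda>(i, j). ((x # xs) ! i) ^ j)"
  define B where "B = mat (1 + ?n) (1 + ?n) (\<lambda>(i, j). ?V $$ (i, j) - (if j < 1 then 0 else x * ?V $$ (i, j - 1)))"
  define A1 where "A1 = mat 1 1 (\<lambda>_. 1 :: complex)"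
  define A3 where "A3 = mat ?n 1 (\<lambda>_. 1 :: complex)"
  define W where "W = mat ?n ?n (\<lambda>(i, j). (xs ! i) ^ j)"
  define A4 where "A4 = mat ?n ?n (\<lambda>(i, j). (xs ! i - x) * W $$ (i, j))"
  have "det ?V = det B"
    unfolding B_def by (rule sub_column_det) simp_all
  also have "B = four_block_mat A1 (0\<^sub>m 1 ?n) A3 A4"
  proof (rule eq_matI)
    fix i j assume "i < dim_row (four_block_mat A1 (0\<^sub>m 1 ?n) A3 A4)" "j < dim_col (four_block_mat A1 (0\<^sub>m 1 ?n) A3 A4)"
    hence ij: "i < 1 + ?n" "j < 1 + ?n" by (auto simp: A1_def A4_def)
    show "B $$ (i, j) = four_block_mat A1 (0\<^sub>m 1 ?n) A3 A4 $$ (i, j)"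
      using ij by (cases i; cases j) (auto simp: B_def A1_def A3_def A4_def W_def left_diff_distrib)
  qed (auto simp: B_def A1_def A4_def)
  also have "det \<dots> = det A1 * det A4"
    by (rule det_four_block_mat_upper_right_zero) (auto simp: A1_def A3_def A4_def)
  also have "det A1 = 1" by (subst det_single) (simp_all add: A1_def)
  also have "det A4 = (\<Prod>i<?n. xs ! i - x) * det W"
    unfolding A4_def by (rule det_scale_rows) (simp add: W_def)
  also have "det W = vander xs" unfolding W_def by (rule Cons.IH)
  also have "(\<Prod>i<?n. xs ! i - x) = (\<Prod>z\<leftarrow>xs. z - x)"
    by (simp add: prod.list_conv_set_nth lessThan_atLeast0)
  finally show ?case by simp
qed simp

lemma fps_nth_0_det:
  fixes A :: "complex fps mat"
  assumes A: "A \<in> carrier_mat n n"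
  shows "det A $ 0 = det (map_mat (\<lambda>F. F $ 0) A)"
proof -
  have prod0: "prod h I $ 0 = (\<Prod>i\<in>I. h i $ 0)" for h :: "nat \<Rightarrow> complex fps" and I
    by (induction I rule: infinite_finite_induct) auto
  have sgn0: "(signof p :: complex fps) $ 0 = signof p" for p :: "nat \<Rightarrow> nat"
    by (simp add: sign_def)
  have "det A $ 0 = (\<Sum>p | p permutes {0..<n}. signof p * (\<Prod>i = 0..<n. A $$ (i, p i) $ 0))"
    unfolding det_def'[OF A] fps_sum_nth fps_mult_nth_0 prod0 sgn0 ..
  also have "\<dots> = det (map_mat (\<lambda>F. F $ 0) A)"
  proof (subst det_def'[of _ n])
    show "map_mat (\<lambda>F. F $ 0) A \<in> carrier_mat n n" using A by simp
    show "(\<Sum>p | p permutes {0..<n}. signof p * (\<Prod>i = 0..<n. A $$ (i, p i) $ 0)) =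
      (\<Sum>p | p permutes {0..<n}. signof p * (\<Prod>i = 0..<n. map_mat (\<lambda>F. F $ 0) A $$ (i, p i)))"
    proof (rule sum.cong[OF refl], rule arg_cong2[where f="(*)", OF refl], rule prod.cong[OF refl])
      fix p i assume "p \<in> {p. p permutes {0..<n}}" "i \<in> {0..<n}"
      hence "p i < n" "i < n" by (auto simp: permutes_def)
      thus "A $$ (i, p i) $ 0 = map_mat (\<lambda>F. F $ 0) A $$ (i, p i)" using A by simp
    qed
  qed
  finally show ?thesis .
qed

lemma phi_det_nth_0: "phi_det N hb xs $ 0 = vander xs"
proof -
  have "map_mat (\<lambda>F. F $ 0) (mat (length xs) (length xs) (\<lambda>(i, j). phiS N hb j (xs ! i))) =
     mat (length xs) (length xs) (\<lambda>(i, j). (xs ! i) ^ j)"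
    by (rule eq_matI) (auto simp: phiS_def)
  thus ?thesis
    unfolding phi_det_def by (subst fps_nth_0_det[of _ "length xs"]) (simp_all add: det_vandermonde)
qed

section \<open>Evolution equation for the Pfaffian\<close>

text \<open>The first derivative is required on a neighbourhood so that it can be differentiated
  again. As a relation, the notion carries both derivatives through sums and products together with
  their existence.\<close>

definition PD2 :: "(complex \<Rightarrow> complex) \<Rightarrow> complex \<Rightarrow> complex \<Rightarrow> complex \<Rightarrow> bool" where
  "PD2 g z d1 d2 \<longleftrightarrow> (\<exists>g1. (\<forall>\<^sub>F w in nhds z. (g has_field_derivative g1 w) (at w)) \<and>
      g1 z = d1 \<and> (g1 has_field_derivative d2) (at z))"

lemma PD2_const: "PD2 (\<lambda>_. c) z 0 0"
  unfolding PD2_def by (rule exI[of _ "\<lambda>_. 0"]) simp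

lemma PD2_add:
  assumes "PD2 f z a b" "PD2 g z c d"
  shows "PD2 (\<lambda>w. f w + g w) z (a + c) (b + d)"
proof -
  obtain f1 where f: "\<forall>\<^sub>F w in nhds z. (f has_field_derivative f1 w) (at w)" "f1 z = a" "(f1 has_field_derivative b) (at z)"
    using assms(1) unfolding PD2_def by blast
  obtain g1 where g: "\<forall>\<^sub>F w in nhds z. (g has_field_derivative g1 w) (at w)" "g1 z = c" "(g1 has_field_derivative d) (at z)"
    using assms(2) unfolding PD2_def by blast
  have "\<forall>\<^sub>F w in nhds z. ((\<lambda>w. f w + g w) has_field_derivative f1 w + g1 w) (at w)"
    using f(1) g(1) by eventually_elim (rule DERIV_add)
  thus ?thesis unfolding PD2_def
    by (intro exI[of _ "\<lambda>w. f1 w + g1 w"] conjI DERIV_add f g) (use f g in auto)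
qed

lemma PD2_mult:
  assumes "PD2 f z a b" "PD2 g z c d"
  shows "PD2 (\<lambda>w. f w * g w) z (a * g z + f z * c) (b * g z + 2 * a * c + f z * d)"
proof -
  obtain f1 where f: "\<forall>\<^sub>F w in nhds z. (f has_field_derivative f1 w) (at w)" "f1 z = a" "(f1 has_field_derivative b) (at z)"
    using assms(1) unfolding PD2_def by blast
  obtain g1 where g: "\<forall>\<^sub>F w in nhds z. (g has_field_derivative g1 w) (at w)" "g1 z = c" "(g1 has_field_derivative d) (at z)"
    using assms(2) unfolding PD2_def by blast
  have 1: "\<forall>\<^sub>F w in nhds z. ((\<lambda>w. f w * g w) has_field_derivative f1 w * g w + f w * g1 w) (at w)"
    using f(1) g(1) by eventually_elim (auto intro!: derivative_eq_intros)
  have fz: "(f has_field_derivative f1 z) (at z)" "(g has_field_derivative g1 z) (at z)"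
    using f(1) g(1) by (auto dest: eventually_nhds_x_imp_x)
  have "((\<lambda>w. f1 w * g w + f w * g1 w) has_field_derivative
      (b * g z + f1 z * g1 z) + (f1 z * g1 z + f z * d)) (at z)"
    using f(3) g(3) fz by (auto intro!: derivative_eq_intros)
  hence "((\<lambda>w. f1 w * g w + f w * g1 w) has_field_derivative b * g z + 2 * a * c + f z * d) (at z)"
    using f(2) g(2) by (simp add: algebra_simps)
  thus ?thesis unfolding PD2_def using 1 f(2) g(2)
    by (intro exI[of _ "\<lambda>w. f1 w * g w + f w * g1 w"]) auto
qed

lemma PD2_cmult: "PD2 f z a b \<Longrightarrow> PD2 (\<lambda>w. c * f w) z (c * a) (c * b)"
  using PD2_mult[OF PD2_const[of c z]] by simp

lemma PD2_sum: "(\<And>i. i \<in> I \<Longrightarrow> PD2 (f i) z (a i) (b i)) \<Longrightarrow>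
   PD2 (\<lambda>w. \<Sum>i\<in>I. f i w) z (\<Sum>i\<in>I. a i) (\<Sum>i\<in>I. b i)"
  by (induction I rule: infinite_finite_induct) (auto intro: PD2_const PD2_add)

text \<open>Agreement near \<open>z\<close> is agreement near every nearby point, so the first
  derivatives coincide on a neighbourhood and may be differentiated again; agreement at
  \<open>z\<close> alone would not suffice.\<close>

lemma PD2_unique:
  assumes "PD2 f z a b" "PD2 g z c d" "\<forall>\<^sub>F w in nhds z. f w = g w"
  shows "a = c" "b = d"
proof -
  obtain f1 where f: "\<forall>\<^sub>F w in nhds z. (f has_field_derivative f1 w) (at w)" "f1 z = a" "(f1 has_field_derivative b) (at z)"
    using assms(1) unfolding PD2_def by blast
  obtain g1 where g: "\<forall>\<^sub>F w in nhds z. (g has_field_derivative g1 w) (at w)" "g1 z = c" "(g1 has_field_derivative d) (at z)"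
    using assms(2) unfolding PD2_def by blast
  have "\<forall>\<^sub>F w in nhds z. \<forall>\<^sub>F v in nhds w. f v = g v"
    using assms(3) by (simp add: eventually_eventually)
  hence eq: "\<forall>\<^sub>F w in nhds z. f1 w = g1 w"
    using f(1) g(1)
  proof eventually_elim
    case (elim w)
    have "(g has_field_derivative f1 w) (at w)"
      using DERIV_cong_ev[OF refl elim(1) refl] elim(2) by blast
    thus ?case using elim(3) by (rule DERIV_unique)
  qed
  thus "a = c" using f(2) g(2) by (auto dest: eventually_nhds_x_imp_x)
  have "(g1 has_field_derivative b) (at z)"
    using DERIV_cong_ev[OF refl eq refl] f(3) by blast
  thus "b = d" using g(3) by (rule DERIV_unique)
qed

lemma eventually_nhds_neq: "z \<noteq> (a :: complex) \<Longrightarrow> \<forall>\<^sub>F w in nhds z. w \<noteq> a"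
  by (rule t1_space_nhds)

lemma inverse_power_derivative:
  assumes "w \<noteq> (0 :: complex)"
  shows "((\<lambda>w. 1 / w ^ k) has_field_derivative - of_nat k / w ^ Suc k) (at w)"
proof (cases k)
  case (Suc m)
  have "((\<lambda>w. 1 / w ^ k) has_field_derivative - (of_nat k * w ^ (k - 1)) / (w ^ k * w ^ k)) (at w)"
    using assms by (auto intro!: derivative_eq_intros)
  also have "- (of_nat k * w ^ (k - 1)) / (w ^ k * w ^ k) = - of_nat k / w ^ Suc k"
    using assms Suc by (simp add: field_simps)
  finally show ?thesis .
qed simp

lemma PD2_inverse_power:
  assumes "z \<noteq> 0"
  shows "PD2 (\<lambda>w. 1 / w ^ k) z (- of_nat k / z ^ Suc k) (of_nat (k * Suc k) / z ^ Suc (Suc k))"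
proof -
  have "((\<lambda>w. - of_nat k * (1 / w ^ Suc k)) has_field_derivative - of_nat k * (- of_nat (Suc k) / z ^ Suc (Suc k))) (at z)"
    by (rule DERIV_cmult[OF inverse_power_derivative[OF assms]])
  hence "((\<lambda>w. - of_nat k / w ^ Suc k) has_field_derivative of_nat (k * Suc k) / z ^ Suc (Suc k)) (at z)"
    by (simp add: algebra_simps)
  moreover have "\<forall>\<^sub>F w in nhds z. ((\<lambda>w. 1 / w ^ k) has_field_derivative - of_nat k / w ^ Suc k) (at w)"
    using eventually_nhds_neq[OF assms] by eventually_elim (rule inverse_power_derivative)
  ultimately show ?thesis
    unfolding PD2_def by (intro exI[of _ "\<lambda>w. - of_nat k / w ^ Suc k"]) blast
qed

lemma PD2_ident: "PD2 (\<lambda>w. w) z 1 0"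
  unfolding PD2_def by (rule exI[of _ "\<lambda>_. 1"]) simp

lemma PD2_inverse_shift:
  assumes "z + y \<noteq> 0"
  shows "PD2 (\<lambda>w. 1 / (w + y)) z (- (1 / (z + y))\<^sup>2) (2 * (1 / (z + y)) ^ 3)"
proof -
  have "z \<noteq> - y" using assms by (metis add.left_inverse)
  hence "\<forall>\<^sub>F w in nhds z. w \<noteq> - y" by (rule eventually_nhds_neq)
  hence "\<forall>\<^sub>F w in nhds z. ((\<lambda>w. 1 / (w + y)) has_field_derivative - (1 / (w + y))\<^sup>2) (at w)"
  proof eventually_elim
    case (elim w)
    hence "w + y \<noteq> 0" by (metis eq_neg_iff_add_eq_0)
    thus ?case by (auto intro!: derivative_eq_intros simp: power2_eq_square)
  qed
  moreover from this have "((\<lambda>w. 1 / (w + y)) has_field_derivative - (1 / (z + y))\<^sup>2) (at z)"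
    by (rule eventually_nhds_x_imp_x)
  from DERIV_minus[OF DERIV_power[OF this, of 2]]
  have "((\<lambda>w. - (1 / (w + y))\<^sup>2) has_field_derivative 2 * (1 / (z + y)) ^ 3) (at z)"
    by (simp add: power2_eq_square power3_eq_cube)
  ultimately show ?thesis
    unfolding PD2_def by (intro exI[of _ "\<lambda>w. - (1 / (w + y))\<^sup>2"]) blast
qed

text \<open>Differentiation with respect to a point, one coefficient at a time; the formal variable
  \<open>X\<close> is only a spectator.\<close>

definition FPD2 :: "(complex \<Rightarrow> complex fps) \<Rightarrow> complex \<Rightarrow> complex fps \<Rightarrow> complex fps \<Rightarrow> bool" where
  "FPD2 F z F1 F2 \<longleftrightarrow> (\<forall>k. PD2 (\<lambda>w. F w $ k) z (F1 $ k) (F2 $ k))"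

lemma FPD2_sum: "(\<And>i. i \<in> I \<Longrightarrow> FPD2 (f i) z (a i) (b i)) \<Longrightarrow>
   FPD2 (\<lambda>w. \<Sum>i\<in>I. f i w) z (\<Sum>i\<in>I. a i) (\<Sum>i\<in>I. b i)"
  unfolding FPD2_def fps_sum_nth by (auto intro: PD2_sum)

lemma FPD2_cmult:
  assumes "FPD2 F z F1 F2"
  shows "FPD2 (\<lambda>w. C * F w) z (C * F1) (C * F2)"
  using assms unfolding FPD2_def fps_mult_nth by (auto intro!: PD2_sum PD2_cmult)

lemma FPD2_diff:
  assumes "FPD2 F z F1 F2" "FPD2 G z G1 G2"
  shows "FPD2 (\<lambda>w. F w - G w) z (F1 - G1) (F2 - G2)"
proof -
  have "PD2 (\<lambda>w. F w $ k + (-1) * G w $ k) z (F1 $ k + (-1) * G1 $ k) (F2 $ k + (-1) * G2 $ k)" for k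
    using assms unfolding FPD2_def by (intro PD2_add PD2_cmult) auto
  thus ?thesis unfolding FPD2_def by simp
qed

lemma FPD2_scale:
  assumes "PD2 h z h1 h2" "FPD2 F z F1 F2"
  shows "FPD2 (\<lambda>w. fps_const (h w) * F w) z (fps_const h1 * F z + fps_const (h z) * F1)
     (fps_const h2 * F z + 2 * fps_const h1 * F1 + fps_const (h z) * F2)"
proof -
  have two: "(2 * fps_const h1 * F1) $ k = 2 * h1 * F1 $ k" for k
    by (metis fps_const_mult fps_mult_left_const_nth numeral_fps_const)
  show ?thesis
    using PD2_mult[OF assms(1) assms(2)[unfolded FPD2_def, rule_format]]
    unfolding FPD2_def by (simp add: two)
qed

section \<open>Bessel-type series and their differential equations\<close>

definition ser :: "(nat \<Rightarrow> complex) \<Rightarrow> complex \<Rightarrow> complex fps" where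
  "ser a x = Abs_fps (\<lambda>k. a k / x ^ k)"
definition ser1 :: "(nat \<Rightarrow> complex) \<Rightarrow> complex \<Rightarrow> complex fps" where
  "ser1 a x = Abs_fps (\<lambda>k. - (a k * of_nat k / x ^ Suc k))"
definition ser2 :: "(nat \<Rightarrow> complex) \<Rightarrow> complex \<Rightarrow> complex fps" where
  "ser2 a x = Abs_fps (\<lambda>k. a k * of_nat (k * Suc k) / x ^ Suc (Suc k))"

lemma FPD2_ser: "x \<noteq> 0 \<Longrightarrow> FPD2 (ser a) x (ser1 a x) (ser2 a x)"
  unfolding FPD2_def ser_def ser1_def ser2_def
  using PD2_cmult[OF PD2_inverse_power] by fastforce

text \<open>\<open>ser a x\<close> depends only on \<open>X / x\<close>, so the Euler operator in
  \<open>X\<close> is minus the one in \<open>x\<close>.\<close>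

lemma ser_euler: "x \<noteq> 0 \<Longrightarrow> fps_X * fps_deriv (ser a x) = - fps_const x * ser1 a x"
proof (rule fps_ext)
  fix k assume "x \<noteq> 0"
  thus "(fps_X * fps_deriv (ser a x)) $ k = (- fps_const x * ser1 a x) $ k"
    by (cases k) (simp_all add: ser_def ser1_def)
qed

lemma of_nat_Suc_neq_0 [simp]: "1 + of_nat k \<noteq> (0 :: complex)" "of_nat k + 1 \<noteq> (0 :: complex)"
  by (metis of_nat_Suc of_nat_eq_0_iff nat.distinct(1)) (metis of_nat_Suc of_nat_eq_0_iff nat.distinct(1) add.commute)

lemma fps_X_mult_eqI:
  fixes F G :: "complex fps"
  assumes "F $ 0 = 0" "\<And>k. F $ Suc k = G $ k"
  shows "F = fps_X * G"
proof (rule fps_ext)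
  show "F $ k = (fps_X * G) $ k" for k using assms by (cases k) simp_all
qed

text \<open>The operator \<open>x d^2/dx^2 + p / x\<close> multiplies \<open>1 / x ^ k\<close> by
  \<open>k * (k + 1) + p\<close> and lowers its degree by one, which \<open>fps_X\<close> records;
  so the recursion for the coefficients is Bessel's equation for the series.\<close>

lemma ser_ode:
  assumes "x \<noteq> 0" and rec: "\<And>k. of_nat (Suc k) * a (Suc k) = hb / 4 * (of_nat (k * Suc k) + p) * a k"
  shows "- 4 * fps_const x * ser1 a x =
     fps_X * fps_const hb * (fps_const x * ser2 a x + fps_const p * fps_const (1 / x) * ser a x)"
proof -
  have four: "(- 4 * fps_const x * F) $ k = - 4 * (x * F $ k)" for F :: "complex fps" and k
    by (metis (no_types, opaque_lifting) fps_const_neg fps_mult_left_const_nth mult.assoc numeral_fps_const)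
  show ?thesis
    unfolding mult.assoc[of fps_X]
  proof (rule fps_X_mult_eqI)
    show "(- 4 * fps_const x * ser1 a x) $ 0 = 0" unfolding four by (simp add: ser1_def)
    fix k
    have "- 4 * (x * ser1 a x $ Suc k) = 4 * (of_nat (Suc k) * a (Suc k)) / x ^ Suc k"
      using assms(1) by (simp add: ser1_def)
    also have "\<dots> = hb * (of_nat (k * Suc k) + p) * a k / x ^ Suc k"
      unfolding rec by simp
    also have "\<dots> = (fps_const hb * (fps_const x * ser2 a x + fps_const p * fps_const (1 / x) * ser a x)) $ k"
      using assms(1) by (simp add: ser_def ser2_def mult.assoc field_simps)
    finally show "(- 4 * fps_const x * ser1 a x) $ Suc k = \<dots>" unfolding four .
  qed
qed

text \<open>The factor \<open>k\<close> of the recursion is minus the Euler operator in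
  \<open>x\<close>, so a relation between neighbouring coefficients becomes a first-order
  differential relation.\<close>

lemma ser_system:
  assumes "x \<noteq> 0" "u 0 = a 0" and rec: "\<And>k. 2 * (a (Suc k) - u (Suc k)) = hb * (of_nat k + b) * a k"
  shows "fps_X * fps_const hb * (fps_const x * ser1 a x) =
     - 2 * fps_const x * (ser a x - ser u x) + fps_X * fps_const hb * (fps_const b * ser a x)"
proof -
  have two: "(2 * fps_const x * F) $ k = 2 * (x * F $ k)" for F :: "complex fps" and k
    by (metis (no_types, opaque_lifting) fps_mult_left_const_nth mult.assoc numeral_fps_const)
  have "2 * fps_const x * (ser a x - ser u x) =
     fps_X * (fps_const hb * (fps_const b * ser a x - fps_const x * ser1 a x))"
  proof (rule fps_X_mult_eqI)
    show "(2 * fps_const x * (ser a x - ser u x)) $ 0 = 0"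
      unfolding two using assms(2) by (simp add: ser_def)
    fix k
    have "2 * (x * (ser a x - ser u x) $ Suc k) = 2 * (a (Suc k) - u (Suc k)) / x ^ k"
      using assms(1) by (simp add: ser_def field_simps)
    also have "\<dots> = (fps_const hb * (fps_const b * ser a x - fps_const x * ser1 a x)) $ k"
      unfolding rec using assms(1) by (simp add: ser_def ser1_def field_simps)
    finally show "(2 * fps_const x * (ser a x - ser u x)) $ Suc k = \<dots>" unfolding two .
  qed
  thus ?thesis by (simp add: algebra_simps)
qed

text \<open>The last factor of \<open>a_coef (Suc k) z\<close> is
  \<open>4 * (z - 1)\<^sup>2 - (2 * k + 1)\<^sup>2\<close>, and
  \<open>(2 * k + 1)\<^sup>2 = 4 * k * (k + 1) + 1\<close>.\<close>

lemma phi_coef_ode: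
  "of_nat (Suc k) * phi_coef N hb j (Suc k) =
     hb / 4 * (of_nat (k * Suc k) + (1/4 - (of_int j - N - 1)\<^sup>2)) * phi_coef N hb j k"
proof -
  define q where "q = a_coef k (of_int j - N) * ((- hb) ^ k / (16 ^ k * fact k))"
  have p: "phi_coef N hb j k = q" by (simp add: phi_coef_def q_def)
  have a: "of_nat (Suc k) * phi_coef N hb j (Suc k) =
      - hb * q * ((2 * (of_int j - N - 1) - 2 * of_nat k - 1) * (2 * (of_int j - N - 1) + 2 * of_nat k + 1)) / 16"
  proof -
    have cancel: "K * (X * r / (16 * K)) = X * r / 16" if "K \<noteq> 0" for K X r :: complex
      using that by simp
    show ?thesis
      unfolding phi_coef_Suc a_coef_Suc of_nat_Suc add.commute[of 1 "of_nat k"] cancel[OF of_nat_Suc_neq_0(2)]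
      by (simp add: q_def)
  qed
  show ?thesis unfolding p a by (simp add: field_simps power2_eq_square)
qed

text \<open>The indices 1 and 2 are adjacent, so both coefficients of order \<open>Suc k\<close> are
  multiples of \<open>a_coef k\<close> taken at either index.\<close>

lemma phi_coef_system:
  "2 * (phi_coef N hb 1 (Suc k) - phi_coef N hb 2 (Suc k)) = hb * (of_nat k + (1/2 - N)) * phi_coef N hb 1 k"
  "2 * (phi_coef N hb 2 (Suc k) - phi_coef N hb 1 (Suc k)) = hb * (of_nat k - (1/2 - N)) * phi_coef N hb 2 k"
proof -
  define r where "r = (- hb) ^ k / (16 ^ k * fact k)"
  define K :: complex where "K = of_nat k + 1"
  have K: "K \<noteq> 0" by (simp add: K_def)
  have k: "of_nat k = K - 1" by (simp add: K_def)
  define z1 where "z1 = of_int 1 - N"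
  define z2 where "z2 = of_int 2 - N"
  have z: "z2 = z1 + 1" "z1 = z2 - 1" by (simp_all add: z1_def z2_def)
  have p: "phi_coef N hb 1 k = a_coef k z1 * r" "phi_coef N hb 2 k = a_coef k z2 * r"
    by (simp_all add: phi_coef_def r_def z1_def z2_def)
  have q: "phi_coef N hb 1 (Suc k) = - hb * a_coef (Suc k) z1 * r / (16 * K)"
    "phi_coef N hb 2 (Suc k) = - hb * a_coef (Suc k) z2 * r / (16 * K)"
    unfolding phi_coef_Suc by (simp_all add: r_def z1_def z2_def K_def)
  have up: "a_coef (Suc k) z2 = a_coef k z1 * ((2 * (z1 - 1) + 2 * of_nat k + 1) * (2 * (z1 - 1) + 2 * of_nat k + 3))"
    unfolding z(1) by (rule a_coef_Suc_up)
  have down: "a_coef (Suc k) z1 = a_coef k z2 * ((2 * (z2 - 1) - 2 * of_nat k - 1) * (2 * (z2 - 1) - 2 * of_nat k - 3))"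
    unfolding z(2) by (rule a_coef_Suc_down)
  show "2 * (phi_coef N hb 1 (Suc k) - phi_coef N hb 2 (Suc k)) = hb * (of_nat k + (1/2 - N)) * phi_coef N hb 1 k"
    unfolding p q up a_coef_Suc[of k z1] k using K by (simp add: z1_def field_simps)
  show "2 * (phi_coef N hb 2 (Suc k) - phi_coef N hb 1 (Suc k)) = hb * (of_nat k - (1/2 - N)) * phi_coef N hb 2 k"
    unfolding p q down a_coef_Suc[of k z2] k using K by (simp add: z2_def field_simps)
qed

text \<open>The \<open>O\<close> hypotheses are the second-order Bessel equations of \<open>f = \<Phi>\<^sub>1\<close> and \<open>u = \<Phi>\<^sub>2 / \<lambda>\<close> at the two
points, the \<open>S\<close> hypotheses their first-order contiguity relations; \<open>s\<close> is \<open>1 / (x + y)\<close>, and \<open>E\<close> is the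
Euler derivative of the numerator \<open>N\<close> with respect to the grading parameter.\<close>
lemma pair_kernel_identity:
  fixes x :: "'a::comm_ring_1"
  assumes s: "s * (x + y) = 1" and ix: "ix * x = 1" and iy: "iy * y = 1"
    and O1: "- 4 * x * f1 = \<kappa> * (x * f2 + p * ix * f)" and O2: "- 4 * x * u1 = \<kappa> * (x * u2 + (p - 2 * b) * ix * u)"
    and O1': "- 4 * y * F1 = \<kappa> * (y * F2 + p * iy * F)" and O2': "- 4 * y * U1 = \<kappa> * (y * U2 + (p - 2 * b) * iy * U)"
    and S1: "\<kappa> * (x * f1) = - 2 * x * (f - u) + \<kappa> * (b * f)" and S2: "\<kappa> * (x * u1) = - 2 * x * (u - f) - \<kappa> * (b * u)"
    and S1': "\<kappa> * (y * F1) = - 2 * y * (F - U) + \<kappa> * (b * F)" and S2': "\<kappa> * (y * U1) = - 2 * y * (U - F) - \<kappa> * (b * U)"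
    and g: "g = x * u" "g1 = u + x * u1" "g2 = 2 * u1 + x * u2"
    and G: "G = y * U" "G1 = U + y * U1" "G2 = 2 * U1 + y * U2"
    and N: "N = f * G - g * F" "Nx = f1 * G - g1 * F" "Nxx = f2 * G - g2 * F" "Ny = f * G1 - g * F1" "Nyy = f * G2 - g * F2"
    and E: "E = - (x * f1) * G - f * (y * y * U1) + x * x * u1 * F + g * (y * F1)"
  shows "4 * s * E = \<kappa> * (x * (s * Nxx - 2 * s\<^sup>2 * Nx + 2 * s ^ 3 * N) +
     y * (s * Nyy - 2 * s\<^sup>2 * Ny + 2 * s ^ 3 * N) + p * (ix + iy) * (s * N))"
proof -
  \<comment> \<open>What remains when the second-order equations for \<open>u\<close> and
    \<open>U\<close> are transferred to \<open>g = x * u\<close> and \<open>G = y * U\<close>: the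
    product rule and the shift of \<open>p\<close> by \<open>2 * b\<close> leave first-order
    terms.\<close>
  define Q where "Q = f * (y * U1 + b * U) - (x * u1 + b * u) * F"
  have g2: "\<kappa> * (x * g2 + p * ix * g) = - 4 * x * x * u1 + 2 * \<kappa> * (x * u1 + b * u)"
  proof -
    have "\<kappa> * (x * g2 + p * ix * g) = x * (\<kappa> * (x * u2 + (p - 2 * b) * ix * u)) + 2 * \<kappa> * x * u1 + \<kappa> * (2 * b) * (ix * x) * u"
      unfolding g by (simp add: algebra_simps)
    thus ?thesis unfolding ix O2[symmetric] by (simp add: algebra_simps)
  qed
  have G2: "\<kappa> * (y * G2 + p * iy * G) = - 4 * y * y * U1 + 2 * \<kappa> * (y * U1 + b * U)"
  proof -
    have "\<kappa> * (y * G2 + p * iy * G) = y * (\<kappa> * (y * U2 + (p - 2 * b) * iy * U)) + 2 * \<kappa> * y * U1 + \<kappa> * (2 * b) * (iy * y) * U"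
      unfolding G by (simp add: algebra_simps)
    thus ?thesis unfolding iy O2'[symmetric] by (simp add: algebra_simps)
  qed
  have "\<kappa> * (x * Nxx + y * Nyy + p * (ix + iy) * N) =
     (\<kappa> * (x * f2 + p * ix * f)) * G - (\<kappa> * (x * g2 + p * ix * g)) * F +
     f * (\<kappa> * (y * G2 + p * iy * G)) - g * (\<kappa> * (y * F2 + p * iy * F))"
    unfolding N by (simp add: algebra_simps)
  also have "\<dots> = 4 * E + 2 * \<kappa> * Q"
    unfolding g2 G2 O1[symmetric] O1'[symmetric] E Q_def by (simp add: algebra_simps)
  finally have main: "\<kappa> * (x * Nxx + y * Nyy + p * (ix + iy) * N) = 4 * E + 2 * \<kappa> * Q" .
  \<comment> \<open>In the application, order \<open>n\<close> of the numerator is homogeneous of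
    degree \<open>1 - n\<close> in the two points, and \<open>E\<close> multiplies it by
    \<open>n\<close>.\<close>
  have euler: "x * Nx + y * Ny = N - E"
    unfolding N E g G by (simp add: algebra_simps)
  \<comment> \<open>The contiguity relations give \<open>\<kappa> * Q = - \<kappa> * s * E\<close>,
    exactly what cancels the terms that come from differentiating
    \<open>s = 1 / (x + y)\<close>.\<close>
  have "\<kappa> * ((x + y) * Q + E) = x * f * (\<kappa> * (y * U1)) - y * F * (\<kappa> * (x * u1))
      - y * U * (\<kappa> * (x * f1)) + x * u * (\<kappa> * (y * F1)) + \<kappa> * (x + y) * b * (f * U - u * F)"
    unfolding Q_def E g G by (simp add: algebra_simps)
  also have "\<dots> = 0"
    unfolding S1 S2 S1' S2' by (simp add: algebra_simps)
  finally have zero: "\<kappa> * ((x + y) * Q + E) = 0" .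
  have "\<kappa> * Q + \<kappa> * s * E = s * (\<kappa> * ((x + y) * Q + E)) + \<kappa> * Q * (1 - s * (x + y))"
    by (simp add: algebra_simps)
  hence zero': "\<kappa> * Q + \<kappa> * s * E = 0" unfolding zero s by simp
  have "x * (s * Nxx - 2 * s\<^sup>2 * Nx + 2 * s ^ 3 * N) +
     y * (s * Nyy - 2 * s\<^sup>2 * Ny + 2 * s ^ 3 * N) + p * (ix + iy) * (s * N) =
     s * (x * Nxx + y * Nyy + p * (ix + iy) * N) - 2 * s\<^sup>2 * (x * Nx + y * Ny) + 2 * s\<^sup>2 * (s * (x + y)) * N"
    by (simp add: algebra_simps power2_eq_square power3_eq_cube)
  also have "\<dots> = s * (x * Nxx + y * Nyy + p * (ix + iy) * N) + 2 * s\<^sup>2 * E"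
    unfolding euler s by (simp add: algebra_simps)
  finally have "\<kappa> * (x * (s * Nxx - 2 * s\<^sup>2 * Nx + 2 * s ^ 3 * N) +
     y * (s * Nyy - 2 * s\<^sup>2 * Ny + 2 * s ^ 3 * N) + p * (ix + iy) * (s * N)) =
     s * (\<kappa> * (x * Nxx + y * Nyy + p * (ix + iy) * N)) + 2 * \<kappa> * s\<^sup>2 * E"
    by (simp add: algebra_simps)
  also have "\<dots> = 4 * s * E + 2 * s * (\<kappa> * Q + \<kappa> * s * E)"
    unfolding main by (simp add: algebra_simps power2_eq_square)
  finally show ?thesis unfolding zero' by simp
qed

definition tau_kernel :: "complex \<Rightarrow> complex \<Rightarrow> complex \<Rightarrow> complex \<Rightarrow> complex fps" where
  "tau_kernel N hb = pair_kernel (phiS N hb 0) (phiS N hb 1)"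

lemma phiS_0: "phiS N hb 0 = ser (phi_coef N hb 1)"
  by (auto simp: phiS_def ser_def)

lemma phiS_1: "phiS N hb 1 x = fps_const x * ser (phi_coef N hb 2) x"
  by (auto simp: phiS_def ser_def fps_eq_iff)

lemma tau_kernel_pde:
  assumes x: "x \<noteq> 0" and y: "y \<noteq> 0" and xy: "x + y \<noteq> 0"
  shows "\<exists>A1 A2 B1 B2. FPD2 (\<lambda>w. tau_kernel N hb w y) x A1 A2 \<and> FPD2 (\<lambda>w. tau_kernel N hb x w) y B1 B2 \<and>
     4 * (fps_X * fps_deriv (tau_kernel N hb x y)) =
       fps_X * fps_const hb * (fps_const x * A2 + fps_const y * B2 +
         fps_const (1/4 - N\<^sup>2) * (fps_const (1 / x) + fps_const (1 / y)) * tau_kernel N hb x y)"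
proof -
  define a where "a = phi_coef N hb 1"
  define v where "v = phi_coef N hb 2"
  \<comment> \<open>\<open>p\<close> and \<open>p - 2 * b\<close> are the constants
    \<open>1/4 - N\<^sup>2\<close> and \<open>1/4 - (1 - N)\<^sup>2\<close> in Bessel's equations of
    \<open>\<Phi>_1\<close> and \<open>\<Phi>_2 / \<lambda>\<close>; \<open>b\<close> and
    \<open>- b\<close> enter the contiguity relations.\<close>
  define b where "b = 1/2 - N"
  define p where "p = 1/4 - N\<^sup>2"
  have arec: "of_nat (Suc k) * a (Suc k) = hb / 4 * (of_nat (k * Suc k) + p) * a k" for k
    using phi_coef_ode[of k N hb 1] by (simp add: a_def p_def)
  have "1/4 - (of_int 2 - N - 1)\<^sup>2 = p - 2 * b"
    by (simp add: p_def b_def power2_eq_square field_simps)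
  hence vrec: "of_nat (Suc k) * v (Suc k) = hb / 4 * (of_nat (k * Suc k) + (p - 2 * b)) * v k" for k
    using phi_coef_ode[of k N hb 2] unfolding v_def by simp
  have sys: "2 * (a (Suc k) - v (Suc k)) = hb * (of_nat k + b) * a k"
    "2 * (v (Suc k) - a (Suc k)) = hb * (of_nat k + (- b)) * v k" for k
    using phi_coef_system[of N hb k] by (simp_all add: a_def v_def b_def)
  have a0: "v 0 = a 0" by (simp add: a_def v_def)
  let ?c = fps_const
  define Gd where "Gd z = ?c z * ser v z" for z
  have tau_kernel: "tau_kernel N hb = (\<lambda>x y. ?c (1 / (x + y)) * (ser a x * Gd y - Gd x * ser a y))"
    by (intro ext) (simp add: tau_kernel_def pair_kernel_def phiS_0 phiS_1[unfolded One_nat_def] a_def v_def Gd_def)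
  define G1 where "G1 z = ser v z + ?c z * ser1 v z" for z
  define G2 where "G2 z = 2 * ser1 v z + ?c z * ser2 v z" for z
  have FG: "FPD2 Gd z (G1 z) (G2 z)" if "z \<noteq> 0" for z
    using FPD2_scale[OF PD2_ident FPD2_ser[OF that]] by (simp add: G1_def G2_def Gd_def[abs_def])
  define s where "s = ?c (1 / (x + y))"
  define Nn where "Nn = ser a x * Gd y - Gd x * ser a y"
  define Nx where "Nx = ser1 a x * Gd y - G1 x * ser a y"
  define Nxx where "Nxx = ser2 a x * Gd y - G2 x * ser a y"
  define Ny where "Ny = ser a x * G1 y - Gd x * ser1 a y"
  define Nyy where "Nyy = ser a x * G2 y - Gd x * ser2 a y"
  have F1: "FPD2 (\<lambda>w. ser a w * Gd y - Gd w * ser a y) x Nx Nxx"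
    using FPD2_diff[OF FPD2_cmult[OF FPD2_ser[OF x], of "Gd y"] FPD2_cmult[OF FG[OF x], of "ser a y"]]
    unfolding Nx_def Nxx_def by (simp only: mult.commute)
  have F2: "FPD2 (\<lambda>w. ser a x * Gd w - Gd x * ser a w) y Ny Nyy"
    unfolding Ny_def Nyy_def by (intro FPD2_diff FPD2_cmult FPD2_ser FG y)
  have s2: "?c (- (1 / (x + y))\<^sup>2) = - s\<^sup>2" "?c (2 * (1 / (x + y)) ^ 3) = 2 * s ^ 3"
    by (simp_all add: s_def numeral_fps_const flip: fps_const_power fps_const_neg fps_const_mult)
  define A2 where "A2 = s * Nxx - 2 * s\<^sup>2 * Nx + 2 * s ^ 3 * Nn"
  define B2 where "B2 = s * Nyy - 2 * s\<^sup>2 * Ny + 2 * s ^ 3 * Nn"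
  have P1: "FPD2 (\<lambda>w. tau_kernel N hb w y) x (- s\<^sup>2 * Nn + s * Nx) A2"
    using FPD2_scale[OF PD2_inverse_shift[OF xy] F1]
    unfolding tau_kernel s2 s_def[symmetric] Nn_def[symmetric] A2_def by (simp add: algebra_simps)
  have yx: "y + x \<noteq> 0" using xy by (simp add: add.commute)
  have P2: "FPD2 (\<lambda>w. tau_kernel N hb x w) y (- s\<^sup>2 * Nn + s * Ny) B2"
    using FPD2_scale[OF PD2_inverse_shift[OF yx] F2]
    unfolding tau_kernel add.commute[of _ x] s2 s_def[symmetric] Nn_def[symmetric] B2_def by (simp add: algebra_simps)
  define E where "E = - (?c x * ser1 a x) * Gd y - ser a x * (?c y * ?c y * ser1 v y)
     + ?c x * ?c x * ser1 v x * ser a y + Gd x * (?c y * ser1 a y)"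
  have dG: "fps_X * fps_deriv (Gd z) = - (?c z * ?c z * ser1 v z)" if "z \<noteq> 0" for z
  proof -
    have "fps_X * fps_deriv (Gd z) = ?c z * (fps_X * fps_deriv (ser v z))"
      by (simp add: Gd_def mult_ac)
    thus ?thesis unfolding ser_euler[OF that] by (simp add: mult.assoc flip: fps_const_neg fps_const_mult)
  qed
  have "fps_X * fps_deriv Nn = (fps_X * fps_deriv (ser a x)) * Gd y + ser a x * (fps_X * fps_deriv (Gd y))
      - ((fps_X * fps_deriv (Gd x)) * ser a y + Gd x * (fps_X * fps_deriv (ser a y)))"
    unfolding Nn_def by (simp add: algebra_simps)
  also have "\<dots> = E"
    unfolding ser_euler[OF x] ser_euler[OF y] dG[OF x] dG[OF y] E_def by (simp add: algebra_simps flip: fps_const_neg fps_const_mult)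
  finally have dN: "fps_X * fps_deriv Nn = E" .
  have pk: "tau_kernel N hb x y = s * Nn" by (simp add: tau_kernel s_def Nn_def)
  have "fps_X * fps_deriv (tau_kernel N hb x y) = s * (fps_X * fps_deriv Nn)"
    unfolding pk by (simp add: s_def mult_ac)
  hence dA: "4 * (fps_X * fps_deriv (tau_kernel N hb x y)) = 4 * s * E" unfolding dN by (simp add: mult.assoc)
  have cxy: "s * (?c x + ?c y) = 1" "?c (1/x) * ?c x = 1" "?c (1/y) * ?c y = 1"
    using x y xy by (simp_all add: s_def fps_const_1_eq_1)
  have pb: "?c (p - 2 * b) = ?c p - 2 * ?c b"
    by (simp add: numeral_fps_const flip: fps_const_sub fps_const_mult)
  have mb: "fps_X * ?c hb * (?c x * ser1 v x) = - 2 * ?c x * (ser v x - ser a x) - fps_X * ?c hb * (?c b * ser v x)" if "x \<noteq> 0" for x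
    using ser_system[OF that a0[symmetric] sys(2)] by (simp add: fps_const_neg[symmetric] del: fps_const_neg)
  have "4 * s * E = fps_X * ?c hb * (?c x * A2 + ?c y * B2 + ?c p * (?c (1 / x) + ?c (1 / y)) * (s * Nn))"
    unfolding A2_def B2_def
    by (rule pair_kernel_identity[OF cxy ser_ode[OF x arec] ser_ode[OF x vrec, unfolded pb]
         ser_ode[OF y arec] ser_ode[OF y vrec, unfolded pb]
         ser_system[OF x a0 sys(1)] mb[OF x] ser_system[OF y a0 sys(1)] mb[OF y]
         Gd_def G1_def G2_def Gd_def G1_def G2_def Nn_def Nx_def Nxx_def Ny_def Nyy_def E_def])
  with dA have "4 * (fps_X * fps_deriv (tau_kernel N hb x y)) =
     fps_X * ?c hb * (?c x * A2 + ?c y * B2 + ?c p * (?c (1 / x) + ?c (1 / y)) * tau_kernel N hb x y)"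
    unfolding pk[symmetric] by simp
  thus ?thesis using P1 P2 unfolding p_def by (intro exI conjI)
qed

text \<open>A Pfaffian is a sum over perfect matchings, and in each term every variable occurs in
  exactly one kernel. Hence a second derivative in one variable never meets two factors, and the
  equation passes from the kernel to the Pfaffian as for a derivation. Points are addressed through
  labels so that one can be moved at a time.\<close>

lemma pf_pde:
  fixes A :: "complex \<Rightarrow> complex \<Rightarrow> complex fps" and lam :: "nat \<Rightarrow> complex"
  assumes pair: "\<And>i j. i \<in> set is \<Longrightarrow> j \<in> set is \<Longrightarrow> i \<noteq> j \<Longrightarrow>
     \<exists>A1 A2 B1 B2. FPD2 (\<lambda>w. A w (lam j)) (lam i) A1 A2 \<and> FPD2 (\<lambda>w. A (lam i) w) (lam j) B1 B2 \<and>
     4 * (fps_X * fps_deriv (A (lam i) (lam j))) =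
       K * (fps_const (lam i) * A2 + fps_const (lam j) * B2 + (q i + q j) * A (lam i) (lam j))"
    and dist: "distinct is"
  shows "\<exists>D1 D2. (\<forall>i\<in>set is. FPD2 (\<lambda>w. pf A (map (lam(i := w)) is)) (lam i) (D1 i) (D2 i)) \<and>
     4 * (fps_X * fps_deriv (pf A (map lam is))) =
       K * (\<Sum>i\<in>set is. fps_const (lam i) * D2 i + q i * pf A (map lam is))"
  using assms
proof (induction "is" rule: length_induct)
  case (1 "is")
  show ?case
  proof (cases "is")
    case Nil
    thus ?thesis by simp
  next
    case (Cons a js)
    have dist: "distinct js" "a \<notin> set js" using "1.prems"(2) Cons by auto
    let ?n = "length js"
    let ?P = "\<lambda>l. pf A (map lam (del_nth l js))"
    let ?A = "\<lambda>l. A (lam a) (lam (js ! l))"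
    let ?c = fps_const
    have pf_eq: "pf A (map \<mu> is) = (\<Sum>l<?n. (-1) ^ l * A (\<mu> a) (\<mu> (js ! l)) * pf A (map \<mu> (del_nth l js)))" for \<mu>
      unfolding Cons by (simp add: map_del)
    have sub: "set (del_nth l js) = set js - {js ! l}" if "l < ?n" for l
      by (rule set_del[OF dist(1) that])
    let ?pair = "\<lambda>l A1 A2 B1 B2. l < ?n \<longrightarrow> FPD2 (\<lambda>w. A w (lam (js ! l))) (lam a) A1 A2 \<and> FPD2 (\<lambda>w. A (lam a) w) (lam (js ! l)) B1 B2 \<and>
     4 * (fps_X * fps_deriv (?A l)) = K * (?c (lam a) * A2 + ?c (lam (js ! l)) * B2 + (q a + q (js ! l)) * ?A l)"
    let ?rest = "\<lambda>l D1 D2. l < ?n \<longrightarrow> (\<forall>i\<in>set (del_nth l js). FPD2 (\<lambda>w. pf A (map (lam(i := w)) (del_nth l js))) (lam i) (D1 i) (D2 i)) \<and>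
      4 * (fps_X * fps_deriv (?P l)) = K * (\<Sum>i\<in>set (del_nth l js). ?c (lam i) * D2 i + q i * ?P l)"
    have "\<forall>l. \<exists>A1 A2 B1 B2. ?pair l A1 A2 B1 B2"
    proof
      fix l
      show "\<exists>A1 A2 B1 B2. ?pair l A1 A2 B1 B2"
      proof (cases "l < ?n")
        case True
        hence mem: "js ! l \<in> set js" by simp
        hence "a \<noteq> js ! l" using dist(2) by blast
        thus ?thesis using "1.prems"(1)[of a "js ! l"] Cons mem by auto
      qed simp
    qed
    then obtain A1 A2 B1 B2 where AB: "\<And>l. l < ?n \<Longrightarrow> FPD2 (\<lambda>w. A w (lam (js ! l))) (lam a) (A1 l) (A2 l)"
      "\<And>l. l < ?n \<Longrightarrow> FPD2 (\<lambda>w. A (lam a) w) (lam (js ! l)) (B1 l) (B2 l)"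
      "\<And>l. l < ?n \<Longrightarrow> 4 * (fps_X * fps_deriv (?A l)) = K * (?c (lam a) * A2 l + ?c (lam (js ! l)) * B2 l + (q a + q (js ! l)) * ?A l)"
      by metis
    have "\<forall>l. \<exists>D1 D2. ?rest l D1 D2"
    proof
      fix l
      show "\<exists>D1 D2. ?rest l D1 D2"
      proof (cases "l < ?n")
        case True
        have "length (del_nth l js) < length is" using True Cons by simp
        moreover have "distinct (del_nth l js)" by (rule distinct_del[OF dist(1) True])
        moreover have "set (del_nth l js) \<subseteq> set is" unfolding sub[OF True] Cons by auto
        ultimately show ?thesis
          using "1.IH"[rule_format, of "del_nth l js"] "1.prems"(1) by (simp add: subset_iff)
      qed simp
    qed
    from choice[OF this] obtain D1 where "\<forall>l. \<exists>D2. ?rest l (D1 l) D2" ..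
    from choice[OF this] obtain D2 where D12: "\<forall>l. ?rest l (D1 l) (D2 l)" ..
    have D: "\<And>l i. l < ?n \<Longrightarrow> i \<in> set (del_nth l js) \<Longrightarrow>
         FPD2 (\<lambda>w. pf A (map (lam(i := w)) (del_nth l js))) (lam i) (D1 l i) (D2 l i)"
      "\<And>l. l < ?n \<Longrightarrow> 4 * (fps_X * fps_deriv (?P l)) = K * (\<Sum>i\<in>set (del_nth l js). ?c (lam i) * D2 l i + q i * ?P l)"
      using D12 by blast+
    let ?S = "\<lambda>l. (-1) ^ l * ?A l * ?P l" and ?U = "\<lambda>l. (-1) ^ l * ?P l" and ?W = "\<lambda>l. (-1) ^ l * ?A l"
    \<comment> \<open>Second derivative of the \<open>l\<close>-th term in the variable
      \<open>i\<close>: it lies in the kernel factor if it is the partner \<open>js ! l\<close>,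
      otherwise in the smaller Pfaffian.\<close>
    let ?t = "\<lambda>l i. if js ! l = i then ?U l * B2 l else ?W l * D2 l i"
    let ?s = "\<lambda>l i. ?c (lam i) * ?t l i + q i * ?S l"
    define R1 where "R1 i = (if i = a then \<Sum>l<?n. ?U l * A1 l
       else \<Sum>l<?n. if js ! l = i then ?U l * B1 l else ?W l * D1 l i)" for i
    define R2 where "R2 i = (if i = a then \<Sum>l<?n. ?U l * A2 l
       else \<Sum>l<?n. if js ! l = i then ?U l * B2 l else ?W l * D2 l i)" for i
    have unaffected: "map (lam(i := w)) zs = map lam zs" if "i \<notin> set zs" for i w zs
      using that by auto
    have FD: "FPD2 (\<lambda>w. pf A (map (lam(i := w)) is)) (lam i) (R1 i) (R2 i)" if i: "i \<in> set is" for i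
    proof (cases "i = a")
      case True
      have "pf A (map (lam(i := w)) is) = (\<Sum>l<?n. ?U l * A w (lam (js ! l)))" for w
      proof -
        have "A ((lam(i := w)) a) ((lam(i := w)) (js ! l)) = A w (lam (js ! l))" if "l < ?n" for l
        proof -
          have "js ! l \<noteq> a" using that dist(2) by (metis nth_mem)
          thus ?thesis using True by simp
        qed
        moreover have "map (lam(i := w)) (del_nth l js) = map lam (del_nth l js)" if "l < ?n" for l
          by (rule unaffected) (use sub[OF that] True dist(2) in auto)
        ultimately show ?thesis unfolding pf_eq
          by (intro sum.cong refl) (simp only: lessThan_iff mult_ac)
      qed
      moreover have "FPD2 (\<lambda>w. \<Sum>l<?n. ?U l * A w (lam (js ! l))) (lam a)
          (\<Sum>l<?n. ?U l * A1 l) (\<Sum>l<?n. ?U l * A2 l)"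
        by (rule FPD2_sum, rule FPD2_cmult, rule AB(1)) simp
      ultimately show ?thesis unfolding True R1_def R2_def by simp
    next
      case False
      hence ij: "i \<in> set js" using i Cons by auto
      have "pf A (map (lam(i := w)) is) =
        (\<Sum>l<?n. if js ! l = i then ?U l * A (lam a) w
             else ?W l * pf A (map (lam(i := w)) (del_nth l js)))" for w
        unfolding pf_eq
      proof (rule sum.cong[OF refl])
        fix l assume "l \<in> {..<?n}"
        hence l: "l < ?n" by simp
        show "(-1) ^ l * A ((lam(i := w)) a) ((lam(i := w)) (js ! l)) * pf A (map (lam(i := w)) (del_nth l js)) =
          (if js ! l = i then ?U l * A (lam a) w
             else ?W l * pf A (map (lam(i := w)) (del_nth l js)))"
        proof (cases "js ! l = i")
          case True
          have "map (lam(i := w)) (del_nth l js) = map lam (del_nth l js)"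
            by (rule unaffected) (use sub[OF l] True in auto)
          hence "pf A (map (lam(i := w)) (del_nth l js)) = ?P l" by (rule arg_cong)
          moreover have "(lam(i := w)) a = lam a" "(lam(i := w)) (js ! l) = w"
            using True False by auto
          ultimately show ?thesis unfolding if_P[OF True] by (simp only: mult_ac)
        next
          case neq: False
          thus ?thesis using False by simp
        qed
      qed
      moreover have pair: "FPD2 (\<lambda>w. if js ! l = i then ?U l * A (lam a) w
             else ?W l * pf A (map (lam(i := w)) (del_nth l js))) (lam i)
         (if js ! l = i then ?U l * B1 l else ?W l * D1 l i)
         (?t l i)" if l: "l < ?n" for l
      proof (cases "js ! l = i")
        case True
        show ?thesis using FPD2_cmult[OF AB(2)[OF l], of "?U l"] True by simp
      next
        case neq: False
        have "i \<in> set (del_nth l js)" using sub[OF l] ij neq by auto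
        from FPD2_cmult[OF D(1)[OF l this], of "?W l"] show ?thesis using neq by simp
      qed
      have "FPD2 (\<lambda>w. \<Sum>l<?n. if js ! l = i then ?U l * A (lam a) w
             else ?W l * pf A (map (lam(i := w)) (del_nth l js))) (lam i) (R1 i) (R2 i)"
        unfolding R1_def R2_def if_not_P[OF False] by (rule FPD2_sum, rule pair) simp
      ultimately show ?thesis by simp
    qed
    have step: "4 * (fps_X * fps_deriv (?S l)) =
       K * (?c (lam a) * (?U l * A2 l) + q a * ?S l +
         (\<Sum>i\<in>set js. ?s l i))" if l: "l < ?n" for l
    proof -
      have sgn: "fps_deriv ((-1) ^ l * F) = (-1) ^ l * fps_deriv F" for F :: "complex fps"
        by (cases "even l") simp_all
      have "4 * (fps_X * fps_deriv (?S l)) =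
         (-1) ^ l * (4 * (fps_X * fps_deriv (?A l)) * ?P l + ?A l * (4 * (fps_X * fps_deriv (?P l))))"
        unfolding mult.assoc[of "(-1) ^ l"] sgn unfolding fps_deriv_mult by (simp add: algebra_simps)
      also have "\<dots> = K * ((?c (lam a) * (?U l * A2 l) + q a * ?S l) +
          ((?c (lam (js ! l)) * (?U l * B2 l) + q (js ! l) * ?S l) +
         (-1) ^ l * ?A l * (\<Sum>i\<in>set (del_nth l js). ?c (lam i) * D2 l i + q i * ?P l)))"
        unfolding AB(3)[OF l] D(2)[OF l] by (simp add: algebra_simps)
      also have "(-1) ^ l * ?A l * (\<Sum>i\<in>set (del_nth l js). ?c (lam i) * D2 l i + q i * ?P l) =
         (\<Sum>i\<in>set js - {js ! l}. ?c (lam i) * (?W l * D2 l i) + q i * ?S l)"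
        unfolding sub[OF l] sum_distrib_left by (rule sum.cong) (simp_all add: algebra_simps)
      also have "(?c (lam (js ! l)) * (?U l * B2 l) + q (js ! l) * ?S l) + \<dots> =
         (\<Sum>i\<in>set js. ?s l i)"
        using l by (subst sum.remove[of "set js" "js ! l"]) (auto intro!: sum.cong)
      finally show ?thesis by (simp only: add.assoc)
    qed
    have "4 * (fps_X * fps_deriv (pf A (map lam is))) = (\<Sum>l<?n. 4 * (fps_X * fps_deriv (?S l)))"
      unfolding pf_eq by (simp only: fps_deriv_sum sum_distrib_left)
    also have "\<dots> = (\<Sum>l<?n. K * (?c (lam a) * (?U l * A2 l) + q a * ?S l +
         (\<Sum>i\<in>set js. ?s l i)))"
      by (rule sum.cong[OF refl], rule step) simp
    also have "\<dots> = K * (?c (lam a) * R2 a + q a * pf A (map lam is) +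
       (\<Sum>l<?n. \<Sum>i\<in>set js. ?s l i))"
    proof -
      have "(\<Sum>l\<in>I. K * (c * g l + qa * h l + T l)) = K * (c * (\<Sum>l\<in>I. g l) + qa * (\<Sum>l\<in>I. h l) + (\<Sum>l\<in>I. T l))"
        for c qa g h T and I :: "nat set"
        by (simp only: sum.distrib sum_distrib_left distrib_left)
      thus ?thesis unfolding pf_eq R2_def if_P[OF refl] by simp
    qed
    also have "(\<Sum>l<?n. \<Sum>i\<in>set js. ?s l i) = (\<Sum>i\<in>set js. ?c (lam i) * R2 i + q i * pf A (map lam is))"
    proof (subst sum.swap, rule sum.cong[OF refl])
      fix i assume "i \<in> set js"
      hence "i \<noteq> a" using dist by auto
      thus "(\<Sum>l<?n. ?s l i) = ?c (lam i) * R2 i + q i * pf A (map lam is)"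
        unfolding pf_eq R2_def by (simp only: if_False sum.distrib sum_distrib_left)
    qed
    also have "?c (lam a) * R2 a + q a * pf A (map lam is) + (\<Sum>i\<in>set js. ?c (lam i) * R2 i + q i * pf A (map lam is)) =
      (\<Sum>i\<in>set is. ?c (lam i) * R2 i + q i * pf A (map lam is))"
      unfolding Cons using dist by simp
    finally show ?thesis using FD by blast
  qed
qed

section \<open>The cut-and-join operator in the Miwa variables\<close>

definition supp :: "mser \<Rightarrow> nat multiset set" where
  "supp c = {T. c T \<noteq> 0}"

text \<open>Meant for polynomials in the times: the sum takes the default value 0 when the support
  is infinite, whence the finiteness hypotheses below.\<close>

definition peval :: "mser \<Rightarrow> (nat \<Rightarrow> complex) \<Rightarrow> complex" where
  "peval c t = (\<Sum>T\<in>supp c. c T * monval t T)"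

lemma peval_superset: "finite S \<Longrightarrow> supp c \<subseteq> S \<Longrightarrow> peval c t = (\<Sum>T\<in>S. c T * monval t T)"
  unfolding peval_def by (rule sum.mono_neutral_left) (auto simp: supp_def)

lemma supp_sum: "supp (\<lambda>T. \<Sum>k\<in>K. a k * h k T) \<subseteq> (\<Union>k\<in>K. supp (h k))"
proof
  fix T assume "T \<in> supp (\<lambda>T. \<Sum>k\<in>K. a k * h k T)"
  hence "(\<Sum>k\<in>K. a k * h k T) \<noteq> 0" by (simp add: supp_def)
  then obtain k where "k \<in> K" "a k * h k T \<noteq> 0" by (rule sum.not_neutral_contains_not_neutral)
  thus "T \<in> (\<Union>k\<in>K. supp (h k))" by (auto simp: supp_def)
qed

lemma supp_add: "supp (\<lambda>T. f T + g T) \<subseteq> supp f \<union> supp g"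
  by (auto simp: supp_def)

lemma supp_cmult: "supp (\<lambda>T. a * f T) \<subseteq> supp f"
  by (auto simp: supp_def)

lemma peval_sum:
  assumes "finite K" "\<And>k. k \<in> K \<Longrightarrow> finite (supp (h k))"
  shows "peval (\<lambda>T. \<Sum>k\<in>K. a k * h k T) t = (\<Sum>k\<in>K. a k * peval (h k) t)"
proof -
  let ?S = "\<Union>k\<in>K. supp (h k)"
  have S: "finite ?S" using assms by auto
  have "peval (\<lambda>T. \<Sum>k\<in>K. a k * h k T) t = (\<Sum>T\<in>?S. \<Sum>k\<in>K. a k * (h k T * monval t T))"
    by (subst peval_superset[OF S supp_sum]) (simp add: sum_distrib_right mult.assoc)
  also have "\<dots> = (\<Sum>k\<in>K. a k * (\<Sum>T\<in>?S. h k T * monval t T))"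
    unfolding sum_distrib_left by (rule sum.swap)
  also have "\<dots> = (\<Sum>k\<in>K. a k * peval (h k) t)"
    by (rule sum.cong[OF refl], subst peval_superset[OF S]) auto
  finally show ?thesis .
qed

lemma peval_add:
  assumes "finite (supp f)" "finite (supp g)"
  shows "peval (\<lambda>T. f T + g T) t = peval f t + peval g t"
  using peval_superset[of "supp f \<union> supp g" "\<lambda>T. f T + g T" t]
    peval_superset[of "supp f \<union> supp g" f t] peval_superset[of "supp f \<union> supp g" g t] assms supp_add[of f g]
  by (simp add: distrib_right sum.distrib)

lemma peval_cmult:
  assumes "finite (supp f)"
  shows "peval (\<lambda>T. a * f T) t = a * peval f t"
  using peval_superset[OF assms supp_cmult[of a f]] by (simp add: peval_def sum_distrib_left mult.assoc)

lemma tmul_nonzeroD: "tmul k F T \<noteq> 0 \<Longrightarrow> \<exists>T'. T = add_mset k T' \<and> F T' \<noteq> 0"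
  unfolding tmul_def by (metis insert_DiffM)

lemma tmul_add_mset [simp]: "tmul k F (add_mset k T) = F T"
  by (simp add: tmul_def)

lemma dt_nonzeroD: "dt k F T \<noteq> 0 \<Longrightarrow> F (add_mset k T) \<noteq> 0"
  by (auto simp: dt_def)

lemma supp_tmul: "supp (tmul k c) = add_mset k ` supp c"
proof -
  have "T \<in> add_mset k ` supp c" if "T \<in> supp (tmul k c)" for T
    using that tmul_nonzeroD[of k c T] by (auto simp: supp_def)
  thus ?thesis by (auto simp: supp_def)
qed

lemma peval_tmul: "peval (tmul k c) t = t k * peval c t"
  unfolding peval_def supp_tmul
  by (subst sum.reindex) (simp_all add: inj_on_def sum_distrib_left mult.left_commute)

lemma supp_dt: "supp (dt k c) \<subseteq> (\<lambda>T. T - {#k#}) ` supp c"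
proof
  fix T assume "T \<in> supp (dt k c)"
  hence "add_mset k T \<in> supp c" by (auto simp: supp_def dest: dt_nonzeroD)
  moreover have "T = add_mset k T - {#k#}" by simp
  ultimately show "T \<in> (\<lambda>T. T - {#k#}) ` supp c" by blast
qed

lemma finite_supp_dt [simp]: "finite (supp c) \<Longrightarrow> finite (supp (dt k c))"
  using supp_dt finite_subset by blast

lemma finite_supp_tmul [simp]: "finite (supp c) \<Longrightarrow> finite (supp (tmul k c))"
  by (simp add: supp_tmul)

lemma peval_dt:
  assumes "finite (supp c)"
  shows "peval (dt k c) t = (\<Sum>T\<in>supp c. c T * (of_nat (count T k) * monval t (T - {#k#})))"
proof -
  let ?S = "{T \<in> supp c. k \<in># T}"
  have inj: "inj_on (\<lambda>T. T - {#k#}) ?S"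
    by (rule inj_onI) (metis (no_types, lifting) insert_DiffM mem_Collect_eq)
  have sub: "supp (dt k c) \<subseteq> (\<lambda>T. T - {#k#}) ` ?S"
  proof
    fix T assume "T \<in> supp (dt k c)"
    hence "add_mset k T \<in> ?S" by (auto simp: supp_def dest: dt_nonzeroD)
    moreover have "T = add_mset k T - {#k#}" by simp
    ultimately show "T \<in> (\<lambda>T. T - {#k#}) ` ?S" by blast
  qed
  have "peval (dt k c) t = (\<Sum>T\<in>(\<lambda>T. T - {#k#}) ` ?S. dt k c T * monval t T)"
    by (rule peval_superset[OF _ sub]) (use assms in auto)
  also have "\<dots> = (\<Sum>T\<in>?S. dt k c (T - {#k#}) * monval t (T - {#k#}))"
    by (subst sum.reindex[OF inj]) simp
  also have "\<dots> = (\<Sum>T\<in>?S. c T * (of_nat (count T k) * monval t (T - {#k#})))"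
  proof (rule sum.cong[OF refl])
    fix T assume "T \<in> ?S"
    then obtain T' where T: "T = add_mset k T'" by (auto dest: multi_member_split)
    show "dt k c (T - {#k#}) * monval t (T - {#k#}) = c T * (of_nat (count T k) * monval t (T - {#k#}))"
      unfolding T by (simp add: dt_def mult_ac)
  qed
  also have "\<dots> = (\<Sum>T\<in>supp c. c T * (of_nat (count T k) * monval t (T - {#k#})))"
    by (rule sum.mono_neutral_left) (use assms in \<open>auto simp: not_in_iff\<close>)
  finally show ?thesis .
qed

lemma monval_has_derivative:
  assumes R: "finite R" "set_mset T \<subseteq> R"
    and D: "\<And>k. k \<in> R \<Longrightarrow> ((\<lambda>w. t w k) has_field_derivative t1 k) (at z)"
  shows "((\<lambda>w. monval (t w) T) has_field_derivative
     (\<Sum>k\<in>R. t1 k * (of_nat (count T k) * monval (t z) (T - {#k#})))) (at z)"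
  using R(2)
proof (induction T)
  case (add a T)
  have a: "a \<in> R" using add.prems by simp
  let ?s = "\<Sum>k\<in>R. t1 k * (of_nat (count T k) * monval (t z) (T - {#k#}))"
  have "((\<lambda>w. t w a * monval (t w) T) has_field_derivative t1 a * monval (t z) T + ?s * t z a) (at z)"
    using D[OF a] add by (intro DERIV_mult) auto
  also have "?s * t z a = (\<Sum>k\<in>R. t1 k * (of_nat (count T k) * monval (t z) (add_mset a T - {#k#})))"
    unfolding sum_distrib_right
  proof (rule sum.cong[OF refl])
    fix k
    show "t1 k * (of_nat (count T k) * monval (t z) (T - {#k#})) * t z a =
      t1 k * (of_nat (count T k) * monval (t z) (add_mset a T - {#k#}))"
    proof (cases "k \<in># T")
      case True
      then obtain T' where "T = add_mset k T'" by (auto dest: multi_member_split)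
      hence "add_mset a T - {#k#} = add_mset a (T - {#k#})" by simp
      thus ?thesis by simp
    qed (simp add: not_in_iff)
  qed
  also have "t1 a * monval (t z) T = (\<Sum>k\<in>R. if k = a then t1 k * monval (t z) (add_mset a T - {#k#}) else 0)"
    using a R(1) by simp
  also have "\<dots> + (\<Sum>k\<in>R. t1 k * (of_nat (count T k) * monval (t z) (add_mset a T - {#k#}))) =
     (\<Sum>k\<in>R. t1 k * (of_nat (count (add_mset a T) k) * monval (t z) (add_mset a T - {#k#})))"
    unfolding sum.distrib[symmetric] by (rule sum.cong) (auto simp: algebra_simps)
  finally show ?case by simp
qed simp

lemma peval_has_derivative:
  assumes fin: "finite (supp c)" and R: "finite R" "\<And>T. T \<in> supp c \<Longrightarrow> set_mset T \<subseteq> R"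
    and D: "\<And>k. k \<in> R \<Longrightarrow> ((\<lambda>w. t w k) has_field_derivative t1 k) (at z)"
  shows "((\<lambda>w. peval c (t w)) has_field_derivative (\<Sum>k\<in>R. t1 k * peval (dt k c) (t z))) (at z)"
proof -
  have "((\<lambda>w. peval c (t w)) has_field_derivative
     (\<Sum>T\<in>supp c. c T * (\<Sum>k\<in>R. t1 k * (of_nat (count T k) * monval (t z) (T - {#k#}))))) (at z)"
    unfolding peval_def by (intro DERIV_sum DERIV_cmult monval_has_derivative R D)
  also have "(\<Sum>T\<in>supp c. c T * (\<Sum>k\<in>R. t1 k * (of_nat (count T k) * monval (t z) (T - {#k#})))) =
     (\<Sum>k\<in>R. t1 k * peval (dt k c) (t z))"
    unfolding peval_dt[OF fin] sum_distrib_left by (subst sum.swap) (simp add: mult_ac)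
  finally show ?thesis .
qed

text \<open>Chain rule to second order: the single sum comes from the accelerations of the times,
  the double sum from products of their velocities.\<close>

lemma PD2_peval:
  assumes fin: "finite (supp c)" and R: "finite R" "\<And>T. T \<in> supp c \<Longrightarrow> set_mset T \<subseteq> R"
    and D: "\<forall>\<^sub>F w in nhds z. \<forall>k\<in>R. ((\<lambda>w. t w k) has_field_derivative t1 w k) (at w)"
    and D2: "\<And>k. k \<in> R \<Longrightarrow> ((\<lambda>w. t1 w k) has_field_derivative t2 k) (at z)"
  shows "PD2 (\<lambda>w. peval c (t w)) z (\<Sum>k\<in>R. t1 z k * peval (dt k c) (t z))
     ((\<Sum>k\<in>R. t2 k * peval (dt k c) (t z)) + (\<Sum>k\<in>R. \<Sum>l\<in>R. t1 z k * t1 z l * peval (dt l (dt k c)) (t z)))"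
proof -
  have sub: "set_mset T \<subseteq> R" if "T \<in> supp (dt k c)" for T k
  proof -
    have "add_mset k T \<in> supp c" using that by (auto simp: supp_def dest: dt_nonzeroD)
    from R(2)[OF this] show ?thesis by simp
  qed
  have D1: "((\<lambda>w. t w k) has_field_derivative t1 z k) (at z)" if "k \<in> R" for k
    using eventually_nhds_x_imp_x[OF D] that by blast
  have 1: "\<forall>\<^sub>F w in nhds z. ((\<lambda>w. peval c (t w)) has_field_derivative (\<Sum>k\<in>R. t1 w k * peval (dt k c) (t w))) (at w)"
    using D by eventually_elim (intro peval_has_derivative fin R, auto)
  have "((\<lambda>w. \<Sum>k\<in>R. t1 w k * peval (dt k c) (t w)) has_field_derivative
    (\<Sum>k\<in>R. t2 k * peval (dt k c) (t z) + (\<Sum>l\<in>R. t1 z l * peval (dt l (dt k c)) (t z)) * t1 z k)) (at z)"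
    by (intro DERIV_sum DERIV_mult D2 peval_has_derivative finite_supp_dt fin R(1) sub D1)
  also have "(\<Sum>k\<in>R. t2 k * peval (dt k c) (t z) + (\<Sum>l\<in>R. t1 z l * peval (dt l (dt k c)) (t z)) * t1 z k) =
     (\<Sum>k\<in>R. t2 k * peval (dt k c) (t z)) + (\<Sum>k\<in>R. \<Sum>l\<in>R. t1 z k * t1 z l * peval (dt l (dt k c)) (t z))"
    unfolding sum.distrib sum_distrib_right by (simp add: mult_ac)
  finally show ?thesis unfolding PD2_def using 1
    by (intro exI[of _ "\<lambda>w. \<Sum>k\<in>R. t1 w k * peval (dt k c) (t w)"]) blast
qed

section \<open>Truncation and weight grading of the cut-and-join operator\<close>

definition Wfin :: "complex \<Rightarrow> nat \<Rightarrow> mser \<Rightarrow> mser" where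
  "Wfin N B F T =
     1/2 * (\<Sum>(k,m)\<in>{..<B}\<times>{..<B}. of_nat ((2*k+1)*(2*m+1)) *
              tmul (2*k+1) (tmul (2*m+1) (dt (2*k+2*m+1) F)) T)
   + 1/4 * (\<Sum>(k,m)\<in>{..<B}\<times>{..<B}. of_nat (2*k+2*m+3) *
              tmul (2*k+2*m+3) (dt (2*k+1) (dt (2*m+1) F)) T)
   + (1/16 - N^2/4) * tmul 1 F T"

lemma infsum_eq_sum:
  assumes "finite A" "\<And>x. x \<notin> A \<Longrightarrow> f x = 0"
  shows "infsum f UNIV = sum f A"
proof -
  have "infsum f UNIV = infsum f A" by (rule infsum_cong_neutral) (use assms in auto)
  thus ?thesis using assms(1) by simp
qed

text \<open>Each summand multiplies by times that must divide \<open>T\<close>, and a factor of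
  \<open>T\<close> has index at most the weight of \<open>T\<close>. This bounds \<open>k\<close>
  and \<open>m\<close>.\<close>

lemma Wop_eq_Wfin:
  assumes "sum_mset T < B"
  shows "Wop N F T = Wfin N B F T"
proof -
  have mem: "k \<le> sum_mset T" if "k \<in># T" for k by (rule mem_le_sum_mset[OF that])
  have "(\<Sum>\<^sub>\<infinity>(k,m)\<in>UNIV. of_nat ((2*k+1)*(2*m+1)) * tmul (2*k+1) (tmul (2*m+1) (dt (2*k+2*m+1) F)) T) =
     (\<Sum>(k,m)\<in>{..<B}\<times>{..<B}. of_nat ((2*k+1)*(2*m+1)) * tmul (2*k+1) (tmul (2*m+1) (dt (2*k+2*m+1) F)) T)"
  proof (rule infsum_eq_sum)
    fix x :: "nat \<times> nat" assume x: "x \<notin> {..<B} \<times> {..<B}"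
    obtain k m where km: "x = (k, m)" by (cases x)
    have "tmul (2*k+1) (tmul (2*m+1) (dt (2*k+2*m+1) F)) T = 0"
    proof (rule ccontr)
      assume "\<not> ?thesis"
      then obtain T' where "T = add_mset (2*k+1) T'" "tmul (2*m+1) (dt (2*k+2*m+1) F) T' \<noteq> 0"
        using tmul_nonzeroD by blast
      moreover from this(2) obtain T'' where "T' = add_mset (2*m+1) T''" using tmul_nonzeroD by blast
      ultimately show False using assms x km by auto
    qed
    thus "(case x of (k, m) \<Rightarrow> of_nat ((2*k+1)*(2*m+1)) * tmul (2*k+1) (tmul (2*m+1) (dt (2*k+2*m+1) F)) T) = 0"
      by (simp add: km)
  qed simp
  moreover have "(\<Sum>\<^sub>\<infinity>(k,m)\<in>UNIV. of_nat (2*k+2*m+3) * tmul (2*k+2*m+3) (dt (2*k+1) (dt (2*m+1) F)) T) =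
     (\<Sum>(k,m)\<in>{..<B}\<times>{..<B}. of_nat (2*k+2*m+3) * tmul (2*k+2*m+3) (dt (2*k+1) (dt (2*m+1) F)) T)"
  proof (rule infsum_eq_sum)
    fix x :: "nat \<times> nat" assume x: "x \<notin> {..<B} \<times> {..<B}"
    obtain k m where km: "x = (k, m)" by (cases x)
    have "tmul (2*k+2*m+3) (dt (2*k+1) (dt (2*m+1) F)) T = 0"
    proof (rule ccontr)
      assume "\<not> ?thesis"
      then obtain T' where "T = add_mset (2*k+2*m+3) T'" using tmul_nonzeroD by blast
      thus False using assms x km by auto
    qed
    thus "(case x of (k, m) \<Rightarrow> of_nat (2*k+2*m+3) * tmul (2*k+2*m+3) (dt (2*k+1) (dt (2*m+1) F)) T) = 0"
      by (simp add: km)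
  qed simp
  ultimately show ?thesis unfolding Wop_def Wfin_def by simp
qed

definition homog :: "nat \<Rightarrow> mser \<Rightarrow> bool" where
  "homog d c \<longleftrightarrow> (\<forall>T. c T \<noteq> 0 \<longrightarrow> sum_mset T = d \<and> (\<forall>i\<in>#T. odd i))"

lemma homog_supp: "homog d c \<Longrightarrow> supp c \<subseteq> Wt d"
  by (force simp: homog_def supp_def Wt_def)

lemma homog_finite_supp: "homog d c \<Longrightarrow> finite (supp c)"
  by (rule finite_subset[OF homog_supp finite_Wt])

text \<open>Both kinds of terms raise the weight by one and keep all indices odd:
  \<open>(2k+1) + (2m+1)\<close> exceeds \<open>2k+2m+1\<close> by one, and \<open>2k+2m+3\<close>
  exceeds \<open>(2k+1) + (2m+1)\<close> by one.\<close>

lemma Wfin_nonzero: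
  assumes c: "homog d c" and T: "Wfin N B c T \<noteq> 0"
  shows "sum_mset T = Suc d \<and> (\<forall>i\<in>#T. odd i)"
proof -
  have add_ne: "a \<noteq> 0 \<or> b \<noteq> 0 \<or> e \<noteq> 0" if "1/2 * a + 1/4 * b + r * e \<noteq> 0" for a b e r :: complex
    using that by auto
  have sum_ne: "\<exists>k m. h k m \<noteq> 0" if ne: "(\<Sum>(k,m)\<in>K. of_nat (a k m) * h k m) \<noteq> 0"
    for a :: "nat \<Rightarrow> nat \<Rightarrow> nat" and h :: "nat \<Rightarrow> nat \<Rightarrow> complex" and K
  proof -
    obtain p where "(case p of (k, m) \<Rightarrow> of_nat (a k m) * h k m) \<noteq> 0"
      using sum.not_neutral_contains_not_neutral[OF ne] by blast
    thus ?thesis by (cases p) (simp, blast)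
  qed
  have "(\<exists>k m. tmul (2*k+1) (tmul (2*m+1) (dt (2*k+2*m+1) c)) T \<noteq> 0) \<or>
    (\<exists>k m. tmul (2*k+2*m+3) (dt (2*k+1) (dt (2*m+1) c)) T \<noteq> 0) \<or> tmul 1 c T \<noteq> 0"
    using add_ne[OF T[unfolded Wfin_def]]
      sum_ne[of "\<lambda>k m. (2*k+1)*(2*m+1)" "\<lambda>k m. tmul (2*k+1) (tmul (2*m+1) (dt (2*k+2*m+1) c)) T" "{..<B}\<times>{..<B}"]
      sum_ne[of "\<lambda>k m. 2*k+2*m+3" "\<lambda>k m. tmul (2*k+2*m+3) (dt (2*k+1) (dt (2*m+1) c)) T" "{..<B}\<times>{..<B}"]
    by blast
  then consider
      k m where "tmul (2*k+1) (tmul (2*m+1) (dt (2*k+2*m+1) c)) T \<noteq> 0"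
    | k m where "tmul (2*k+2*m+3) (dt (2*k+1) (dt (2*m+1) c)) T \<noteq> 0"
    | "tmul 1 c T \<noteq> 0"
    by blast
  thus ?thesis
  proof cases
    case (1 k m)
    then obtain T' where T': "T = add_mset (2*k+1) T'" "tmul (2*m+1) (dt (2*k+2*m+1) c) T' \<noteq> 0"
      using tmul_nonzeroD by blast
    from this(2) obtain T'' where T'': "T' = add_mset (2*m+1) T''" "dt (2*k+2*m+1) c T'' \<noteq> 0"
      using tmul_nonzeroD by blast
    from dt_nonzeroD[OF this(2)] c have "sum_mset (add_mset (2*k+2*m+1) T'') = d" "\<forall>i\<in>#T''. odd i"
      unfolding homog_def by auto
    thus ?thesis using T' T'' by auto
  next
    case (2 k m)
    then obtain T' where T': "T = add_mset (2*k+2*m+3) T'" "dt (2*k+1) (dt (2*m+1) c) T' \<noteq> 0"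
      using tmul_nonzeroD by blast
    from dt_nonzeroD[OF dt_nonzeroD[OF this(2)]] c
    have "sum_mset (add_mset (2*m+1) (add_mset (2*k+1) T')) = d" "\<forall>i\<in>#T'. odd i"
      unfolding homog_def by auto
    thus ?thesis using T' by auto
  next
    case 3
    then obtain T' where T': "T = add_mset 1 T'" "c T' \<noteq> 0" using tmul_nonzeroD by blast
    thus ?thesis using c unfolding homog_def by auto
  qed
qed

text \<open>One truncation serves all monomials: those of weight \<open>Suc d\<close> lie below the
  bound, and on all others both sides vanish.\<close>

lemma Wop_homog:
  assumes "homog d c"
  shows "homog (Suc d) (Wop N c)" "Wop N c = Wfin N (Suc (Suc d)) c"
proof -
  show h: "homog (Suc d) (Wop N c)"
    unfolding homog_def using Wfin_nonzero[OF assms] Wop_eq_Wfin[OF lessI] by metis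
  show "Wop N c = Wfin N (Suc (Suc d)) c"
  proof
    fix T
    show "Wop N c T = Wfin N (Suc (Suc d)) c T"
    proof (cases "sum_mset T = Suc d")
      case True
      thus ?thesis by (intro Wop_eq_Wfin) simp
    next
      case False
      hence "Wop N c T = 0" using h unfolding homog_def by blast
      moreover have "Wfin N (Suc (Suc d)) c T = 0" using Wfin_nonzero[OF assms] False by blast
      ultimately show ?thesis by simp
    qed
  qed
qed

section \<open>The cut-and-join operator as a differential operator in the points\<close>

lemma sum_triangle:
  fixes q :: "nat \<Rightarrow> complex"
  assumes "\<And>s. s \<ge> B \<Longrightarrow> q s = 0"
  shows "(\<Sum>k<B. \<Sum>m<B. a k * b m * q (k + m)) = (\<Sum>s<B. q s * (\<Sum>k\<le>s. a k * b (s - k)))"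
proof -
  have "(\<Sum>k<B. \<Sum>m<B. a k * b m * q (k + m)) = (\<Sum>(k,m)\<in>{..<B}\<times>{..<B}. a k * b m * q (k + m))"
    by (simp add: sum.cartesian_product)
  also have "\<dots> = (\<Sum>(k,m)\<in>{(k,m). k + m < B}. a k * b m * q (k + m))"
    by (rule sum.mono_neutral_right) (auto, metis assms not_less)
  also have "\<dots> = (\<Sum>s<B. \<Sum>k\<le>s. a k * b (s - k) * q (k + (s - k)))"
    by (rule sum.triangle_reindex)
  also have "\<dots> = (\<Sum>s<B. q s * (\<Sum>k\<le>s. a k * b (s - k)))"
    unfolding sum_distrib_left by (intro sum.cong) (auto simp: mult_ac)
  finally show ?thesis .
qed

text \<open>A geometric sum in \<open>1 / x\<^sup>2\<close> and \<open>1 / y\<^sup>2\<close>. Its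
  denominator \<open>x\<^sup>2 - y\<^sup>2\<close> is the source of the logarithmic derivative of
  the Vandermonde ratio.\<close>

lemma geometric_odd:
  fixes x y :: complex
  assumes "x \<noteq> 0" "y \<noteq> 0" "x\<^sup>2 \<noteq> y\<^sup>2"
  shows "(\<Sum>k\<le>s. (1/x) ^ (2*k+1) * (1/y) ^ (2*(s-k)+1)) =
     x * y / (x\<^sup>2 - y\<^sup>2) * ((1/y) ^ (2 * s + 2) - (1/x) ^ (2 * s + 2))"
proof -
  define u where "u = (1/x)\<^sup>2"
  define v where "v = (1/y)\<^sup>2"
  define w where "w = 1 / (x\<^sup>2 * y\<^sup>2)"
  define S where "S = (\<Sum>k\<le>s. (1/x) ^ (2*k+1) * (1/y) ^ (2*(s-k)+1))"
  have pw: "(1/x) ^ (2*k+1) = u ^ k * (1/x)" "(1/y) ^ (2*k+1) = v ^ k * (1/y)"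
     "(1/x) ^ (2*k+2) = u ^ Suc k" "(1/y) ^ (2*k+2) = v ^ Suc k" for k
    unfolding u_def v_def power_mult[symmetric] by (simp_all add: power_add power2_eq_square)
  have "S = 1/x * (1/y) * (\<Sum>k<Suc s. u ^ k * v ^ (s - k))"
    unfolding S_def pw sum_distrib_left lessThan_Suc_atMost by (rule sum.cong) (simp_all add: mult_ac)
  hence e: "(u - v) * S = 1/x * (1/y) * (u ^ Suc s - v ^ Suc s)"
    unfolding diff_power_eq_sum by (simp only: mult_ac)
  have d: "u - v = - (w * (x\<^sup>2 - y\<^sup>2))"
    using assms by (simp add: u_def v_def w_def field_simps)
  have p: "1/x * (1/y) = w * (x * y)"
    using assms by (simp add: w_def field_simps power2_eq_square)
  have "w * ((x\<^sup>2 - y\<^sup>2) * S) = w * (x * y * (v ^ Suc s - u ^ Suc s))"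
    using e unfolding d p by (simp add: algebra_simps)
  moreover have "w \<noteq> 0" using assms by (simp add: w_def)
  ultimately have eq: "(x\<^sup>2 - y\<^sup>2) * S = x * y * (v ^ Suc s - u ^ Suc s)" by simp
  have ne: "x\<^sup>2 - y\<^sup>2 \<noteq> 0" using assms(3) by simp
  have "S = x * y * (v ^ Suc s - u ^ Suc s) / (x\<^sup>2 - y\<^sup>2)"
    by (simp only: eq[symmetric] nonzero_mult_div_cancel_left[OF ne])
  thus ?thesis unfolding S_def[symmetric] unfolding pw by simp
qed

lemma sum_swap_antisym:
  fixes c :: "nat \<Rightarrow> nat \<Rightarrow> complex"
  assumes "\<And>i j. c i j = - c j i"
  shows "(\<Sum>i<M. \<Sum>j\<in>{..<M} - {i}. c i j * h j) = - (\<Sum>i<M. \<Sum>j\<in>{..<M} - {i}. c i j * h i)"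
proof -
  have conv: "(\<Sum>i<M. \<Sum>j\<in>{..<M} - {i}. g i j) = (\<Sum>i<M. \<Sum>j<M. if i = j then 0 else g i j)" for g :: "nat \<Rightarrow> nat \<Rightarrow> complex"
    by (intro sum.cong refl sum.mono_neutral_cong_left) auto
  have "(\<Sum>i<M. \<Sum>j<M. if i = j then 0 else c i j * h j) = (\<Sum>j<M. \<Sum>i<M. if i = j then 0 else c i j * h j)"
    by (rule sum.swap)
  also have "\<dots> = (\<Sum>j<M. \<Sum>i<M. - (if j = i then 0 else c j i * h j))"
  proof (intro sum.cong refl)
    fix i j
    show "(if i = j then 0 else c i j * h j) = - (if j = i then 0 else c j i * h j)"
      by (cases "i = j") (simp_all add: assms[of i j])
  qed
  also have "\<dots> = - (\<Sum>j<M. \<Sum>i<M. if j = i then 0 else c j i * h j)"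
    by (simp only: sum_negf)
  finally show ?thesis unfolding conv .
qed

definition lam_times :: "nat \<Rightarrow> (nat \<Rightarrow> complex) \<Rightarrow> nat \<Rightarrow> complex" where
  "lam_times M lam = miwa_time M (\<lambda>i. 1 / lam i)"

text \<open>Logarithmic derivative in \<open>lam i\<close> of the product of the
  \<open>(lam i - lam j) / (lam i + lam j)\<close>, since
  \<open>1 / (a - b) - 1 / (a + b) = 2 * b / (a\<^sup>2 - b\<^sup>2)\<close>.\<close>

definition ratio_logderiv :: "nat \<Rightarrow> (nat \<Rightarrow> complex) \<Rightarrow> nat \<Rightarrow> complex" where
  "ratio_logderiv M lam i = (\<Sum>j\<in>{..<M} - {i}. 2 * lam j / ((lam i)\<^sup>2 - (lam j)\<^sup>2))"

lemma generic_square: "generic M lam \<Longrightarrow> i < M \<Longrightarrow> j < M \<Longrightarrow> i \<noteq> j \<Longrightarrow> (lam i)\<^sup>2 \<noteq> (lam j)\<^sup>2"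
  unfolding generic_def by (metis eq_neg_iff_add_eq_0 power2_eq_iff)

lemma generic_neq_0: "generic M lam \<Longrightarrow> i < M \<Longrightarrow> lam i \<noteq> 0"
  unfolding generic_def by blast

text \<open>The product of two power sums is a double sum over points. Its diagonal yields the part
  of the second derivative in which a time is differentiated twice; the off-diagonal terms are
  geometric sums and yield the first-order term with \<open>ratio_logderiv\<close>.\<close>

lemma cut_join_quadratic:
  assumes gen: "generic M lam" and q: "\<And>s. s \<ge> B \<Longrightarrow> q s = 0"
  shows "1/2 * (\<Sum>k<B. \<Sum>m<B. of_nat ((2*k+1)*(2*m+1)) * (lam_times M lam (2*k+1) * (lam_times M lam (2*m+1) * q (k + m)))) =
     1/4 * (\<Sum>i<M. lam i * (\<Sum>s<B. of_nat (2 * s + 2) * (1 / lam i) ^ (2 * s + 3) * q s)) +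
     1/2 * (\<Sum>i<M. lam i * ratio_logderiv M lam i * (\<Sum>s<B. - ((1 / lam i) ^ (2 * s + 2)) * q s))"
proof -
  let ?x = "\<lambda>i. 1 / lam i"
  have t: "of_nat (2*k+1) * lam_times M lam (2*k+1) = (\<Sum>i<M. ?x i ^ (2*k+1))" for k
  proof -
    have ne: "of_nat (2*k+1) \<noteq> (0 :: complex)" by (simp only: of_nat_eq_0_iff)
    show ?thesis
      unfolding lam_times_def miwa_time_def times_divide_eq_right by (rule nonzero_mult_div_cancel_left[OF ne])
  qed
  let ?g = "\<lambda>s i j. \<Sum>k\<le>s. ?x i ^ (2*k+1) * ?x j ^ (2*(s-k)+1)"
  have "(\<Sum>k<B. \<Sum>m<B. of_nat ((2*k+1)*(2*m+1)) * (lam_times M lam (2*k+1) * (lam_times M lam (2*m+1) * q (k + m)))) =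
    (\<Sum>k<B. \<Sum>m<B. (\<Sum>i<M. ?x i ^ (2*k+1)) * (\<Sum>j<M. ?x j ^ (2*m+1)) * q (k + m))"
    unfolding t[symmetric] by (intro sum.cong refl) (simp only: of_nat_mult mult_ac)
  also have "\<dots> = (\<Sum>s<B. q s * (\<Sum>k\<le>s. (\<Sum>i<M. ?x i ^ (2*k+1)) * (\<Sum>j<M. ?x j ^ (2*(s-k)+1))))"
    by (rule sum_triangle[OF q])
  also have "\<dots> = (\<Sum>s<B. q s * (\<Sum>i<M. \<Sum>j<M. ?g s i j))"
  proof (rule sum.cong[OF refl])
    fix s
    have "(\<Sum>k\<le>s. (\<Sum>i<M. ?x i ^ (2*k+1)) * (\<Sum>j<M. ?x j ^ (2*(s-k)+1))) =
      (\<Sum>k\<le>s. \<Sum>i<M. \<Sum>j<M. ?x i ^ (2*k+1) * ?x j ^ (2*(s-k)+1))"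
      by (simp only: sum_product)
    also have "\<dots> = (\<Sum>i<M. \<Sum>k\<le>s. \<Sum>j<M. ?x i ^ (2*k+1) * ?x j ^ (2*(s-k)+1))"
      by (rule sum.swap)
    also have "\<dots> = (\<Sum>i<M. \<Sum>j<M. ?g s i j)"
      by (rule sum.cong[OF refl], rule sum.swap)
    finally show "q s * (\<Sum>k\<le>s. (\<Sum>i<M. ?x i ^ (2*k+1)) * (\<Sum>j<M. ?x j ^ (2*(s-k)+1))) = q s * (\<Sum>i<M. \<Sum>j<M. ?g s i j)"
      by simp
  qed
  also have "\<dots> = (\<Sum>s<B. q s * (\<Sum>i<M. of_nat (s + 1) * ?x i ^ (2 * s + 2))) +
     (\<Sum>s<B. q s * (\<Sum>i<M. \<Sum>j\<in>{..<M} - {i}. ?g s i j))"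
    unfolding sum.distrib[symmetric] distrib_left[symmetric]
  proof (intro sum.cong refl arg_cong2[where f="(*)"])
    fix s i assume i: "i \<in> {..<M}"
    have "?g s i i = (\<Sum>k\<le>s. ?x i ^ (2 * s + 2))"
      by (rule sum.cong[OF refl]) (simp flip: power_add add: algebra_simps)
    hence "?g s i i = of_nat (s + 1) * ?x i ^ (2 * s + 2)" by (simp add: algebra_simps)
    thus "(\<Sum>j<M. ?g s i j) = of_nat (s + 1) * ?x i ^ (2 * s + 2) + (\<Sum>j\<in>{..<M} - {i}. ?g s i j)"
      using i by (subst sum.remove[of _ i]) auto
  qed
  \<comment> \<open>The coefficient is antisymmetric in \<open>i\<close> and \<open>j\<close>, so
    exchanging the names in half of the terms leaves only powers of \<open>1 / lam i\<close> and a
    factor 2.\<close>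
  also have "(\<Sum>s<B. q s * (\<Sum>i<M. \<Sum>j\<in>{..<M} - {i}. ?g s i j)) =
     2 * (\<Sum>s<B. q s * (\<Sum>i<M. \<Sum>j\<in>{..<M} - {i}. - (lam i * lam j / ((lam i)\<^sup>2 - (lam j)\<^sup>2) * ?x i ^ (2 * s + 2))))"
    unfolding sum_distrib_left[of 2]
  proof (rule sum.cong[OF refl])
    fix s
    let ?c = "\<lambda>i j. lam i * lam j / ((lam i)\<^sup>2 - (lam j)\<^sup>2)"
    have anti: "?c i j = - ?c j i" for i j
      by (metis (no_types, lifting) minus_diff_eq minus_divide_right mult.commute)
    have "(\<Sum>i<M. \<Sum>j\<in>{..<M} - {i}. ?g s i j) =
      (\<Sum>i<M. \<Sum>j\<in>{..<M} - {i}. ?c i j * ?x j ^ (2 * s + 2) - ?c i j * ?x i ^ (2 * s + 2))"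
      unfolding right_diff_distrib[symmetric]
      by (intro sum.cong refl geometric_odd generic_neq_0[OF gen] generic_square[OF gen]) auto
    also have "\<dots> = 2 * (\<Sum>i<M. \<Sum>j\<in>{..<M} - {i}. - (?c i j * ?x i ^ (2 * s + 2)))"
      unfolding sum_subtractf sum_swap_antisym[OF anti, where h="\<lambda>j. ?x j ^ (2 * s + 2)"] sum_negf by simp
    finally show "q s * (\<Sum>i<M. \<Sum>j\<in>{..<M} - {i}. ?g s i j) =
       2 * (q s * (\<Sum>i<M. \<Sum>j\<in>{..<M} - {i}. - (?c i j * ?x i ^ (2 * s + 2))))"
      by (simp only: mult.left_commute)
  qed
  finally have eq: "(\<Sum>k<B. \<Sum>m<B. of_nat ((2*k+1)*(2*m+1)) * (lam_times M lam (2*k+1) * (lam_times M lam (2*m+1) * q (k + m)))) =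
     (\<Sum>s<B. q s * (\<Sum>i<M. of_nat (s + 1) * ?x i ^ (2 * s + 2))) +
     2 * (\<Sum>s<B. q s * (\<Sum>i<M. \<Sum>j\<in>{..<M} - {i}. - (lam i * lam j / ((lam i)\<^sup>2 - (lam j)\<^sup>2) * ?x i ^ (2 * s + 2))))" .
  have 1: "(\<Sum>s<B. q s * (\<Sum>i<M. of_nat (s + 1) * ?x i ^ (2 * s + 2))) =
     1/2 * (\<Sum>i<M. lam i * (\<Sum>s<B. of_nat (2 * s + 2) * ?x i ^ (2 * s + 3) * q s))"
    unfolding sum_distrib_left
  proof (subst sum.swap, intro sum.cong refl)
    fix i s assume "i \<in> {..<M}"
    hence "lam i \<noteq> 0" using generic_neq_0[OF gen] by simp
    moreover have "?x i ^ (2 * s + 3) = ?x i ^ (2 * s + 2) * ?x i" by (simp add: eval_nat_numeral)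
    ultimately show "q s * (of_nat (s + 1) * ?x i ^ (2 * s + 2)) =
       1/2 * (lam i * (of_nat (2 * s + 2) * ?x i ^ (2 * s + 3) * q s))"
      by (simp add: field_simps)
  qed
  have 2: "2 * (\<Sum>s<B. q s * (\<Sum>i<M. \<Sum>j\<in>{..<M} - {i}. - (lam i * lam j / ((lam i)\<^sup>2 - (lam j)\<^sup>2) * ?x i ^ (2 * s + 2)))) =
     (\<Sum>i<M. lam i * ratio_logderiv M lam i * (\<Sum>s<B. - (?x i ^ (2 * s + 2)) * q s))"
    unfolding sum_distrib_left ratio_logderiv_def sum_distrib_right
  proof (subst sum.swap, intro sum.cong refl)
    fix i s j
    show "2 * (q s * - (lam i * lam j / ((lam i)\<^sup>2 - (lam j)\<^sup>2) * ?x i ^ (2 * s + 2))) =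
      lam i * (2 * lam j / ((lam i)\<^sup>2 - (lam j)\<^sup>2)) * (- (?x i ^ (2 * s + 2)) * q s)"
      by simp
  qed
  show ?thesis unfolding eq 1 2 by simp
qed

text \<open>The derivative of time \<open>k\<close> in \<open>lam i\<close> is
  \<open>- (1 / lam i) ^ (k + 1)\<close>, so the inner sums are the first and second derivatives of
  \<open>peval c\<close> in \<open>lam i\<close>. Thus \<open>W\<close> acts as the sum over
  \<open>i\<close> of \<open>1/4 * lam i * d_i^2 + 1/2 * lam i * ratio_logderiv M lam i *
  d_i\<close> and a multiple of \<open>1 / lam i\<close>.\<close>

lemma peval_Wop:
  assumes gen: "generic M lam" and c: "homog d c"
  defines "t \<equiv> lam_times M lam" and "B \<equiv> Suc (Suc d)"
  shows "peval (Wop N c) t =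
     1/4 * (\<Sum>i<M. lam i * ((\<Sum>s<B. of_nat (2 * s + 2) * (1 / lam i) ^ (2 * s + 3) * peval (dt (2 * s + 1) c) t) +
        (\<Sum>k<B. \<Sum>l<B. (1 / lam i) ^ (2 * k + 2) * (1 / lam i) ^ (2 * l + 2) * peval (dt (2 * l + 1) (dt (2 * k + 1) c)) t))) +
     1/2 * (\<Sum>i<M. lam i * ratio_logderiv M lam i * (\<Sum>s<B. - ((1 / lam i) ^ (2 * s + 2)) * peval (dt (2 * s + 1) c) t)) +
     (1/16 - N\<^sup>2/4) * (\<Sum>i<M. 1 / lam i) * peval c t"
proof -
  let ?Q = "\<lambda>s. peval (dt (2 * s + 1) c) t"
  let ?K = "{..<B} \<times> {..<B}"
  have fin: "finite (supp c)" by (rule homog_finite_supp[OF c])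
  have Q0: "?Q s = 0" if "s \<ge> B" for s
  proof -
    have "dt (2 * s + 1) c T = 0" for T
    proof (rule ccontr)
      assume "dt (2 * s + 1) c T \<noteq> 0"
      from dt_nonzeroD[OF this] c have "sum_mset (add_mset (2 * s + 1) T) = d" unfolding homog_def by blast
      thus False using that by (simp add: B_def)
    qed
    thus ?thesis by (simp add: peval_def)
  qed
  define W1 where "W1 = (\<lambda>T. \<Sum>p\<in>?K. of_nat ((2*fst p+1)*(2 * snd p+1)) * tmul (2*fst p+1) (tmul (2 * snd p+1) (dt (2*fst p+2 * snd p+1) c)) T)"
  define W2 where "W2 = (\<lambda>T. \<Sum>p\<in>?K. of_nat (2*fst p+2 * snd p+3) * tmul (2*fst p+2 * snd p+3) (dt (2*fst p+1) (dt (2 * snd p+1) c)) T)"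
  have W: "Wop N c = (\<lambda>T. 1/2 * W1 T + (1/4 * W2 T + (1/16 - N\<^sup>2/4) * tmul 1 c T))"
    unfolding Wop_homog(2)[OF c] B_def[symmetric]
    by (rule ext) (simp add: Wfin_def W1_def W2_def case_prod_unfold)
  have f1: "finite (supp W1)" unfolding W1_def
    by (rule finite_subset[OF supp_sum]) (auto intro!: finite_supp_tmul finite_supp_dt fin)
  have f2: "finite (supp W2)" unfolding W2_def
    by (rule finite_subset[OF supp_sum]) (auto intro!: finite_supp_tmul finite_supp_dt fin)
  have f3: "finite (supp (tmul 1 c))" by (rule finite_supp_tmul[OF fin])
  have fc: "finite (supp (\<lambda>T. a * F T))" if "finite (supp F)" for a F
    by (rule finite_subset[OF supp_cmult that])
  have "peval (Wop N c) t = 1/2 * peval W1 t + (1/4 * peval W2 t + (1/16 - N\<^sup>2/4) * peval (tmul 1 c) t)"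
    unfolding W
    by (simp only: peval_add peval_cmult f1 f2 f3 fc finite_subset[OF supp_add] finite_Un)
  also have "peval W1 t = (\<Sum>k<B. \<Sum>m<B. of_nat ((2*k+1)*(2*m+1)) * (t (2*k+1) * (t (2*m+1) * ?Q (k + m))))"
  proof -
    have "peval W1 t = (\<Sum>p\<in>?K. of_nat ((2*fst p+1)*(2 * snd p+1)) * (t (2*fst p+1) * (t (2 * snd p+1) * peval (dt (2*fst p+2 * snd p+1) c) t)))"
      unfolding W1_def
      by (subst peval_sum) (simp_all only: peval_tmul finite_supp_tmul finite_supp_dt fin finite_cartesian_product finite_lessThan)
    thus ?thesis by (simp add: sum.cartesian_product case_prod_unfold distrib_left)
  qed
  also have "peval W2 t = (\<Sum>i<M. lam i * (\<Sum>k<B. \<Sum>l<B. (1 / lam i) ^ (2 * k + 2) * (1 / lam i) ^ (2 * l + 2) * peval (dt (2 * l + 1) (dt (2 * k + 1) c)) t))"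
  proof -
    let ?R = "\<lambda>k m. peval (dt (2*k+1) (dt (2*m+1) c)) t"
    \<comment> \<open>Point by point, the multiplying time splits into \<open>lam i\<close> and the
      velocities of the two times that are differentiated.\<close>
    have tt: "of_nat (2*k+2*m+3) * t (2*k+2*m+3) = (\<Sum>i<M. lam i * ((1 / lam i) ^ (2 * k + 2) * (1 / lam i) ^ (2 * m + 2)))" for k m
    proof -
      have "of_nat (2*k+2*m+3) * t (2*k+2*m+3) = (\<Sum>i<M. (1 / lam i) ^ (2*k+2*m+3))"
      proof -
        have ne: "of_nat (2*k+2*m+3) \<noteq> (0 :: complex)" by (simp only: of_nat_eq_0_iff)
        show ?thesis
          unfolding t_def lam_times_def miwa_time_def times_divide_eq_right by (rule nonzero_mult_div_cancel_left[OF ne])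
      qed
      also have "\<dots> = (\<Sum>i<M. lam i * ((1 / lam i) ^ (2 * k + 2) * (1 / lam i) ^ (2 * m + 2)))"
      proof (rule sum.cong[OF refl])
        fix i assume "i \<in> {..<M}"
        hence "lam i \<noteq> 0" using generic_neq_0[OF gen] by simp
        thus "(1 / lam i) ^ (2*k+2*m+3) = lam i * ((1 / lam i) ^ (2 * k + 2) * (1 / lam i) ^ (2 * m + 2))"
          by (simp add: power_add eval_nat_numeral)
      qed
      finally show ?thesis .
    qed
    have "peval W2 t = (\<Sum>p\<in>?K. of_nat (2*fst p+2 * snd p+3) * (t (2*fst p+2 * snd p+3) * ?R (fst p) (snd p)))"
      unfolding W2_def
      by (subst peval_sum) (simp_all only: peval_tmul finite_supp_tmul finite_supp_dt fin finite_cartesian_product finite_lessThan)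
    also have "\<dots> = (\<Sum>k<B. \<Sum>m<B. (of_nat (2*k+2*m+3) * t (2*k+2*m+3)) * ?R k m)"
      by (simp add: sum.cartesian_product case_prod_unfold mult.assoc)
    also have "\<dots> = (\<Sum>m<B. \<Sum>k<B. \<Sum>i<M. lam i * ((1 / lam i) ^ (2 * m + 2) * (1 / lam i) ^ (2 * k + 2) * ?R k m))"
      unfolding tt sum_distrib_right by (subst sum.swap) (simp only: mult_ac)
    also have "\<dots> = (\<Sum>m<B. \<Sum>i<M. \<Sum>k<B. lam i * ((1 / lam i) ^ (2 * m + 2) * (1 / lam i) ^ (2 * k + 2) * ?R k m))"
      by (rule sum.cong[OF refl], rule sum.swap)
    also have "\<dots> = (\<Sum>i<M. \<Sum>m<B. \<Sum>k<B. lam i * ((1 / lam i) ^ (2 * m + 2) * (1 / lam i) ^ (2 * k + 2) * ?R k m))"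
      by (rule sum.swap)
    finally show ?thesis unfolding sum_distrib_left .
  qed
  also have "peval (tmul 1 c) t = (\<Sum>i<M. 1 / lam i) * peval c t"
    by (simp add: peval_tmul t_def lam_times_def miwa_time_def)
  also have "1/2 * (\<Sum>k<B. \<Sum>m<B. of_nat ((2*k+1)*(2*m+1)) * (t (2*k+1) * (t (2*m+1) * ?Q (k + m)))) =
     1/4 * (\<Sum>i<M. lam i * (\<Sum>s<B. of_nat (2 * s + 2) * (1 / lam i) ^ (2 * s + 3) * ?Q s)) +
     1/2 * (\<Sum>i<M. lam i * ratio_logderiv M lam i * (\<Sum>s<B. - ((1 / lam i) ^ (2 * s + 2)) * ?Q s))"
    unfolding t_def by (rule cut_join_quadratic[OF gen]) (use Q0 in \<open>simp add: t_def\<close>)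
  finally show ?thesis by (simp add: distrib_left sum.distrib mult.assoc)
qed

section \<open>Solving the evolution equation\<close>

definition vander_ratio :: "complex list \<Rightarrow> complex" where
  "vander_ratio xs = vander xs / pair_sums xs"

definition generic_list :: "complex list \<Rightarrow> bool" where
  "generic_list xs \<longleftrightarrow> distinct xs \<and> (\<forall>x\<in>set xs. x \<noteq> 0) \<and> (\<forall>x\<in>set xs. \<forall>y\<in>set xs. x \<noteq> y \<longrightarrow> x + y \<noteq> 0)"

lemma generic_list_map: "generic M lam \<Longrightarrow> generic_list (map lam [0..<M])"
  unfolding generic_def generic_list_def by (auto simp: distinct_map inj_on_def) blast+

lemma pair_sums_nonzero: "generic_list xs \<Longrightarrow> pair_sums xs \<noteq> 0"
proof (induction xs)
  case (Cons x xs)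
  have "generic_list xs" using Cons.prems by (auto simp: generic_list_def)
  moreover have "0 \<notin> set (map (\<lambda>z. x + z) xs)"
    using Cons.prems by (auto simp: generic_list_def)
  hence "(\<Prod>z\<leftarrow>xs. x + z) \<noteq> 0" by (simp only: prod_list_zero_iff not_False_eq_True)
  ultimately show ?case using Cons.IH by simp
qed simp

lemma vander_nonzero: "distinct xs \<Longrightarrow> vander xs \<noteq> 0"
proof (induction xs)
  case (Cons x xs)
  have "0 \<notin> set (map (\<lambda>z. z - x) xs)" using Cons.prems by auto
  hence "(\<Prod>z\<leftarrow>xs. z - x) \<noteq> 0" by (simp only: prod_list_zero_iff not_False_eq_True)
  thus ?case using Cons by simp
qed simp

lemma phi_det_eq_pf:
  assumes "generic_list xs" "even (length xs)"
  shows "phi_det N hb xs = fps_const (pair_sums xs) * pf (tau_kernel N hb) xs"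
  using assms phi_det_eq_row_det[of xs N hb] row_det_eq_pf[of xs "phiS N hb 0" "phiS N hb 1"]
  unfolding generic_list_def tau_kernel_def by auto

text \<open>At order zero the kernel is \<open>(y - x) / (x + y)\<close>, so this is Schur's
  Pfaffian identity, obtained here from the Vandermonde determinant.\<close>

lemma pf_nth_0:
  assumes "generic_list xs" "even (length xs)"
  shows "pf (tau_kernel N hb) xs $ 0 = vander_ratio xs"
  using arg_cong[OF phi_det_eq_pf[OF assms, of N hb], of "\<lambda>F. F $ 0"] pair_sums_nonzero[OF assms(1)]
  by (simp add: phi_det_nth_0 vander_ratio_def field_simps)

lemma vander_ratio_Cons: "vander_ratio (x # xs) = (\<Prod>z\<leftarrow>xs. (z - x) / (x + z)) * vander_ratio xs"
proof -
  have "(\<Prod>z\<leftarrow>zs. (z - x) / (x + z)) = (\<Prod>z\<leftarrow>zs. z - x) / (\<Prod>z\<leftarrow>zs. x + z)" for zs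
    by (induction zs) simp_all
  thus ?thesis by (simp add: vander_ratio_def)
qed

text \<open>Written without division, so that logarithmic derivatives add under products with no
  side condition on zeros.\<close>

definition has_logderiv :: "(complex \<Rightarrow> complex) \<Rightarrow> complex \<Rightarrow> complex \<Rightarrow> bool" where
  "has_logderiv g l z \<longleftrightarrow> (g has_field_derivative g z * l) (at z)"

lemma has_logderiv_const: "has_logderiv (\<lambda>_. c) 0 z"
  by (simp add: has_logderiv_def)

lemma has_logderiv_mult:
  assumes "has_logderiv f a z" "has_logderiv g b z"
  shows "has_logderiv (\<lambda>w. f w * g w) (a + b) z"
  using DERIV_mult[OF assms[unfolded has_logderiv_def]] by (simp add: has_logderiv_def algebra_simps)

lemma has_logderiv_quotient:
  assumes "z \<noteq> y" "z + y \<noteq> 0"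
  shows "has_logderiv (\<lambda>w. (w - y) / (w + y)) (2 * y / (z\<^sup>2 - y\<^sup>2)) z"
proof -
  have "((\<lambda>w. (w - y) / (w + y)) has_field_derivative ((z + y) - (z - y)) / ((z + y) * (z + y))) (at z)"
    using assms by (auto intro!: derivative_eq_intros)
  moreover have "((z + y) - (z - y)) / ((z + y) * (z + y)) = (z - y) / (z + y) * (2 * y / (z\<^sup>2 - y\<^sup>2))"
  proof -
    have sq: "z\<^sup>2 - y\<^sup>2 = (z - y) * (z + y)" by (simp add: power2_eq_square algebra_simps)
    show ?thesis unfolding sq using assms by (simp add: divide_simps)
  qed
  ultimately show ?thesis by (simp only: has_logderiv_def)
qed

lemma has_logderiv_quotient':
  assumes "z \<noteq> y" "z + y \<noteq> 0"
  shows "has_logderiv (\<lambda>w. (y - w) / (w + y)) (2 * y / (z\<^sup>2 - y\<^sup>2)) z"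
proof -
  have "(\<lambda>w. (y - w) / (w + y)) = (\<lambda>w. (-1) * ((w - y) / (w + y)))"
    by (simp add: minus_divide_left)
  thus ?thesis using has_logderiv_mult[OF has_logderiv_const has_logderiv_quotient[OF assms], of "-1"] by simp
qed

text \<open>The order of the list decides whether a factor is
  \<open>(w - lam j) / (w + lam j)\<close> or its negative; this sign is constant and drops
  out.\<close>

lemma vander_ratio_logderiv:
  assumes "distinct js" "i \<in> set js"
    and "\<And>j. j \<in> set js \<Longrightarrow> j \<noteq> i \<Longrightarrow> lam i \<noteq> lam j \<and> lam i + lam j \<noteq> (0::complex)"
  shows "has_logderiv (\<lambda>w. vander_ratio (map (lam(i := w)) js))
     (\<Sum>j\<in>set js - {i}. 2 * lam j / ((lam i)\<^sup>2 - (lam j)\<^sup>2)) (lam i)"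
  using assms
proof (induction js)
  case (Cons a js)
  show ?case
  proof (cases "a = i")
    case True
    have i: "i \<notin> set js" using Cons.prems True by simp
    have prod: "has_logderiv (\<lambda>w. \<Prod>j\<leftarrow>zs. (lam j - w) / (w + lam j))
       (\<Sum>j\<leftarrow>zs. 2 * lam j / ((lam i)\<^sup>2 - (lam j)\<^sup>2)) (lam i)" if "set zs \<subseteq> set js" for zs
      using that
    proof (induction zs)
      case (Cons j zs)
      have "j \<in> set (a # js)" "j \<noteq> i" using Cons.prems i by auto
      with \<open>\<And>j. j \<in> set (a # js) \<Longrightarrow> j \<noteq> i \<Longrightarrow> lam i \<noteq> lam j \<and> lam i + lam j \<noteq> 0\<close>
      have "lam i \<noteq> lam j" "lam i + lam j \<noteq> 0" by auto
      from has_logderiv_mult[OF has_logderiv_quotient'[OF this]] Cons show ?case by simp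
    qed (simp add: has_logderiv_const)
    have m: "map (lam(i := w)) js = map lam js" for w using i by auto
    have E1: "vander_ratio (map (lam(i := w)) (a # js)) = (\<Prod>j\<leftarrow>js. (lam j - w) / (w + lam j)) * vander_ratio (map lam js)" for w
      unfolding list.map m True fun_upd_same vander_ratio_Cons by (simp add: o_def)
    have E2: "(\<Sum>j\<leftarrow>js. 2 * lam j / ((lam i)\<^sup>2 - (lam j)\<^sup>2)) = (\<Sum>j\<in>set (a # js) - {i}. 2 * lam j / ((lam i)\<^sup>2 - (lam j)\<^sup>2))"
      using Cons.prems True i by (simp add: sum_list_distinct_conv_sum_set)
    show ?thesis
      unfolding E1 E2[symmetric]
      using has_logderiv_mult[OF prod[OF subset_refl] has_logderiv_const[of "vander_ratio (map lam js)"]] by simp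
  next
    case False
    hence i: "i \<in> set js" and a: "a \<notin> set js" "distinct js" using Cons.prems by auto
    let ?P = "\<Prod>j\<leftarrow>remove1 i js. (lam j - lam a) / (lam a + lam j)"
    have "lam i \<noteq> lam a" "lam i + lam a \<noteq> 0" using Cons.prems(3)[of a] False by auto
    note quot = has_logderiv_quotient[OF this]
    have prod: "(\<Prod>z\<leftarrow>map (lam(i := w)) js. (z - lam a) / (lam a + z)) = (w - lam a) / (w + lam a) * ?P" for w
    proof -
      have "(\<Prod>z\<leftarrow>map (lam(i := w)) js. (z - lam a) / (lam a + z)) =
        (\<Prod>j\<in>#mset js. ((lam(i := w)) j - lam a) / (lam a + (lam(i := w)) j))"
        by (simp add: prod_mset_prod_list o_def flip: mset_map)
      also have "mset js = add_mset i (mset (remove1 i js))" using i by simp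
      also have "(\<Prod>j\<in>#\<dots>. ((lam(i := w)) j - lam a) / (lam a + (lam(i := w)) j)) =
         (w - lam a) / (lam a + w) * (\<Prod>j\<leftarrow>remove1 i js. ((lam(i := w)) j - lam a) / (lam a + (lam(i := w)) j))"
        by (simp add: prod_mset_prod_list flip: mset_map del: mset_remove1)
      also have "map (\<lambda>j. ((lam(i := w)) j - lam a) / (lam a + (lam(i := w)) j)) (remove1 i js) =
         map (\<lambda>j. (lam j - lam a) / (lam a + lam j)) (remove1 i js)"
        using a(2) by (auto simp: set_remove1_eq)
      finally show ?thesis unfolding add.commute[of w "lam a"] .
    qed
    have "(lam(i := w)) a = lam a" for w using False by simp
    hence E1: "vander_ratio (map (lam(i := w)) (a # js)) = (w - lam a) / (w + lam a) * (?P * vander_ratio (map (lam(i := w)) js))" for w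
      unfolding list.map vander_ratio_Cons mult.assoc[symmetric] using prod[of w] by simp
    have "has_logderiv (\<lambda>w. vander_ratio (map (lam(i := w)) js)) (\<Sum>j\<in>set js - {i}. 2 * lam j / ((lam i)\<^sup>2 - (lam j)\<^sup>2)) (lam i)"
      by (rule Cons.IH) (use Cons.prems i in auto)
    from has_logderiv_mult[OF quot has_logderiv_mult[OF has_logderiv_const this, of ?P]]
    have L: "has_logderiv (\<lambda>w. (w - lam a) / (w + lam a) * (?P * vander_ratio (map (lam(i := w)) js)))
      (2 * lam a / ((lam i)\<^sup>2 - (lam a)\<^sup>2) + (\<Sum>j\<in>set js - {i}. 2 * lam j / ((lam i)\<^sup>2 - (lam j)\<^sup>2))) (lam i)" by simp
    have E2: "2 * lam a / ((lam i)\<^sup>2 - (lam a)\<^sup>2) + (\<Sum>j\<in>set js - {i}. 2 * lam j / ((lam i)\<^sup>2 - (lam j)\<^sup>2)) =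
      (\<Sum>j\<in>set (a # js) - {i}. 2 * lam j / ((lam i)\<^sup>2 - (lam j)\<^sup>2))"
    proof -
      have "set (a # js) - {i} = insert a (set js - {i})" using False by auto
      thus ?thesis using a by simp
    qed
    show ?thesis unfolding E1 E2[symmetric] by (rule L)
  qed
qed simp

text \<open>The factor \<open>fps_X\<close> in the evolution equation turns it into a recursion that
  determines order \<open>Suc k\<close> from order \<open>k\<close>.\<close>

lemma pf_tau_kernel_pde:
  assumes gen: "generic M lam"
  shows "\<exists>D1 D2. (\<forall>i<M. FPD2 (\<lambda>w. pf (tau_kernel N hb) (map (lam(i := w)) [0..<M])) (lam i) (D1 i) (D2 i)) \<and>
    (\<forall>k. 4 * (of_nat (Suc k) * pf (tau_kernel N hb) (map lam [0..<M]) $ Suc k) =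
       hb * (\<Sum>i<M. lam i * D2 i $ k + (1/4 - N\<^sup>2) / lam i * pf (tau_kernel N hb) (map lam [0..<M]) $ k))"
proof -
  let ?p = "pf (tau_kernel N hb) (map lam [0..<M])"
  let ?c = "fps_const :: complex \<Rightarrow> _"
  let ?q = "\<lambda>i. ?c (1/4 - N\<^sup>2) * ?c (1 / lam i)"
  have "\<exists>D1 D2. (\<forall>i\<in>set [0..<M]. FPD2 (\<lambda>w. pf (tau_kernel N hb) (map (lam(i := w)) [0..<M])) (lam i) (D1 i) (D2 i)) \<and>
     4 * (fps_X * fps_deriv ?p) =
       (fps_X * ?c hb) * (\<Sum>i\<in>set [0..<M]. ?c (lam i) * D2 i + ?q i * ?p)"
  proof (rule pf_pde)
    fix i j assume "i \<in> set [0..<M]" "j \<in> set [0..<M]" "i \<noteq> j"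
    hence "lam i \<noteq> 0" "lam j \<noteq> 0" "lam i + lam j \<noteq> 0" using gen by (auto simp: generic_def)
    from tau_kernel_pde[OF this, of N hb]
    show "\<exists>A1 A2 B1 B2. FPD2 (\<lambda>w. tau_kernel N hb w (lam j)) (lam i) A1 A2 \<and> FPD2 (\<lambda>w. tau_kernel N hb (lam i) w) (lam j) B1 B2 \<and>
       4 * (fps_X * fps_deriv (tau_kernel N hb (lam i) (lam j))) =
       fps_X * ?c hb * (?c (lam i) * A2 + ?c (lam j) * B2 + (?q i + ?q j) * tau_kernel N hb (lam i) (lam j))"
      by (simp only: distrib_left)
  qed simp
  then obtain D1 D2 where D: "\<forall>i\<in>set [0..<M]. FPD2 (\<lambda>w. pf (tau_kernel N hb) (map (lam(i := w)) [0..<M])) (lam i) (D1 i) (D2 i)"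
     "4 * (fps_X * fps_deriv ?p) = (fps_X * ?c hb) * (\<Sum>i\<in>set [0..<M]. ?c (lam i) * D2 i + ?q i * ?p)"
    by blast
  have four: "(4 * F) $ k = 4 * F $ k" for F :: "complex fps" and k
    by (metis fps_mult_left_const_nth numeral_fps_const)
  have "4 * (of_nat (Suc k) * ?p $ Suc k) = hb * (\<Sum>i<M. lam i * D2 i $ k + (1/4 - N\<^sup>2) / lam i * ?p $ k)" for k
  proof -
    have "4 * (of_nat (Suc k) * ?p $ Suc k) = (4 * (fps_X * fps_deriv ?p)) $ Suc k"
      unfolding four by simp
    also have "\<dots> = (?c hb * (\<Sum>i<M. ?c (lam i) * D2 i + ?q i * ?p)) $ k"
      unfolding D(2) mult.assoc[of fps_X] by (simp add: lessThan_atLeast0)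
    also have "\<dots> = hb * (\<Sum>i<M. lam i * D2 i $ k + (1/4 - N\<^sup>2) / lam i * ?p $ k)"
      by (simp add: fps_sum_nth mult.assoc)
    finally show ?thesis .
  qed
  thus ?thesis using D(1) by (intro exI[of _ D1] exI[of _ D2]) (simp add: lessThan_atLeast0)
qed

text \<open>Genericity is an open condition in each point, so identities proved at generic points
  may be differentiated.\<close>

lemma eventually_generic_update:
  assumes gen: "generic M lam" and i: "i < M"
  shows "\<forall>\<^sub>F w in nhds (lam i). generic M (lam(i := w))"
proof -
  have "\<forall>\<^sub>F w in nhds (lam i). \<forall>j\<in>{..<M}. j \<noteq> i \<longrightarrow> w \<noteq> lam j \<and> w \<noteq> - lam j"
  proof (rule eventually_ball_finite)
    show "\<forall>j\<in>{..<M}. \<forall>\<^sub>F w in nhds (lam i). j \<noteq> i \<longrightarrow> w \<noteq> lam j \<and> w \<noteq> - lam j"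
    proof
      fix j assume "j \<in> {..<M}"
      show "\<forall>\<^sub>F w in nhds (lam i). j \<noteq> i \<longrightarrow> w \<noteq> lam j \<and> w \<noteq> - lam j"
      proof (cases "j = i")
        case False
        hence "lam i \<noteq> lam j" "lam i \<noteq> - lam j"
          using gen i \<open>j \<in> {..<M}\<close> by (auto simp: generic_def eq_neg_iff_add_eq_0)
        from eventually_conj[OF eventually_nhds_neq[OF this(1)] eventually_nhds_neq[OF this(2)]]
        show ?thesis by eventually_elim simp
      qed simp
    qed
  qed simp
  moreover have "\<forall>\<^sub>F w in nhds (lam i). w \<noteq> 0"
    using gen i by (intro eventually_nhds_neq) (auto simp: generic_def)
  ultimately show ?thesis
  proof eventually_elim
    case (elim w)
    thus ?case using gen unfolding generic_def by (auto simp: eq_neg_iff_add_eq_0 add.commute)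
  qed
qed

text \<open>For \<open>N = 1/2\<close> and \<open>j = 1, 2\<close> the first factor
  \<open>4 * (j - 3/2)\<^sup>2 - 1\<close> vanishes, and the recursion carries the zero to all
  higher orders.\<close>

lemma phi_coef_half: "j = 1 \<or> j = 2 \<Longrightarrow> phi_coef (1/2) 1 j (Suc k) = 0"
proof (induction k)
  case 0
  thus ?case by (auto simp: phi_coef_def a_coef_def power2_eq_square)
next
  case (Suc k)
  have "of_nat (Suc (Suc k)) * phi_coef (1/2) 1 j (Suc (Suc k)) = 0"
    unfolding phi_coef_ode[of "Suc k" "1/2" 1 j] using Suc by simp
  thus ?case by (simp del: of_nat_Suc)
qed

lemma pf_half_const: "pf (tau_kernel (1/2) 1) xs $ Suc k = 0"
proof -
  have ser: "ser (phi_coef (1/2) 1 j) x = 1" if "j = 1 \<or> j = 2" for j x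
  proof (rule fps_ext)
    fix k show "ser (phi_coef (1/2) 1 j) x $ k = 1 $ k"
      using phi_coef_half[OF that] by (cases k) (simp_all add: ser_def)
  qed
  have "tau_kernel (1/2) 1 = (\<lambda>x y. fps_const ((y - x) / (x + y)))"
  proof (intro ext)
    fix x y
    have s: "ser (phi_coef (1/2) 1 1) z = 1" "ser (phi_coef (1/2) 1 2) z = 1" for z
      by (rule ser, simp)+
    have "tau_kernel (1/2) 1 x y = fps_const (1 / (x + y)) * (fps_const y - fps_const x)"
      unfolding tau_kernel_def pair_kernel_def phiS_0 phiS_1 s by simp
    thus "tau_kernel (1/2) 1 x y = fps_const ((y - x) / (x + y))" by simp
  qed
  moreover have "pf (\<lambda>x y. fps_const (a x y)) xs = fps_const (pf a xs)" for a :: "complex \<Rightarrow> complex \<Rightarrow> complex"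
  proof (induction a xs rule: pf.induct)
    case (2 a x xs)
    have sgn: "(-1) ^ l = (fps_const ((-1) ^ l) :: complex fps)" for l by (cases "even l") simp_all
    have "pf (\<lambda>x y. fps_const (a x y)) (x # xs) = (\<Sum>l<length xs. fps_const ((-1) ^ l * a x (xs ! l) * pf a (del_nth l xs)))"
      unfolding pf.simps(2)
    proof (rule sum.cong[OF refl])
      fix l assume "l \<in> {..<length xs}"
      from "2.IH"[OF this] show "(-1) ^ l * fps_const (a x (xs ! l)) * pf (\<lambda>x y. fps_const (a x y)) (del_nth l xs) =
          fps_const ((-1) ^ l * a x (xs ! l) * pf a (del_nth l xs))"
        by (simp only: sgn[of l] fps_const_mult)
    qed
    also have "\<dots> = fps_const (pf a (x # xs))" by (simp add: fps_eq_iff fps_sum_nth)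
    finally show ?case .
  qed simp
  ultimately show ?thesis by simp
qed

text \<open>For \<open>N = 1/2\<close> all \<open>\<Phi>\<^sub>j\<close> are monomials and the flow is trivial, so the equation for the
Pfaffian degenerates to the statement that \<open>vander_ratio\<close> is annihilated by \<open>\<Sum> \<lambda>\<^sub>i \<partial>\<^sub>i\<^sup>2\<close>.\<close>
lemma vander_ratio_PD2:
  assumes gen: "generic M lam" and ev: "even M"
  shows "\<exists>V2. (\<forall>i<M. PD2 (\<lambda>w. vander_ratio (map (lam(i := w)) [0..<M])) (lam i)
       (vander_ratio (map lam [0..<M]) * ratio_logderiv M lam i) (V2 i)) \<and> (\<Sum>i<M. lam i * V2 i) = 0"
proof -
  obtain D1 D2 where D: "\<forall>i<M. FPD2 (\<lambda>w. pf (tau_kernel (1/2) 1) (map (lam(i := w)) [0..<M])) (lam i) (D1 i) (D2 i)"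
    "\<And>k. 4 * (of_nat (Suc k) * pf (tau_kernel (1/2) 1) (map lam [0..<M]) $ Suc k) =
       1 * (\<Sum>i<M. lam i * D2 i $ k + (1/4 - (1/2)\<^sup>2) / lam i * pf (tau_kernel (1/2) 1) (map lam [0..<M]) $ k)"
    using pf_tau_kernel_pde[OF gen, of "1/2" 1] by blast
  \<comment> \<open>The left-hand side is a coefficient of positive order, hence 0, and
    \<open>1/4 - (1/2)\<^sup>2 = 0\<close> removes the potential.\<close>
  have sum0: "(\<Sum>i<M. lam i * D2 i $ 0) = 0"
    using D(2)[of 0] by (simp add: pf_half_const power2_eq_square)
  have "PD2 (\<lambda>w. vander_ratio (map (lam(i := w)) [0..<M])) (lam i) (vander_ratio (map lam [0..<M]) * ratio_logderiv M lam i) (D2 i $ 0)"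
    if i: "i < M" for i
  proof -
    have P: "PD2 (\<lambda>w. pf (tau_kernel (1/2) 1) (map (lam(i := w)) [0..<M]) $ 0) (lam i) (D1 i $ 0) (D2 i $ 0)"
      using D(1) i unfolding FPD2_def by blast
    have eq: "\<forall>\<^sub>F w in nhds (lam i). pf (tau_kernel (1/2) 1) (map (lam(i := w)) [0..<M]) $ 0 = vander_ratio (map (lam(i := w)) [0..<M])"
      using eventually_generic_update[OF gen i]
      by eventually_elim (use ev in \<open>simp add: pf_nth_0 generic_list_map\<close>)
    obtain g1 where g1: "\<forall>\<^sub>F w in nhds (lam i). ((\<lambda>w. pf (tau_kernel (1/2) 1) (map (lam(i := w)) [0..<M]) $ 0) has_field_derivative g1 w) (at w)"
      "g1 (lam i) = D1 i $ 0" "(g1 has_field_derivative D2 i $ 0) (at (lam i))"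
      using P unfolding PD2_def by blast
    have ee: "\<forall>\<^sub>F w in nhds (lam i). \<forall>\<^sub>F v in nhds w. pf (tau_kernel (1/2) 1) (map (lam(i := v)) [0..<M]) $ 0 = vander_ratio (map (lam(i := v)) [0..<M])"
      using eq by (simp add: eventually_eventually)
    have d: "\<forall>\<^sub>F w in nhds (lam i). ((\<lambda>w. vander_ratio (map (lam(i := w)) [0..<M])) has_field_derivative g1 w) (at w)"
      using g1(1) ee
    proof eventually_elim
      case (elim w)
      show ?case using DERIV_cong_ev[OF refl elim(2) refl] elim(1) by blast
    qed
    have V1: "((\<lambda>w. vander_ratio (map (lam(i := w)) [0..<M])) has_field_derivative vander_ratio (map lam [0..<M]) * ratio_logderiv M lam i) (at (lam i))"
    proof -
      have "has_logderiv (\<lambda>w. vander_ratio (map (lam(i := w)) [0..<M]))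
         (\<Sum>j\<in>set [0..<M] - {i}. 2 * lam j / ((lam i)\<^sup>2 - (lam j)\<^sup>2)) (lam i)"
        by (rule vander_ratio_logderiv) (use gen i in \<open>auto simp: generic_def\<close>)
      thus ?thesis by (simp add: has_logderiv_def ratio_logderiv_def lessThan_atLeast0)
    qed
    have "D1 i $ 0 = vander_ratio (map lam [0..<M]) * ratio_logderiv M lam i"
      using DERIV_unique[OF eventually_nhds_x_imp_x[OF d] V1] g1(2) by simp
    thus ?thesis unfolding PD2_def using d g1(2,3) by (intro exI[of _ g1]) simp
  qed
  thus ?thesis using sum0 by (intro exI[of _ "\<lambda>i. D2 i $ 0"]) simp
qed

section \<open>Comparison of the Pfaffian with the exponential of the cut-and-join operator\<close>

lemma miwa_time_update_derivative:
  assumes "i < M" "w \<noteq> 0" "k > 0"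
  shows "((\<lambda>w. lam_times M (lam(i := w)) k) has_field_derivative - ((1 / w) ^ Suc k)) (at w)"
proof -
  have split: "(\<Sum>j<M. (1 / (lam(i := w)) j) ^ k) = (1 / w) ^ k + (\<Sum>j\<in>{..<M} - {i}. (1 / lam j) ^ k)" for w
    using assms(1) by (subst sum.remove[of _ i]) (auto intro!: sum.cong)
  have "((\<lambda>w. (1 / w ^ k + (\<Sum>j\<in>{..<M} - {i}. (1 / lam j) ^ k)) / of_nat k) has_field_derivative
     (- of_nat k / w ^ Suc k + 0) / of_nat k) (at w)"
    by (intro DERIV_cdivide DERIV_add inverse_power_derivative assms(2) DERIV_const)
  hence "((\<lambda>w. ((1 / w) ^ k + (\<Sum>j\<in>{..<M} - {i}. (1 / lam j) ^ k)) / of_nat k) has_field_derivative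
     - ((1 / w) ^ Suc k)) (at w)"
    using assms(3) by (simp add: power_one_over del: power_Suc)
  thus ?thesis unfolding lam_times_def miwa_time_def split .
qed

lemma PD2_miwa:
  assumes gen: "generic M lam" and i: "i < M" and c: "homog d c"
  defines "t \<equiv> lam_times M lam" and "B \<equiv> Suc (Suc d)"
  shows "PD2 (\<lambda>w. peval c (lam_times M (lam(i := w)))) (lam i)
     (\<Sum>s<B. - ((1 / lam i) ^ (2 * s + 2)) * peval (dt (2 * s + 1) c) t)
     ((\<Sum>s<B. of_nat (2 * s + 2) * (1 / lam i) ^ (2 * s + 3) * peval (dt (2 * s + 1) c) t) +
      (\<Sum>k<B. \<Sum>l<B. (1 / lam i) ^ (2 * k + 2) * (1 / lam i) ^ (2 * l + 2) * peval (dt (2 * l + 1) (dt (2 * k + 1) c)) t))"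
proof -
  define R where "R = (\<lambda>s. 2 * s + 1) ` {..<B}"
  have inj: "inj_on (\<lambda>s. 2 * s + 1) {..<B}" by (auto simp: inj_on_def)
  have reindex: "(\<Sum>k\<in>R. h k) = (\<Sum>s<B. h (2 * s + 1))" for h :: "nat \<Rightarrow> complex"
    unfolding R_def by (subst sum.reindex[OF inj]) simp
  have li: "lam i \<noteq> 0" by (rule generic_neq_0[OF gen i])
  have sub: "set_mset T \<subseteq> R" if "T \<in> supp c" for T
  proof
    fix k assume k: "k \<in># T"
    have "sum_mset T = d" "odd k" using c that k unfolding homog_def supp_def by auto
    moreover have "k \<le> sum_mset T" by (rule mem_le_sum_mset[OF k])
    moreover obtain s where "k = 2 * s + 1" using \<open>odd k\<close> by (elim oddE)
    ultimately show "k \<in> R" unfolding R_def B_def by auto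
  qed
  have D: "\<forall>\<^sub>F w in nhds (lam i). \<forall>k\<in>R. ((\<lambda>w. lam_times M (lam(i := w)) k) has_field_derivative - ((1 / w) ^ Suc k)) (at w)"
    using eventually_nhds_neq[OF li]
  proof eventually_elim
    case (elim w)
    show ?case
    proof
      fix k assume "k \<in> R"
      hence "k > 0" by (auto simp: R_def)
      thus "((\<lambda>w. lam_times M (lam(i := w)) k) has_field_derivative - ((1 / w) ^ Suc k)) (at w)"
        by (rule miwa_time_update_derivative[OF i elim])
    qed
  qed
  have D2: "((\<lambda>w. - ((1 / w) ^ Suc k)) has_field_derivative of_nat (Suc k) * (1 / lam i) ^ (k + 2)) (at (lam i))" for k
  proof -
    from DERIV_minus[OF inverse_power_derivative[OF li, of "Suc k"]] show ?thesis
      by (simp add: power_one_over del: of_nat_Suc)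
  qed
  have fR: "finite R" by (simp add: R_def)
  have upd: "lam(i := lam i) = lam" by simp
  note P = PD2_peval[OF homog_finite_supp[OF c] fR sub D D2, unfolded upd reindex]
  have e': "Suc (2 * s + 1) = 2 * s + 2" "2 * s + 1 + 2 = 2 * s + 3" for s by simp_all
  show ?thesis
    using P unfolding t_def e' minus_mult_minus .
qed

text \<open>The coefficient of \<open>hb ^ k\<close> in the exponential, which is also its part of
  weight \<open>k\<close>.\<close>

definition cW :: "complex \<Rightarrow> nat \<Rightarrow> mser" where
  "cW N k = (\<lambda>T. (Wop N ^^ k) fone T / fact k)"

lemma dt_scale: "dt k (\<lambda>T. a * F T) = (\<lambda>T. a * dt k F T)"
  by (simp add: dt_def fun_eq_iff)

lemma tmul_scale: "tmul k (\<lambda>T. a * F T) = (\<lambda>T. a * tmul k F T)"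
  by (simp add: tmul_def fun_eq_iff)

lemma Wop_scale: "Wop N (\<lambda>T. a * F T) T = a * Wop N F T"
proof -
  have "Wop N (\<lambda>T. a * F T) T = Wfin N (Suc (sum_mset T)) (\<lambda>T. a * F T) T" by (rule Wop_eq_Wfin) simp
  also have "\<dots> = a * Wfin N (Suc (sum_mset T)) F T"
    unfolding Wfin_def dt_scale tmul_scale
    by (simp only: distrib_left sum_distrib_left case_prod_unfold mult.left_commute)
  also have "Wfin N (Suc (sum_mset T)) F T = Wop N F T" by (rule Wop_eq_Wfin[symmetric]) simp
  finally show ?thesis .
qed

lemma cW_0: "cW N 0 = fone"
  by (simp add: cW_def)

lemma cW_Suc: "cW N (Suc k) = (\<lambda>T. Wop N (cW N k) T / of_nat (Suc k))"
proof
  fix T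
  have "Wop N (cW N k) T = 1 / fact k * Wop N ((Wop N ^^ k) fone) T"
    unfolding cW_def using Wop_scale[of N "1 / fact k" "(Wop N ^^ k) fone" T] by simp
  thus "cW N (Suc k) T = Wop N (cW N k) T / of_nat (Suc k)"
    by (simp add: cW_def)
qed

lemma homog_cW: "homog k (cW N k)"
proof (induction k)
  case 0
  show ?case unfolding cW_0 by (simp add: homog_def fone_def)
next
  case (Suc k)
  from Wop_homog(1)[OF this, of N] show ?case unfolding cW_Suc homog_def by auto
qed

lemma peval_fone: "peval fone t = 1"
proof -
  have "supp fone = {{#}}" by (auto simp: supp_def fone_def)
  thus ?thesis by (simp add: peval_def fone_def)
qed

text \<open>Both sides obey the same recursion in \<open>k\<close>. The induction covers all generic
  points at once, because its step differentiates the hypothesis in every point.\<close>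

lemma pf_eq_ratio_peval:
  assumes "generic M lam" and ev: "even M"
  shows "pf (tau_kernel N hb) (map lam [0..<M]) $ k = vander_ratio (map lam [0..<M]) * (hb ^ k * peval (cW N k) (lam_times M lam))"
  using assms(1)
proof (induction k arbitrary: lam)
  case 0
  thus ?case using ev by (simp add: pf_nth_0 generic_list_map cW_0 peval_fone)
next
  case (Suc k)
  let ?g = "\<lambda>lam. pf (tau_kernel N hb) (map lam [0..<M])"
  let ?V = "\<lambda>lam. vander_ratio (map lam [0..<M])"
  let ?F = "\<lambda>lam. peval (cW N k) (lam_times M lam)"
  note gen = Suc.prems
  obtain D1 D2 where D: "\<forall>i<M. FPD2 (\<lambda>w. ?g (lam(i := w))) (lam i) (D1 i) (D2 i)"
    "\<And>k. 4 * (of_nat (Suc k) * ?g lam $ Suc k) = hb * (\<Sum>i<M. lam i * D2 i $ k + (1/4 - N\<^sup>2) / lam i * ?g lam $ k)"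
    using pf_tau_kernel_pde[OF gen, of N hb] by blast
  obtain V2 where V2: "\<forall>i<M. PD2 (\<lambda>w. ?V (lam(i := w))) (lam i) (?V lam * ratio_logderiv M lam i) (V2 i)"
    "(\<Sum>i<M. lam i * V2 i) = 0"
    using vander_ratio_PD2[OF gen ev] by blast
  define B where "B = Suc (Suc k)"
  define F1 where "F1 i = (\<Sum>s<B. - ((1 / lam i) ^ (2 * s + 2)) * peval (dt (2 * s + 1) (cW N k)) (lam_times M lam))" for i
  define F2 where "F2 i = (\<Sum>s<B. of_nat (2 * s + 2) * (1 / lam i) ^ (2 * s + 3) * peval (dt (2 * s + 1) (cW N k)) (lam_times M lam)) +
      (\<Sum>r<B. \<Sum>l<B. (1 / lam i) ^ (2 * r + 2) * (1 / lam i) ^ (2 * l + 2) * peval (dt (2 * l + 1) (dt (2 * r + 1) (cW N k))) (lam_times M lam))" for i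
  have D2: "D2 i $ k = hb ^ k * (V2 i * ?F lam + 2 * (?V lam * ratio_logderiv M lam i) * F1 i + ?V lam * F2 i)" if i: "i < M" for i
  proof -
    have P: "PD2 (\<lambda>w. ?g (lam(i := w)) $ k) (lam i) (D1 i $ k) (D2 i $ k)"
      using D(1) i unfolding FPD2_def by blast
    have PF: "PD2 (\<lambda>w. ?F (lam(i := w))) (lam i) (F1 i) (F2 i)"
      using PD2_miwa[OF gen i homog_cW[of k N]] unfolding F1_def F2_def B_def .
    have upd: "lam(i := lam i) = lam" by simp
    have PV: "PD2 (\<lambda>w. ?V (lam(i := w))) (lam i) (?V lam * ratio_logderiv M lam i) (V2 i)"
      using V2(1) i by blast
    note Q = PD2_cmult[OF PD2_mult[OF PV PF], of "hb ^ k", unfolded upd]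
    have "\<forall>\<^sub>F w in nhds (lam i). ?g (lam(i := w)) $ k = hb ^ k * (?V (lam(i := w)) * ?F (lam(i := w)))"
      using eventually_generic_update[OF gen i]
    proof eventually_elim
      case (elim w)
      show ?case unfolding Suc.IH[OF elim] by (simp only: mult.left_commute)
    qed
    from PD2_unique(2)[OF P Q this] show ?thesis .
  qed
  have "4 * (of_nat (Suc k) * ?g lam $ Suc k) = hb * (\<Sum>i<M. lam i * D2 i $ k + (1/4 - N\<^sup>2) / lam i * ?g lam $ k)"
    by (rule D(2))
  \<comment> \<open>Product rule for the Vandermonde ratio times \<open>?F\<close>: the terms with
    \<open>V2 i\<close> will sum to 0, the mixed term gives the first-order part of
    \<open>W\<close>, and \<open>1/4 - N\<^sup>2\<close> is four times the constant in
    \<open>W\<close>.\<close>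
  also have "(\<Sum>i<M. lam i * D2 i $ k + (1/4 - N\<^sup>2) / lam i * ?g lam $ k) =
     (\<Sum>i<M. hb ^ k * ?F lam * (lam i * V2 i) + 4 * (hb ^ k * ?V lam) * (1/4 * (lam i * F2 i) +
        1/2 * (lam i * ratio_logderiv M lam i * F1 i) + (1/16 - N\<^sup>2/4) * (1 / lam i) * ?F lam))"
  proof (rule sum.cong[OF refl])
    fix i assume "i \<in> {..<M}"
    hence i: "i < M" by simp
    show "lam i * D2 i $ k + (1/4 - N\<^sup>2) / lam i * ?g lam $ k =
      hb ^ k * ?F lam * (lam i * V2 i) + 4 * (hb ^ k * ?V lam) * (1/4 * (lam i * F2 i) +
        1/2 * (lam i * ratio_logderiv M lam i * F1 i) + (1/16 - N\<^sup>2/4) * (1 / lam i) * ?F lam)"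
      unfolding D2[OF i] Suc.IH[OF gen] using generic_neq_0[OF gen i] by (simp add: field_simps)
  qed
  also have "\<dots> = hb ^ k * ?F lam * (\<Sum>i<M. lam i * V2 i) + 4 * (hb ^ k * ?V lam) *
     (1/4 * (\<Sum>i<M. lam i * F2 i) + 1/2 * (\<Sum>i<M. lam i * ratio_logderiv M lam i * F1 i) +
      (1/16 - N\<^sup>2/4) * (\<Sum>i<M. 1 / lam i) * ?F lam)"
    by (simp only: sum.distrib sum_distrib_left[symmetric] sum_distrib_right[symmetric])
  also have "1/4 * (\<Sum>i<M. lam i * F2 i) + 1/2 * (\<Sum>i<M. lam i * ratio_logderiv M lam i * F1 i) +
      (1/16 - N\<^sup>2/4) * (\<Sum>i<M. 1 / lam i) * ?F lam = peval (Wop N (cW N k)) (lam_times M lam)"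
    unfolding peval_Wop[OF gen homog_cW] F1_def F2_def B_def ..
  also have "peval (Wop N (cW N k)) (lam_times M lam) = of_nat (Suc k) * peval (cW N (Suc k)) (lam_times M lam)"
  proof -
    have "finite (supp (cW N (Suc k)))" by (rule homog_finite_supp[OF homog_cW])
    from peval_cmult[OF this, of "of_nat (Suc k)"] show ?thesis
      unfolding cW_Suc by (simp del: of_nat_Suc)
  qed
  finally have "4 * of_nat (Suc k) * ?g lam $ Suc k =
     4 * of_nat (Suc k) * (?V lam * (hb ^ Suc k * peval (cW N (Suc k)) (lam_times M lam)))"
    unfolding V2(2) by (simp add: mult_ac del: of_nat_Suc)
  thus ?case by (simp del: of_nat_Suc)
qed

definition miwa_fps :: "complex \<Rightarrow> complex \<Rightarrow> (nat \<Rightarrow> complex) \<Rightarrow> complex fps" where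
  "miwa_fps N hb t = Abs_fps (\<lambda>k. hb ^ k * peval (cW N k) t)"

lemma phi_det_even:
  assumes gen: "generic M lam" and ev: "even M"
  shows "phi_det N hb (map lam [0..<M]) = fps_const (vander (map lam [0..<M])) * miwa_fps N hb (lam_times M lam)"
proof -
  let ?xs = "map lam [0..<M]"
  note gl = generic_list_map[OF gen]
  have "pf (tau_kernel N hb) ?xs = fps_const (vander_ratio ?xs) * miwa_fps N hb (lam_times M lam)"
    by (rule fps_ext) (simp add: pf_eq_ratio_peval[OF gen ev] miwa_fps_def)
  moreover have "pair_sums ?xs * vander_ratio ?xs = vander ?xs" using pair_sums_nonzero[OF gl] by (simp add: vander_ratio_def)
  moreover have "phi_det N hb ?xs = fps_const (pair_sums ?xs) * pf (tau_kernel N hb) ?xs"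
    by (rule phi_det_eq_pf[OF gl]) (use ev in simp)
  ultimately show ?thesis by (simp add: mult.assoc[symmetric])
qed

text \<open>As \<open>W\<close> raises the weight by one, only the term with \<open>k\<close> equal
  to the weight of \<open>T\<close> survives, so the exponential series is finite at each
  monomial.\<close>

lemma expW_eq: "expW N hb T = hb ^ sum_mset T * cW N (sum_mset T) T"
proof -
  have "hb ^ k / fact k * ((Wop N ^^ k) fone) T = hb ^ k * cW N k T" for k by (simp add: cW_def)
  moreover have "cW N k T = 0" if "k \<noteq> sum_mset T" for k
    using homog_cW[of k N] that unfolding homog_def by blast
  hence "(\<Sum>k. hb ^ k * cW N k T) = (\<Sum>k\<in>{sum_mset T}. hb ^ k * cW N k T)"
    by (intro suminf_finite) auto
  ultimately show ?thesis unfolding expW_def by simp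
qed

lemma ev_miwa_expW: "ev M \<xi> (miwa M (expW N hb)) = miwa_fps N hb (miwa_time M \<xi>)"
proof (rule fps_ext)
  fix d
  have "ev M \<xi> (miwa M (expW N hb)) $ d = (\<Sum>T\<in>Wt d. hb ^ d * (cW N d T * monval (miwa_time M \<xi>) T))"
    unfolding ev_miwa by (rule sum.cong) (auto simp: expW_eq Wt_def)
  also have "\<dots> = hb ^ d * peval (cW N d) (miwa_time M \<xi>)"
    unfolding peval_superset[OF finite_Wt homog_supp[OF homog_cW]] sum_distrib_left ..
  finally show "ev M \<xi> (miwa M (expW N hb)) $ d = miwa_fps N hb (miwa_time M \<xi>) $ d"
    by (simp add: miwa_fps_def)
qed

section \<open>The tau-function\<close>

lemma ev_fdet_eq_det: "ev M xi (fdet M A) = det (mat M M (\<lambda>(i, j). ev M xi (A i j)))"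
proof -
  have "det (mat M M (\<lambda>(i, j). ev M xi (A i j))) =
     (\<Sum>p | p permutes {0..<M}. signof p * (\<Prod>i = 0..<M. mat M M (\<lambda>(i, j). ev M xi (A i j)) $$ (i, p i)))"
    by (rule det_def') simp
  also have "\<dots> = (\<Sum>p | p permutes {..<M}. of_int (sign p) * (\<Prod>i<M. ev M xi (A i (p i))))"
    unfolding lessThan_atLeast0
  proof (rule sum.cong[OF refl])
    fix p assume "p \<in> {p. p permutes {0..<M}}"
    hence p: "p permutes {0..<M}" by simp
    have "(\<Prod>i = 0..<M. mat M M (\<lambda>(i, j). ev M xi (A i j)) $$ (i, p i)) = (\<Prod>i = 0..<M. ev M xi (A i (p i)))"
    proof (rule prod.cong[OF refl])
      fix i assume "i \<in> {0..<M}"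
      moreover from this have "p i \<in> {0..<M}" using permutes_in_image[OF p] by blast
      ultimately show "mat M M (\<lambda>(i, j). ev M xi (A i j)) $$ (i, p i) = ev M xi (A i (p i))" by simp
    qed
    thus "signof p * (\<Prod>i = 0..<M. mat M M (\<lambda>(i, j). ev M xi (A i j)) $$ (i, p i)) =
       of_int (sign p) * (\<Prod>i = 0..<M. ev M xi (A i (p i)))" by (simp add: sign_def)
  qed
  finally show ?thesis unfolding ev_fdet ..
qed

section \<open>Removing row and column factors from the determinants\<close>

lemma det_scale_rows_cols:
  "det (mat n n (\<lambda>(i, j). a i * b j * h i j)) = (\<Prod>i<n. a i) * (\<Prod>j<n. b j) * det (mat n n (\<lambda>(i, j). h i j :: complex fps))"
proof -
  let ?H = "mat n n (\<lambda>(i, j). h i j)"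
  let ?B = "mat n n (\<lambda>(i, j). b i * ?H\<^sup>T $$ (i, j))"
  have "det (mat n n (\<lambda>(i, j). a i * b j * h i j)) = det (mat n n (\<lambda>(i, j). a i * ?B\<^sup>T $$ (i, j)))"
    by (rule arg_cong[of _ _ det], rule eq_matI) (auto simp: mult.assoc)
  also have "\<dots> = (\<Prod>i<n. a i) * det ?B\<^sup>T"
    by (rule det_scale_rows) simp
  also have "det ?B\<^sup>T = det ?B" by (rule det_transpose[of _ n]) simp
  also have "\<dots> = (\<Prod>j<n. b j) * det ?H\<^sup>T" by (rule det_scale_rows) simp
  also have "det ?H\<^sup>T = det ?H" by (rule det_transpose[of _ n]) simp
  finally show ?thesis by (simp add: mult.assoc)
qed

lemma ev_single_variable:
  assumes "i < M" "\<And>C. \<not> set_mset C \<subseteq> {i} \<Longrightarrow> f C = 0"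
  shows "ev M xi f $ d = f (replicate_mset d i) * xi i ^ d"
proof -
  have rep: "C = replicate_mset (size C) i" if "set_mset C \<subseteq> {i}" for C
    using that by (metis set_mset_subset_singletonD size_replicate_mset)
  have "ev M xi f $ d = (\<Sum>C\<in>{replicate_mset d i}. f C * monval xi C)"
    unfolding ev_nth
  proof (rule sum.mono_neutral_right)
    show "\<forall>C\<in>msets M d - {replicate_mset d i}. f C * monval xi C = 0"
    proof
      fix C assume "C \<in> msets M d - {replicate_mset d i}"
      hence "\<not> set_mset C \<subseteq> {i}" using rep[of C] by (auto simp: msets_def)
      thus "f C * monval xi C = 0" using assms(2) by simp
    qed
  next
    show "{replicate_mset d i} \<subseteq> msets M d" using assms(1) by (auto simp: msets_def)
  qed simp
  thus ?thesis by simp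
qed

text \<open>The factor \<open>xi i ^ (M - 1)\<close> clears the denominators of row
  \<open>i\<close>; the power of \<open>X\<close>, which depends only on the column, restores the
  true degree of the leading term that \<open>phiS\<close> places in degree 0.\<close>

lemma ev_phi_entry:
  assumes "i < M" "j < M" "xi i \<noteq> 0"
  shows "ev M xi (phi_entry N hb M i j) = fps_const (xi i ^ (M - 1)) * fps_X ^ (M - 1 - j) * phiS N hb j (1 / xi i)"
proof (rule fps_ext)
  fix d
  have "ev M xi (phi_entry N hb M i j) $ d = phi_entry N hb M i j (replicate_mset d i) * xi i ^ d"
    by (rule ev_single_variable[OF assms(1)]) (auto simp: phi_entry_def)
  also have "phi_entry N hb M i j (replicate_mset d i) * xi i ^ d =
     (if M - 1 - j \<le> d then phi_coef N hb (int j + 1) (d - (M - 1 - j)) * xi i ^ d else 0)"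
    by (auto simp: phi_entry_def)
  also have "\<dots> = (fps_const (xi i ^ (M - 1)) * fps_X ^ (M - 1 - j) * phiS N hb j (1 / xi i)) $ d"
  proof (cases "M - 1 - j \<le> d")
    case True
    then obtain e where d: "d = M - 1 - j + e" using le_Suc_ex by blast
    have "xi i ^ (M - 1) = xi i ^ (M - 1 - j) * xi i ^ j"
      using assms(2) by (simp flip: power_add)
    thus ?thesis using assms(3)
      by (simp add: d mult.assoc fps_X_power_mult_nth phiS_def power_one_over power_add)
  qed (simp add: mult.assoc fps_X_power_mult_nth)
  finally show "ev M xi (phi_entry N hb M i j) $ d = \<dots>" .
qed

lemma ev_vand_entry:
  assumes "i < M" "j < M" "xi i \<noteq> 0"
  shows "ev M xi (vand_entry M i j) = fps_const (xi i ^ (M - 1)) * fps_X ^ (M - 1 - j) * fps_const ((1 / xi i) ^ j)"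
proof (rule fps_ext)
  fix d
  have "ev M xi (vand_entry M i j) $ d = vand_entry M i j (replicate_mset d i) * xi i ^ d"
    by (rule ev_single_variable[OF assms(1)]) (auto simp: vand_entry_def split: if_splits)
  also have "vand_entry M i j (replicate_mset d i) * xi i ^ d = (if d = M - 1 - j then xi i ^ d else 0)"
    by (auto simp: vand_entry_def dest: arg_cong[of _ _ size])
  also have "\<dots> = (fps_const (xi i ^ (M - 1)) * fps_X ^ (M - 1 - j) * fps_const ((1 / xi i) ^ j)) $ d"
  proof -
    have "xi i ^ (M - 1) = xi i ^ (M - 1 - j) * xi i ^ j"
      using assms(2) by (simp flip: power_add)
    thus ?thesis using assms(3)
      by (simp add: mult.assoc fps_X_power_mult_nth power_one_over)
  qed
  finally show "ev M xi (vand_entry M i j) $ d = \<dots>" .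
qed

text \<open>When the last variable vanishes, only the column whose entry starts with the constant 1
  survives; the last row becomes a unit vector and the determinant loses one variable.\<close>

lemma ev_entry_at_0:
  assumes "xi M = 0" "j \<le> M"
  shows "ev (Suc M) xi (phi_entry N hb (Suc M) M j) = (if j = M then 1 else 0)"
    "ev (Suc M) xi (vand_entry (Suc M) M j) = (if j = M then 1 else 0)"
proof -
  show "ev (Suc M) xi (phi_entry N hb (Suc M) M j) = (if j = M then 1 else 0)"
  proof (rule fps_ext)
    fix d
    have "ev (Suc M) xi (phi_entry N hb (Suc M) M j) $ d = phi_entry N hb (Suc M) M j (replicate_mset d M) * xi M ^ d"
      by (rule ev_single_variable) (auto simp: phi_entry_def)
    thus "ev (Suc M) xi (phi_entry N hb (Suc M) M j) $ d = (if j = M then 1 else 0) $ d"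
      using assms by (cases d) (auto simp: phi_entry_def)
  qed
  show "ev (Suc M) xi (vand_entry (Suc M) M j) = (if j = M then 1 else 0)"
  proof (rule fps_ext)
    fix d
    have "ev (Suc M) xi (vand_entry (Suc M) M j) $ d = vand_entry (Suc M) M j (replicate_mset d M) * xi M ^ d"
      by (rule ev_single_variable) (auto simp: vand_entry_def split: if_splits)
    thus "ev (Suc M) xi (vand_entry (Suc M) M j) $ d = (if j = M then 1 else 0) $ d"
      using assms by (cases d) (auto simp: vand_entry_def dest: arg_cong[of _ _ size])
  qed
qed

lemma det_last_row_unit:
  fixes E :: "nat \<Rightarrow> nat \<Rightarrow> complex fps"
  assumes "\<And>j. j \<le> M \<Longrightarrow> E M j = (if j = M then 1 else 0)"
  shows "det (mat (Suc M) (Suc M) (\<lambda>(i, j). E i j)) = det (mat M M (\<lambda>(i, j). E i j))"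
proof -
  let ?E = "mat (Suc M) (Suc M) (\<lambda>(i, j). E i j)"
  have "det ?E = (\<Sum>j<Suc M. ?E $$ (M, j) * cofactor ?E M j)"
    by (rule laplace_expansion_row) simp_all
  also have "\<dots> = (\<Sum>j<Suc M. if j = M then cofactor ?E M M else 0)"
    by (rule sum.cong) (auto simp: assms)
  also have "\<dots> = cofactor ?E M M" by simp
  also have "mat_delete ?E M M = mat M M (\<lambda>(i, j). E i j)"
    by (rule eq_matI) (auto simp: mat_delete_def)
  hence "cofactor ?E M M = det (mat M M (\<lambda>(i, j). E i j))"
    by (simp add: cofactor_def)
  finally show ?thesis .
qed

text \<open>The size \<open>m\<close> is separate from \<open>M\<close> because specialising the
  last of \<open>M\<close> variables leaves a smaller minor that keeps the exponents of the larger
  determinant.\<close>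

definition row_factor :: "nat \<Rightarrow> (nat \<Rightarrow> complex) \<Rightarrow> nat \<Rightarrow> complex fps" where
  "row_factor m xi M = (\<Prod>i<m. fps_const (xi i ^ (M - 1))) * (\<Prod>j<m. fps_X ^ (M - 1 - j))"

definition det_phi where
  "det_phi N hb M xi = det (mat M M (\<lambda>(i, j). phiS N hb j (1 / xi i)))"
definition det_vand where
  "det_vand M xi = det (mat M M (\<lambda>(i, j). fps_const ((1 / xi i) ^ j :: complex)))"

lemma row_factor_nonzero: "(\<And>i. i < m \<Longrightarrow> xi i \<noteq> 0) \<Longrightarrow> row_factor m xi M \<noteq> 0"
  unfolding row_factor_def by simp

lemma ev_fdet_entries:
  assumes "m \<le> M" "\<And>i. i < m \<Longrightarrow> xi i \<noteq> 0"
  shows "det (mat m m (\<lambda>(i, j). ev M xi (phi_entry N hb M i j))) = row_factor m xi M * det_phi N hb m xi"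
    "det (mat m m (\<lambda>(i, j). ev M xi (vand_entry M i j))) = row_factor m xi M * det_vand m xi"
proof -
  have "mat m m (\<lambda>(i, j). ev M xi (phi_entry N hb M i j)) =
     mat m m (\<lambda>(i, j). fps_const (xi i ^ (M - 1)) * fps_X ^ (M - 1 - j) * phiS N hb j (1 / xi i))"
    using assms by (intro eq_matI) (auto simp: ev_phi_entry)
  thus "det (mat m m (\<lambda>(i, j). ev M xi (phi_entry N hb M i j))) = row_factor m xi M * det_phi N hb m xi"
    unfolding row_factor_def det_phi_def by (simp only: det_scale_rows_cols)
  have "mat m m (\<lambda>(i, j). ev M xi (vand_entry M i j)) =
     mat m m (\<lambda>(i, j). fps_const (xi i ^ (M - 1)) * fps_X ^ (M - 1 - j) * fps_const ((1 / xi i) ^ j))"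
    using assms by (intro eq_matI) (auto simp: ev_vand_entry)
  thus "det (mat m m (\<lambda>(i, j). ev M xi (vand_entry M i j))) = row_factor m xi M * det_vand m xi"
    unfolding row_factor_def det_vand_def by (simp only: det_scale_rows_cols)
qed

lemma det_vand_eq: "det_vand M xi = fps_const (vander (map (\<lambda>i. 1 / xi i) [0..<M]))"
proof -
  let ?A = "mat M M (\<lambda>(i, j). (1 / xi i) ^ j)"
  interpret H: comm_ring_hom "fps_const :: complex \<Rightarrow> complex fps"
    by unfold_locales simp_all
  have "det_vand M xi = det (map_mat fps_const ?A)"
    unfolding det_vand_def by (rule arg_cong[of _ _ det], rule eq_matI) auto
  also have "\<dots> = fps_const (det ?A)" by (rule H.hom_det)
  also have "det ?A = vander (map (\<lambda>i. 1 / xi i) [0..<M])"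
  proof -
    have "?A = mat (length (map (\<lambda>i. 1 / xi i) [0..<M])) (length (map (\<lambda>i. 1 / xi i) [0..<M]))
       (\<lambda>(i, j). (map (\<lambda>i. 1 / xi i) [0..<M] ! i) ^ j)"
      by (rule eq_matI) auto
    thus ?thesis by (simp only: det_vandermonde)
  qed
  finally show ?thesis .
qed

lemma generic_inverse: "generic M xi \<Longrightarrow> generic M (\<lambda>i. 1 / xi i)"
proof -
  assume g: "generic M xi"
  have "1 / xi i \<noteq> 1 / xi j \<and> 1 / xi i + 1 / xi j \<noteq> 0" if "i < M" "j < M" "i \<noteq> j" for i j
  proof -
    have "xi i \<noteq> 0" "xi j \<noteq> 0" "xi i \<noteq> xi j" "xi i + xi j \<noteq> 0" using g that by (auto simp: generic_def)
    thus ?thesis by (auto simp: field_simps)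
  qed
  thus ?thesis using g by (auto simp: generic_def)
qed

lemma det_identity_even:
  assumes "generic M xi" "even M"
  shows "miwa_fps N hb (miwa_time M xi) * det_vand M xi = det_phi N hb M xi"
proof -
  let ?lam = "\<lambda>i. 1 / xi i"
  have "det_phi N hb M xi = phi_det N hb (map ?lam [0..<M])"
    unfolding det_phi_def phi_det_def by (rule arg_cong[of _ _ det], rule eq_matI) auto
  also have "\<dots> = fps_const (vander (map ?lam [0..<M])) * miwa_fps N hb (lam_times M ?lam)"
    by (rule phi_det_even[OF generic_inverse[OF assms(1)] assms(2)])
  also have "lam_times M ?lam = miwa_time M xi" by (simp add: lam_times_def)
  finally show ?thesis by (simp add: det_vand_eq mult.commute)
qed

lemma in_vars_entries:
  "i < M \<Longrightarrow> in_vars M (phi_entry N hb M i j)" "i < M \<Longrightarrow> in_vars M (vand_entry M i j)"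
  by (auto simp: in_vars_def phi_entry_def vand_entry_def split: if_splits)

text \<open>Evaluation multiplies both sides by the same nonzero \<open>row_factor\<close>, and
  values at generic points determine the series.\<close>

lemma tau_equation_iff:
  "(fmul (miwa M (expW N hb)) (fdet M (vand_entry M)) = fdet M (phi_entry N hb M)) \<longleftrightarrow>
   (\<forall>xi. generic M xi \<longrightarrow> miwa_fps N hb (miwa_time M xi) * det_vand M xi = det_phi N hb M xi)"
proof -
  have evl: "ev M xi (fmul (miwa M (expW N hb)) (fdet M (vand_entry M))) = row_factor M xi M * (miwa_fps N hb (miwa_time M xi) * det_vand M xi)"
    and evr: "ev M xi (fdet M (phi_entry N hb M)) = row_factor M xi M * det_phi N hb M xi" if "generic M xi" for xi
  proof -
    have nz: "xi i \<noteq> 0" if "i < M" for i using \<open>generic M xi\<close> that by (rule generic_neq_0)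
    have e: "det (mat M M (\<lambda>(i, j). ev M xi (phi_entry N hb M i j))) = row_factor M xi M * det_phi N hb M xi"
      "det (mat M M (\<lambda>(i, j). ev M xi (vand_entry M i j))) = row_factor M xi M * det_vand M xi"
      using nz by (simp_all add: ev_fdet_entries)
    show "ev M xi (fmul (miwa M (expW N hb)) (fdet M (vand_entry M))) = row_factor M xi M * (miwa_fps N hb (miwa_time M xi) * det_vand M xi)"
      unfolding ev_fmul ev_fdet_eq_det ev_miwa_expW e(2) by (rule mult.left_commute)
    show "ev M xi (fdet M (phi_entry N hb M)) = row_factor M xi M * det_phi N hb M xi"
      unfolding ev_fdet_eq_det by (rule e(1))
  qed
  have nz: "row_factor M xi M \<noteq> 0" if "generic M xi" for xi
    by (rule row_factor_nonzero) (rule generic_neq_0[OF that])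
  have iv: "in_vars M (fmul (miwa M (expW N hb)) (fdet M (vand_entry M)))" "in_vars M (fdet M (phi_entry N hb M))"
    by (rule in_vars_fmul[OF in_vars_miwa in_vars_fdet[OF in_vars_entries(2)]], assumption)
       (rule in_vars_fdet[OF in_vars_entries(1)])
  show ?thesis
  proof
    assume eq: "fmul (miwa M (expW N hb)) (fdet M (vand_entry M)) = fdet M (phi_entry N hb M)"
    show "\<forall>xi. generic M xi \<longrightarrow> miwa_fps N hb (miwa_time M xi) * det_vand M xi = det_phi N hb M xi"
    proof (intro allI impI)
      fix xi assume g: "generic M xi"
      have "row_factor M xi M * (miwa_fps N hb (miwa_time M xi) * det_vand M xi) = row_factor M xi M * det_phi N hb M xi"
        unfolding evl[OF g, symmetric] evr[OF g, symmetric] eq ..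
      thus "miwa_fps N hb (miwa_time M xi) * det_vand M xi = det_phi N hb M xi" using nz[OF g] by simp
    qed
  next
    assume eq: "\<forall>xi. generic M xi \<longrightarrow> miwa_fps N hb (miwa_time M xi) * det_vand M xi = det_phi N hb M xi"
    show "fmul (miwa M (expW N hb)) (fdet M (vand_entry M)) = fdet M (phi_entry N hb M)"
      by (rule ev_eqI[OF iv]) (use eq evl evr in simp)
  qed
qed

lemma tau_equation_expW: "fmul (miwa M (expW N hb)) (fdet M (vand_entry M)) = fdet M (phi_entry N hb M)"
proof (cases "even M")
  case True
  thus ?thesis unfolding tau_equation_iff using det_identity_even by blast
next
  case False
  \<comment> \<open>The equation for \<open>M + 1\<close> variables specialises to that for \<open>M\<close> when the last variable vanishes.\<close>
  have eq: "fmul (miwa (Suc M) (expW N hb)) (fdet (Suc M) (vand_entry (Suc M))) = fdet (Suc M) (phi_entry N hb (Suc M))"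
    unfolding tau_equation_iff using det_identity_even False by simp
  show ?thesis unfolding tau_equation_iff
  proof (intro allI impI)
    fix xi assume g: "generic M xi"
    \<comment> \<open>As a point for \<open>Suc M\<close> variables this is not generic; only the
      identity of series \<open>eq\<close> can be evaluated here.\<close>
    define \<eta> where "\<eta> = xi(M := 0)"
    have \<eta>: "\<eta> M = 0" "\<eta> i \<noteq> 0" "\<eta> i = xi i" if "i < M" for i
      using generic_neq_0[OF g that] that by (auto simp: \<eta>_def)
    have \<eta>M: "\<eta> M = 0" by (simp add: \<eta>_def)
    have nz: "\<eta> i \<noteq> 0" if "i < M" for i using \<eta>(2)[OF that] .
    have time: "miwa_time (Suc M) \<eta> = miwa_time M xi"
    proof
      fix k
      show "miwa_time (Suc M) \<eta> k = miwa_time M xi k"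
        by (cases k) (simp_all add: miwa_time_def \<eta>_def)
    qed
    have dets: "det_vand M \<eta> = det_vand M xi" "det_phi N hb M \<eta> = det_phi N hb M xi"
      unfolding det_vand_def det_phi_def
      by (rule arg_cong[of _ _ det], rule eq_matI, auto simp: \<eta>_def)+
    have L: "ev (Suc M) \<eta> (fdet (Suc M) (vand_entry (Suc M))) = row_factor M \<eta> (Suc M) * det_vand M xi"
      unfolding ev_fdet_eq_det dets(1)[symmetric]
      by (subst det_last_row_unit) (simp_all add: ev_entry_at_0[where xi=\<eta> and M=M, OF \<eta>M] ev_fdet_entries nz)
    have R: "ev (Suc M) \<eta> (fdet (Suc M) (phi_entry N hb (Suc M))) = row_factor M \<eta> (Suc M) * det_phi N hb M xi"
      unfolding ev_fdet_eq_det dets(2)[symmetric]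
      by (subst det_last_row_unit) (simp_all add: ev_entry_at_0[where xi=\<eta> and M=M, OF \<eta>M] ev_fdet_entries nz)
    have "row_factor M \<eta> (Suc M) * (miwa_fps N hb (miwa_time M xi) * det_vand M xi) =
        ev (Suc M) \<eta> (fmul (miwa (Suc M) (expW N hb)) (fdet (Suc M) (vand_entry (Suc M))))"
      unfolding ev_fmul ev_miwa_expW L time by (rule mult.left_commute)
    also have "\<dots> = row_factor M \<eta> (Suc M) * det_phi N hb M xi" unfolding eq R ..
    finally show "miwa_fps N hb (miwa_time M xi) * det_vand M xi = det_phi N hb M xi"
      using row_factor_nonzero[of M \<eta> "Suc M", OF nz] by simp
  qed
qed

lemma is_tau_expW: "is_tau N hb (expW N hb)"
proof -
  have "expW N hb T = 0" if "0 \<in># T" for T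
  proof -
    have "cW N (sum_mset T) T = 0" using homog_cW[of "sum_mset T" N] that unfolding homog_def by force
    thus ?thesis by (simp add: expW_eq)
  qed
  thus ?thesis using tau_equation_expW by (simp add: is_tau_def)
qed

section \<open>Uniqueness and the Virasoro constraints\<close>

definition psum_prod :: "nat \<Rightarrow> nat list \<Rightarrow> mser" where
  "psum_prod M ks = fprod_list (map (\<lambda>k. (\<lambda>D. psum M k D / of_nat k)) ks)"

lemma psum_prod_Nil: "psum_prod M [] = fone"
  by (simp add: psum_prod_def fprod_list_def)

lemma psum_prod_Cons: "psum_prod M (k # ks) = fmul (\<lambda>D. psum M k D / of_nat k) (psum_prod M ks)"
  by (simp add: psum_prod_def fprod_list_def)

text \<open>Each factor is a sum of powers of single variables, so a monomial of the product
  involves at most as many variables as there are factors; if it reaches this number, no two factors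
  share a variable and its exponents are the parts.\<close>

lemma psum_prod_support:
  assumes "psum_prod M ks C \<noteq> 0" "0 \<notin> set ks"
  shows "card (set_mset C) \<le> length ks \<and>
    (card (set_mset C) = length ks \<longrightarrow> image_mset (count C) (mset_set (set_mset C)) = mset ks)"
  using assms
proof (induction ks arbitrary: C)
  case Nil
  thus ?case by (simp add: psum_prod_Nil fone_def split: if_splits)
next
  case (Cons k ks)
  obtain A where A: "A \<subseteq># C" "psum M k A / of_nat k * psum_prod M ks (C - A) \<noteq> 0"
    using sum.not_neutral_contains_not_neutral[OF Cons.prems(1)[unfolded psum_prod_Cons fmul_def]] by blast
  then obtain i where i: "A = replicate_mset k i" by (auto simp: psum_def split: if_splits)
  define D where "D = C - A"
  have C: "C = replicate_mset k i + D" using A(1) i by (simp add: D_def)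
  have k: "k \<noteq> 0" using Cons.prems(2) by simp
  have IH: "card (set_mset D) \<le> length ks" "card (set_mset D) = length ks \<longrightarrow> image_mset (count D) (mset_set (set_mset D)) = mset ks"
  proof -
    have "psum_prod M ks D \<noteq> 0" using A(2) by (simp add: D_def)
    from Cons.IH[OF this] Cons.prems(2)
    show "card (set_mset D) \<le> length ks" "card (set_mset D) = length ks \<longrightarrow> image_mset (count D) (mset_set (set_mset D)) = mset ks"
      by simp_all
  qed
  have S: "set_mset C = insert i (set_mset D)" using k by (simp add: C)
  have le: "card (set_mset C) \<le> Suc (card (set_mset D))" unfolding S by (rule card_insert_le_m1) auto
  show ?case
  proof (intro conjI impI)
    show "card (set_mset C) \<le> length (k # ks)" using le IH(1) by simp
    assume eq: "card (set_mset C) = length (k # ks)"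
    hence D: "card (set_mset D) = length ks" using le IH(1) by simp
    have i: "i \<notin># D"
    proof
      assume "i \<in># D"
      hence "set_mset C = set_mset D" unfolding S by auto
      thus False using eq D by simp
    qed
    have "image_mset (count C) (mset_set (set_mset C)) = add_mset (count C i) (image_mset (count C) (mset_set (set_mset D)))"
      unfolding S using i by simp
    also have "count C i = k" using i by (simp add: C not_in_iff)
    also have "image_mset (count C) (mset_set (set_mset D)) = image_mset (count D) (mset_set (set_mset D))"
      by (rule image_mset_cong) (use i in \<open>auto simp: C\<close>)
    finally show "image_mset (count C) (mset_set (set_mset C)) = mset (k # ks)" using IH(2) D by simp
  qed
qed

text \<open>Nonnegative coefficients exclude cancellation, so that one positive contribution will
  show a coefficient to be nonzero.\<close>

lemma psum_prod_nonneg: "psum_prod M ks C \<in> \<real>\<^sub>\<ge>\<^sub>0"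
proof (induction ks arbitrary: C)
  case Nil
  show ?case by (simp add: psum_prod_Nil fone_def)
next
  case (Cons k ks)
  have "psum M k A / of_nat k \<in> \<real>\<^sub>\<ge>\<^sub>0" for A
    by (simp add: psum_def)
  hence h: "psum M k A / of_nat k * psum_prod M ks (C - A) \<in> \<real>\<^sub>\<ge>\<^sub>0" for A
    using Cons.IH by (rule nonneg_Reals_mult_I)
  have sum: "(\<Sum>A\<in>S. h A) \<in> \<real>\<^sub>\<ge>\<^sub>0" if "\<And>A. h A \<in> \<real>\<^sub>\<ge>\<^sub>0" for S and h :: "nat multiset \<Rightarrow> complex"
    by (induction S rule: infinite_finite_induct) (auto intro: nonneg_Reals_add_I that)
  show ?case unfolding psum_prod_Cons fmul_def by (rule sum, rule h)
qed

fun staircase :: "nat \<Rightarrow> nat list \<Rightarrow> nat multiset" where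
  "staircase n [] = {#}"
| "staircase n (k # ks) = replicate_mset k n + staircase (Suc n) ks"

lemma set_staircase: "0 \<notin> set ks \<Longrightarrow> set_mset (staircase n ks) = {n..<n + length ks}"
  by (induction ks arbitrary: n) auto

lemma size_staircase: "size (staircase n ks) = sum_list ks"
  by (induction ks arbitrary: n) auto

lemma psum_prod_staircase:
  assumes "0 \<notin> set ks" "n + length ks \<le> M"
  shows "0 < Re (psum_prod M ks (staircase n ks))"
  using assms
proof (induction ks arbitrary: n)
  case Nil
  show ?case by (simp add: psum_prod_Nil fone_def)
next
  case (Cons k ks)
  let ?C = "staircase n (k # ks)" and ?A = "replicate_mset k n"
  let ?h = "\<lambda>A. psum M k A / of_nat k * psum_prod M ks (?C - A)"
  have nonneg: "0 \<le> Re (?h A)" for A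
  proof -
    have "?h A \<in> \<real>\<^sub>\<ge>\<^sub>0"
      by (intro nonneg_Reals_mult_I psum_prod_nonneg) (simp add: psum_def)
    thus ?thesis by (simp add: complex_nonneg_Reals_iff)
  qed
  have "psum M k ?A = 1" using Cons.prems(2) unfolding psum_def by (auto intro!: exI[of _ n])
  hence hA: "?h ?A = psum_prod M ks (staircase (Suc n) ks) / of_nat k" by simp
  have "0 < Re (?h ?A)"
    unfolding hA using Cons.IH[of "Suc n"] Cons.prems by (simp add: Re_divide_of_nat)
  also have "Re (?h ?A) \<le> (\<Sum>A\<in>{A. A \<subseteq># ?C}. Re (?h A))"
    by (rule member_le_sum) (use nonneg in auto)
  also have "\<dots> = Re (psum_prod M (k # ks) ?C)"
    by (simp add: psum_prod_Cons fmul_def)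
  finally show ?case .
qed

lemma miwa_psum_prod: "miwa M \<tau> C = (\<Sum>T\<in>Wt (size C). \<tau> T * psum_prod M (sorted_list_of_multiset T) C)"
  by (simp add: miwa_def Wt_def psum_prod_def)

text \<open>Among the time monomials of a given weight in the support, one with the most factors is
detected by the variable monomial carrying each part on its own variable.\<close>
lemma miwa_injective:
  assumes eq: "\<And>M. M \<ge> 1 \<Longrightarrow> miwa M \<sigma> = miwa M \<tau>"
    and zero: "\<And>T. 0 \<in># T \<Longrightarrow> \<sigma> T = \<tau> T"
  shows "\<sigma> = \<tau>"
proof (rule ccontr)
  define \<delta> where "\<delta> T = \<sigma> T - \<tau> T" for T
  assume "\<sigma> \<noteq> \<tau>"
  then obtain T0 where "\<delta> T0 \<noteq> 0" by (auto simp: \<delta>_def fun_eq_iff)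
  define d where "d = sum_mset T0"
  let ?S = "{T \<in> Wt d. \<delta> T \<noteq> 0}"
  have "T0 \<in> ?S" using \<open>\<delta> T0 \<noteq> 0\<close> zero[of T0] by (auto simp: Wt_def d_def \<delta>_def)
  moreover have finS: "finite ?S" by simp
  ultimately have "Max (size ` ?S) \<in> size ` ?S" by (intro Max_in) auto
  then obtain T where T: "T \<in> ?S" "size T = Max (size ` ?S)" by auto
  have max: "size T' \<le> size T" if "T' \<in> ?S" for T'
    unfolding T(2) using finS that by auto
  define ks where "ks = sorted_list_of_multiset T"
  \<comment> \<open>At least one variable for each factor of \<open>T\<close>, and positive even if
    \<open>T\<close> is empty.\<close>
  define M where "M = Suc (size T)"
  define C where "C = staircase 0 ks"
  have ks: "0 \<notin> set ks" "length ks = size T" "mset ks = T" "sum_list ks = d"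
    using T(1) by (auto simp: ks_def Wt_def simp flip: size_mset sum_mset_sum_list)
  have sizeC: "size C = d" by (simp add: C_def size_staircase ks)
  have cardC: "card (set_mset C) = size T" by (simp add: C_def set_staircase ks)
  have nz: "psum_prod M ks C \<noteq> 0"
    using psum_prod_staircase[OF ks(1), of 0 M] ks(2) by (auto simp: M_def C_def)
  have TC: "image_mset (count C) (mset_set (set_mset C)) = T"
    using psum_prod_support[OF nz ks(1)] cardC ks by simp
  have other: "\<delta> T' * psum_prod M (sorted_list_of_multiset T') C = 0" if "T' \<in> Wt d" "T' \<noteq> T" for T'
  proof (rule ccontr)
    assume ne: "\<delta> T' * psum_prod M (sorted_list_of_multiset T') C \<noteq> 0"
    have "0 \<notin> set (sorted_list_of_multiset T')" using that(1) by (simp add: Wt_def)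
    from psum_prod_support[OF _ this, of M C] ne
    have P: "card (set_mset C) \<le> length (sorted_list_of_multiset T')"
      "card (set_mset C) = length (sorted_list_of_multiset T') \<longrightarrow> image_mset (count C) (mset_set (set_mset C)) = T'"
      by auto
    have len: "length (sorted_list_of_multiset T') = size T'" by (simp flip: size_mset)
    have "size T' \<le> size T" by (rule max) (use ne that in auto)
    hence "card (set_mset C) = size T'" using P(1) cardC len by simp
    hence "T = T'" using P(2) TC len by simp
    thus False using that(2) by simp
  qed
  have "0 = miwa M \<sigma> C - miwa M \<tau> C" using eq[of M] by (simp add: M_def)
  also have "\<dots> = (\<Sum>T'\<in>Wt d. \<delta> T' * psum_prod M (sorted_list_of_multiset T') C)"
    unfolding miwa_psum_prod sizeC by (simp add: \<delta>_def left_diff_distrib sum_subtractf)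
  also have "\<dots> = (\<Sum>T'\<in>{T}. \<delta> T' * psum_prod M (sorted_list_of_multiset T') C)"
    by (rule sum.mono_neutral_right) (use other T(1) in auto)
  also have "\<dots> = \<delta> T * psum_prod M ks C" by (simp add: ks_def)
  finally show False using nz T(1) by simp
qed

text \<open>At a generic point the Vandermonde determinant is a nonzero element of an integral
  domain and cancels, which leaves the injectivity of the Miwa substitutions.\<close>

lemma is_tau_unique:
  assumes "is_tau N hb \<sigma>" "is_tau N hb \<tau>"
  shows "\<sigma> = \<tau>"
proof (rule miwa_injective)
  fix M :: nat assume "M \<ge> 1"
  hence eq: "fmul (miwa M \<sigma>) (fdet M (vand_entry M)) = fmul (miwa M \<tau>) (fdet M (vand_entry M))"
    using assms unfolding is_tau_def by simp
  show "miwa M \<sigma> = miwa M \<tau>"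
  proof (rule ev_eqI[OF in_vars_miwa in_vars_miwa])
    fix xi assume g: "generic M xi"
    have nz: "xi i \<noteq> 0" if "i < M" for i by (rule generic_neq_0[OF g that])
    have "ev M xi (fdet M (vand_entry M)) = row_factor M xi M * det_vand M xi"
      unfolding ev_fdet_eq_det by (rule ev_fdet_entries(2)[OF order_refl nz])
    moreover have "row_factor M xi M \<noteq> 0" by (rule row_factor_nonzero[OF nz])
    moreover have "det_vand M xi \<noteq> 0"
    proof -
      have "distinct (map (\<lambda>i. 1 / xi i) [0..<M])"
        using generic_list_map[OF generic_inverse[OF g]] by (simp add: generic_list_def)
      from vander_nonzero[OF this] show ?thesis unfolding det_vand_eq by simp
    qed
    ultimately have "ev M xi (fdet M (vand_entry M)) \<noteq> 0" by simp
    thus "ev M xi (miwa M \<sigma>) = ev M xi (miwa M \<tau>)"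
      using arg_cong[OF eq, of "ev M xi"] unfolding ev_fmul by simp
  qed
next
  show "\<sigma> T = \<tau> T" if "0 \<in># T" for T using assms that unfolding is_tau_def by simp
qed

lemma tauN_eq_expW: "tauN N hb = expW N hb"
  unfolding tauN_def by (rule the_equality) (rule is_tau_expW, rule is_tau_unique[OF _ is_tau_expW])

section \<open>The Virasoro constraints\<close>

lemma tmul_dt: "tmul k (dt k F) T = of_nat (count T k) * F T"
proof (cases "k \<in># T")
  case True
  then obtain T' where T: "T = add_mset k T'" by (auto dest: multi_member_split)
  show ?thesis unfolding T by (simp add: dt_def add.commute)
next
  case False
  moreover from this have "count T k = 0" by (simp add: not_in_iff)
  ultimately show ?thesis by (simp add: tmul_def)
qed

lemma sum_odd_parts:
  assumes "\<forall>i\<in>#T. odd i" "sum_mset T < B"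
  shows "(\<Sum>m<B. (2 * m + 1) * count T (2 * m + 1)) = sum_mset T"
  using assms
proof (induction T)
  case (add x T)
  obtain s where s: "x = 2 * s + 1" using add.prems(1) by (auto elim: oddE)
  hence "s < B" using add.prems(2) by simp
  have "(\<Sum>m<B. (2 * m + 1) * count (add_mset x T) (2 * m + 1)) =
     (\<Sum>m<B. (if m = s then x else 0) + (2 * m + 1) * count T (2 * m + 1))"
    by (rule sum.cong) (auto simp: s)
  also have "\<dots> = x + sum_mset T" using add \<open>s < B\<close> by (simp add: sum.distrib)
  finally show ?case by simp
qed simp

lemma Lvir_finite:
  assumes "sum_mset S < B"
  shows "Lvir N m F S = 1/2 * (\<Sum>k<B. of_nat (2*k+1) * tmul (2*k+1) (dt (2*k+2*m+1) F) S)
   + 1/4 * (\<Sum>a<m. dt (2*a+1) (dt (2*(m-1-a)+1) F) S) + (if m = 0 then 1/16 - N^2/4 else 0) * F S"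
proof -
  have "(\<Sum>\<^sub>\<infinity>k\<in>UNIV. of_nat (2*k+1) * tmul (2*k+1) (dt (2*k+2*m+1) F) S) =
     (\<Sum>k<B. of_nat (2*k+1) * tmul (2*k+1) (dt (2*k+2*m+1) F) S)"
  proof (rule infsum_eq_sum)
    fix k assume k: "k \<notin> {..<B}"
    have "tmul (2*k+1) (dt (2*k+2*m+1) F) S = 0"
    proof (rule ccontr)
      assume "\<not> ?thesis"
      then obtain S' where "S = add_mset (2*k+1) S'" using tmul_nonzeroD by blast
      thus False using assms k by simp
    qed
    thus "of_nat (2*k+1) * tmul (2*k+1) (dt (2*k+2*m+1) F) S = 0" by simp
  qed simp
  thus ?thesis by (simp add: Lvir_def)
qed

text \<open>The second-order terms of \<open>Lvir N m\<close> with \<open>a + b = m - 1\<close>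
  match the pair \<open>(a, b)\<close> in \<open>Wop\<close>, as
  \<open>2 * m + 1 = 2 * a + 2 * b + 3\<close>; the constant occurs only for \<open>m = 0\<close>
  and is multiplied by \<open>t_1\<close>.\<close>

lemma sum_Lvir_eq_Wop:
  assumes B: "sum_mset T < B"
  shows "(\<Sum>m<B. of_nat (2*m+1) * tmul (2*m+1) (Lvir N m F) T) = Wop N F T"
proof -
  let ?r = "1/16 - N^2/4"
  let ?L1 = "\<lambda>m k. of_nat (2*k+1) * tmul (2*m+1) (tmul (2*k+1) (dt (2*k+2*m+1) F)) T"
  let ?g = "\<lambda>k m. of_nat (2*k+2*m+3) * tmul (2*k+2*m+3) (dt (2*k+1) (dt (2*m+1) F)) T"
  let ?L2 = "\<lambda>m. \<Sum>a<m. of_nat (2*m+1) * tmul (2*m+1) (dt (2*a+1) (dt (2*(m-1-a)+1) F)) T"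
  have exp: "tmul (2*m+1) (Lvir N m F) T = 1/2 * (\<Sum>k<B. ?L1 m k)
     + 1/4 * (\<Sum>a<m. tmul (2*m+1) (dt (2*a+1) (dt (2*(m-1-a)+1) F)) T) + (if m = 0 then ?r * tmul 1 F T else 0)" for m
  proof (cases "2 * m + 1 \<in># T")
    case True
    then obtain S where T: "T = add_mset (2*m+1) S" by (auto dest: multi_member_split)
    have "sum_mset S < B" using B by (simp add: T)
    from Lvir_finite[OF this, of N m F] show ?thesis
      unfolding T tmul_add_mset by (cases "m = 0") simp_all
  next
    case False
    thus ?thesis by (cases "m = 0") (simp_all add: tmul_def)
  qed
  have gz: "?g k m = 0" if "k + m + 1 \<ge> B" for k m
  proof -
    have "tmul (2*k+2*m+3) (dt (2*k+1) (dt (2*m+1) F)) T = 0"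
    proof (rule ccontr)
      assume "\<not> ?thesis"
      then obtain S' where "T = add_mset (2*k+2*m+3) S'" using tmul_nonzeroD by blast
      thus False using B that by simp
    qed
    thus ?thesis by simp
  qed
  have L2: "?L2 (Suc s) = (\<Sum>k\<le>s. ?g k (s - k))" for s
    unfolding lessThan_Suc_atMost
  proof (rule sum.cong[OF refl])
    fix a assume "a \<in> {..s}"
    hence "2 * Suc s + 1 = 2*a+2*(s-a)+3" "Suc s - 1 - a = s - a" by simp_all
    thus "of_nat (2 * Suc s + 1) * tmul (2 * Suc s + 1) (dt (2*a+1) (dt (2*(Suc s - 1 - a)+1) F)) T = ?g a (s - a)"
      by presburger
  qed
  have "(\<Sum>(k,m)\<in>{..<B}\<times>{..<B}. ?g k m) = (\<Sum>(k,m)\<in>{(k,m). k + m < B}. ?g k m)"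
  proof (rule sum.mono_neutral_right)
    show "\<forall>p\<in>{..<B} \<times> {..<B} - {(k, m). k + m < B}. (case p of (k, m) \<Rightarrow> ?g k m) = 0"
    proof
      fix p assume "p \<in> {..<B} \<times> {..<B} - {(k, m). k + m < B}"
      moreover obtain k m where "p = (k, m)" by (cases p)
      ultimately show "(case p of (k, m) \<Rightarrow> ?g k m) = 0" using gz[of k m] by simp
    qed
  qed auto
  also have "\<dots> = (\<Sum>s<B. \<Sum>k\<le>s. ?g k (s - k))" by (rule sum.triangle_reindex)
  also have "\<dots> = (\<Sum>s<B. ?L2 (Suc s))" by (simp only: L2)
  \<comment> \<open>Shift to \<open>m = s + 1\<close>: there are no second-order terms for
    \<open>m = 0\<close>, and the extra term \<open>m = B\<close> vanishes by weight.\<close>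
  also have "\<dots> = (\<Sum>m<Suc B. ?L2 m)" unfolding sum.lessThan_Suc_shift by simp
  also have "\<dots> = (\<Sum>m<B. ?L2 m)"
  proof -
    have "?L2 B = 0"
    proof (cases B)
      case (Suc s)
      show ?thesis unfolding Suc L2
      proof (rule sum.neutral, rule ballI)
        fix k assume "k \<in> {..s}"
        thus "?g k (s - k) = 0" by (intro gz) (simp add: Suc)
      qed
    qed simp
    thus ?thesis by simp
  qed
  finally have second: "(\<Sum>(k,m)\<in>{..<B}\<times>{..<B}. ?g k m) = (\<Sum>m<B. ?L2 m)" .
  have first: "(\<Sum>(k,m)\<in>{..<B}\<times>{..<B}. of_nat ((2*k+1)*(2*m+1)) * tmul (2*k+1) (tmul (2*m+1) (dt (2*k+2*m+1) F)) T) =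
     (\<Sum>m<B. \<Sum>k<B. of_nat (2*m+1) * ?L1 m k)"
    unfolding sum.cartesian_product[symmetric]
    by (intro sum.cong refl) (simp only: of_nat_mult mult.assoc add.commute[of "2 * _" "2 * _"])
  have third: "(\<Sum>m<B. of_nat (2*m+1) * (if m = 0 then ?r * tmul 1 F T else 0)) = ?r * tmul 1 F T"
  proof -
    have "(\<Sum>m<B. of_nat (2*m+1) * (if m = 0 then ?r * tmul 1 F T else 0)) =
       (\<Sum>m<B. if m = 0 then ?r * tmul 1 F T else 0)"
      by (rule sum.cong) auto
    thus ?thesis using B by simp
  qed
  have "(\<Sum>m<B. of_nat (2*m+1) * tmul (2*m+1) (Lvir N m F) T) =
     1/2 * (\<Sum>m<B. \<Sum>k<B. of_nat (2*m+1) * ?L1 m k) + 1/4 * (\<Sum>m<B. ?L2 m) +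
     (\<Sum>m<B. of_nat (2*m+1) * (if m = 0 then ?r * tmul 1 F T else 0))"
    unfolding exp distrib_left sum.distrib sum_distrib_left by (simp only: mult.left_commute)
  thus ?thesis unfolding third Wop_eq_Wfin[OF B] Wfin_def first second by simp
qed

text \<open>On the derivative side, the weighted sum of the constraints is the full Euler operator
  because only odd times occur in \<open>Z\<close>.\<close>

lemma virasoro_imp_euler:
  assumes odd: "\<And>T. Z T \<noteq> 0 \<Longrightarrow> \<forall>i\<in>#T. odd i" and vir: "\<And>m. (\<lambda>T. hb * Lvir N m Z T) = dt (2*m+1) Z"
  shows "of_nat (sum_mset T) * Z T = hb * Wop N Z T"
proof -
  let ?B = "Suc (sum_mset T)"
  have "hb * Wop N Z T = (\<Sum>m<?B. of_nat (2*m+1) * tmul (2*m+1) (\<lambda>T. hb * Lvir N m Z T) T)"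
    unfolding sum_Lvir_eq_Wop[OF lessI, symmetric] tmul_scale sum_distrib_left by (simp only: mult.left_commute)
  also have "\<dots> = (\<Sum>m<?B. of_nat (2*m+1) * (of_nat (count T (2*m+1)) * Z T))"
    unfolding vir tmul_dt ..
  also have "\<dots> = of_nat (\<Sum>m<?B. (2*m+1) * count T (2*m+1)) * Z T"
    by (simp only: of_nat_sum of_nat_mult sum_distrib_right mult.assoc)
  also have "\<dots> = of_nat (sum_mset T) * Z T"
    using odd[of T] sum_odd_parts[of T ?B] by (cases "Z T = 0") auto
  finally show ?thesis by simp
qed

text \<open>Since \<open>W\<close> raises the weight by one, a coefficient of its result depends
  only on coefficients one weight lower. This permits induction on the weight for series with
  infinite support.\<close>

lemma Wop_local:
  assumes "\<And>S. Suc (sum_mset S) = sum_mset T \<Longrightarrow> F S = G S"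
  shows "Wop N F T = Wop N G T"
proof -
  have 1: "tmul (2*k+1) (tmul (2*m+1) (dt (2*k+2*m+1) F)) T = tmul (2*k+1) (tmul (2*m+1) (dt (2*k+2*m+1) G)) T" for k m
  proof (cases "2*k+1 \<in># T \<and> 2*m+1 \<in># T - {#2*k+1#}")
    case True
    then obtain S where T: "T = add_mset (2*k+1) (add_mset (2*m+1) S)" by (metis insert_DiffM)
    show ?thesis unfolding T tmul_add_mset dt_def using assms by (simp add: T)
  qed (auto simp: tmul_def)
  have 2: "tmul (2*k+2*m+3) (dt (2*k+1) (dt (2*m+1) F)) T = tmul (2*k+2*m+3) (dt (2*k+1) (dt (2*m+1) G)) T" for k m
  proof (cases "2*k+2*m+3 \<in># T")
    case True
    then obtain S where T: "T = add_mset (2*k+2*m+3) S" by (auto dest: multi_member_split)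
    show ?thesis unfolding T tmul_add_mset dt_def using assms by (simp add: T)
  qed (simp add: tmul_def)
  have 3: "tmul 1 F T = tmul 1 G T"
  proof (cases "1 \<in># T")
    case True
    then obtain S where T: "T = add_mset 1 S" by (auto dest: multi_member_split)
    show ?thesis unfolding T tmul_add_mset using assms by (simp add: T)
  qed (simp add: tmul_def)
  show ?thesis unfolding Wop_def 1 2 3 ..
qed

lemma expW_euler: "of_nat (sum_mset T) * expW N hb T = hb * Wop N (expW N hb) T"
proof (cases "sum_mset T")
  case 0
  \<comment> \<open>No monomial has weight \<open>-1\<close>, so locality allows the series to be
    replaced by zero.\<close>
  have "Wop N (expW N hb) T = Wop N (\<lambda>T. 0 * fone T) T" by (rule Wop_local) (simp add: 0)
  also have "\<dots> = 0" unfolding Wop_scale by simp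
  finally have "Wop N (expW N hb) T = 0" .
  thus ?thesis unfolding 0 by simp
next
  case (Suc n)
  have "Wop N (expW N hb) T = Wop N (\<lambda>S. hb ^ n * cW N n S) T"
    by (rule Wop_local) (use Suc in \<open>simp add: expW_eq\<close>)
  also have "\<dots> = hb ^ n * (of_nat (Suc n) * cW N (Suc n) T)"
    unfolding Wop_scale by (simp add: cW_Suc del: of_nat_Suc)
  finally show ?thesis by (simp add: expW_eq Suc)
qed

lemma virasoro_solution:
  assumes odd: "\<And>T. Z T \<noteq> 0 \<Longrightarrow> \<forall>i\<in>#T. odd i" and vir: "\<And>m. (\<lambda>T. hb * Lvir N m Z T) = dt (2*m+1) Z"
  shows "Z = (\<lambda>T. Z {#} * expW N hb T)"
proof
  fix T
  show "Z T = Z {#} * expW N hb T"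
  proof (induction "sum_mset T" arbitrary: T)
    case 0
    show ?case
    \<comment> \<open>Weight 0 alone does not make \<open>T\<close> empty, because the index 0 has
      weight 0; monomials containing it are absent from both series.\<close>
    proof (cases "0 \<in># T")
      case True
      have "Z T = 0" using odd[of T] True by fastforce
      moreover have "expW N hb T = 0" using is_tau_expW True unfolding is_tau_def by blast
      ultimately show ?thesis by simp
    next
      case False
      hence "size T \<le> sum_mset T" by (rule size_le_sum_mset)
      also have "\<dots> = 0" using 0 by simp
      finally have "T = {#}" by simp
      thus ?thesis by (simp add: expW_eq cW_0 fone_def)
    qed
  next
    case (Suc n)
    have "of_nat (Suc n) * Z T = hb * Wop N Z T"
      unfolding Suc.hyps(2) by (rule virasoro_imp_euler[OF odd vir])
    also have "Wop N Z T = Wop N (\<lambda>S. Z {#} * expW N hb S) T"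
      by (rule Wop_local) (use Suc.hyps in auto)
    also have "hb * \<dots> = Z {#} * (hb * Wop N (expW N hb) T)"
      unfolding Wop_scale by (rule mult.left_commute)
    also have "\<dots> = of_nat (Suc n) * (Z {#} * expW N hb T)"
      unfolding expW_euler[symmetric] Suc.hyps(2)[symmetric] by (rule mult.left_commute)
    finally show ?case by (simp del: of_nat_Suc)
  qed
qed

theorem mainTheorem4:
  fixes N hb :: complex
  assumes "hb \<noteq> 0"
  shows "tauN N hb = expW N hb
    \<and> (\<exists>c :: nat \<Rightarrow> mser. c 0 = fone
          \<and> (\<forall>k. c (Suc k) = (\<lambda>T. Wop N (c k) T / of_nat (Suc k)))
          \<and> (\<forall>h. h \<noteq> 0 \<longrightarrow> tauN N h = (\<lambda>T. \<Sum>k. h^k * c k T)))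
    \<and> (\<forall>Z :: mser. (\<forall>T. Z T \<noteq> 0 \<longrightarrow> (\<forall>i\<in>#T. odd i))
          \<and> (\<forall>m. (\<lambda>T. hb * Lvir N m Z T) = dt (2*m+1) Z)
          \<longrightarrow> (\<exists>C. Z = (\<lambda>T. C * expW N hb T)))
    \<and> tauN 0 hb = expW 0 hb"
proof (intro conjI)
  show "\<exists>c :: nat \<Rightarrow> mser. c 0 = fone
          \<and> (\<forall>k. c (Suc k) = (\<lambda>T. Wop N (c k) T / of_nat (Suc k)))
          \<and> (\<forall>h. h \<noteq> 0 \<longrightarrow> tauN N h = (\<lambda>T. \<Sum>k. h^k * c k T))"
  \<comment> \<open>The witness is free of \<open>h\<close>, so one family serves all values of the
    parameter.\<close>
  proof (intro exI[of _ "cW N"] conjI allI impI)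
    show "tauN N h = (\<lambda>T. \<Sum>k. h^k * cW N k T)" for h
      unfolding tauN_eq_expW by (rule ext) (simp add: expW_def cW_def)
  qed (rule cW_0 cW_Suc)+
  show "\<forall>Z :: mser. (\<forall>T. Z T \<noteq> 0 \<longrightarrow> (\<forall>i\<in>#T. odd i))
          \<and> (\<forall>m. (\<lambda>T. hb * Lvir N m Z T) = dt (2*m+1) Z)
          \<longrightarrow> (\<exists>C. Z = (\<lambda>T. C * expW N hb T))"
  proof (intro allI impI)
    fix Z :: mser
    assume "(\<forall>T. Z T \<noteq> 0 \<longrightarrow> (\<forall>i\<in>#T. odd i)) \<and> (\<forall>m. (\<lambda>T. hb * Lvir N m Z T) = dt (2*m+1) Z)"
    thus "\<exists>C. Z = (\<lambda>T. C * expW N hb T)" by (intro exI[of _ "Z {#}"] virasoro_solution) blast+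
  qed
qed (rule tauN_eq_expW)+

end
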